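(* Let $l\ge 1$, let $T\subset\mathbb{Z}^n$ be an $l$-dimensional vector semigroup, and let $(g^y\mid y\in T)$ be an ergodic action of $T$ on a probability space $(\Omega,\mathsf{P})$. Let $S\subset\mathbb{Z}^m$ be another vector semigroup, $\pi\colon S\to T$ a nontrivial semigroup homomorphism, and put $f^x=g^{\pi(x)}$ for all $x\in S$. Let $h=(h(x)\mid x\in S)$ be an $f$-subadditive random function on $S$ which is dominated by some nonnegative random function $h_+=(h_+(x)\mid x\in S)$, i.e. $h(x,\omega)\le h_+(x,\omega)$ for all $x\in S$, $\omega\in\Omega$, such that for all $a\in S$: (a) $h_+(a)\in L^l(\mathsf{P})$, and (b) the family of random variables $(\omega\mapsto h_+(a,g^y\omega)\mid y\in T)$ is almost independent. Let $O$ denote the asymptotic cone of $S$ and $q\colon O\to[-\infty;\infty)$ the gauge associated with $h$. Then there exists a measurable set $W\subset\Omega$ with $\mathsf{P}(W)=1$ such that $$\frac{h(x_n,\omega)}{|x_n|}\to q(x)\quad\text{as } n\to\infty$$ for all $\omega\in W$, all $x\in O$ and all sequences $(x_n)\subset S$ with asymptotic direction $x$.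
   Context: $|\cdot|$ denotes a fixed norm (on $\mathbb{R}^m$, respectively $\mathbb{R}^n$); $\mathbb{N}=\{1,2,\dots\}$. A vector semigroup is a nonempty $S\subset\mathbb{Z}^m$ with $x+y\in S$ for all $x,y\in S$; it is $k$-dimensional if its linear hull $\mathrm{lin}(S)\subset\mathbb{R}^m$ has dimension $k$. A semigroup homomorphism $\pi\colon S\to T$ satisfies $\pi(x+y)=\pi(x)+\pi(y)$ for all $x,y\in S$; it is nontrivial if $\pi(x)\ne0$ for some $x\ne0$ in $S$. An action of a vector semigroup $T$ on a probability space $(\Omega,\mathsf{P})$ is a family $(g^y\mid y\in T)$ of measurable measure-preserving maps $\Omega\to\Omega$ with $g^{y+z}=g^y\circ g^z$ for all $y,z\in T$ and, if $0\in T$, $g^0=\mathrm{id}$. It is ergodic if for every $y\in T\setminus\{0\}$ every measurable $W\subset\Omega$ with $(g^y)^{-1}(W)=W$ has $\mathsf{P}(W)\in\{0,1\}$. A random function on $S$ is a family $h=(h(x)\mid x\in S)$ of real random variables on $\Omega$; $h(x,\omega)$ is the value of $h(x)$ at $\omega$. It is $f$-subadditive if $h(x+y,\omega)\le h(x,\omega)+h(y,f^x\omega)$ for all $x,y\in S$, $\omega\in\Omega$, and $h(0)=0$ in case $0\in S$. A family of random variables $(Z_y\mid y\in T)$ is almost independent if there exists $c<\infty$ such that for all nonempty $A,B\subset T$ with $\rho(A,B)>c$ the subfamilies $(Z_y\mid y\in A)$ and $(Z_y\mid y\in B)$ are independent, where $\rho(A,B)=\inf_{x\in A,y\in B}|x-y|$.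 The asymptotic cone of $S$ is $O=\mathrm{int}(\mathrm{cone}(S))$, where $\mathrm{cone}(S)$ is the set of finite nonnegative linear combinations of elements of $S$ and the interior is taken relative to $\mathrm{lin}(S)$. A gauge on $O$ is a function $q\colon O\to[-\infty;\infty)$ with $q(x+y)\le q(x)+q(y)$ and $q(sx)=sq(x)$ for all $x,y\in O$ and real $s>0$. The gauge associated with $h$ is the unique gauge $q$ on $O$ such that for every $x\in O\cap S$ almost surely $h(nx)/n\to q(x)$ as $n\to\infty$. A sequence $(x_n)\subset S$ has asymptotic direction $x$ if $|x_n|\to\infty$ and $x_n/|x_n|\to x$. *)

theory Defs
  imports "HOL-Probability.Probability"
begin

text \<open>The fixed norms are arbitrary norms on Euclidean space, not necessarily the library's
  Euclidean \<^const>\<open>norm\<close>.\<close>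

definition norm_function :: "('v::real_vector \<Rightarrow> real) \<Rightarrow> bool" where
  "norm_function N \<longleftrightarrow>
     (\<forall>x y. N (x + y) \<le> N x + N y) \<and>
     (\<forall>c x. N (c *\<^sub>R x) = \<bar>c\<bar> * N x) \<and>
     (\<forall>x. N x = 0 \<longrightarrow> x = 0)"

text \<open>The integer lattice is taken inside real Euclidean space, so that linear hulls, cones and
  directions need no coercions.\<close>

definition int_lattice :: "(real ^ 'm) set" where
  "int_lattice = {x. \<forall>i. x $ i \<in> \<int>}"

definition vector_semigroup :: "(real ^ 'm) set \<Rightarrow> bool" where
  "vector_semigroup S \<longleftrightarrow>
     S \<noteq> {} \<and> S \<subseteq> int_lattice \<and> (\<forall>x\<in>S. \<forall>y\<in>S. x + y \<in> S)"

definition semigroup_dim :: "(real ^ 'm) set \<Rightarrow> nat" where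
  "semigroup_dim S = dim (span S)"

definition semigroup_hom ::
    "(real ^ 'm) set \<Rightarrow> (real ^ 'n) set \<Rightarrow> (real ^ 'm \<Rightarrow> real ^ 'n) \<Rightarrow> bool" where
  "semigroup_hom S T \<pi> \<longleftrightarrow>
     (\<forall>x\<in>S. \<pi> x \<in> T) \<and> (\<forall>x\<in>S. \<forall>y\<in>S. \<pi> (x + y) = \<pi> x + \<pi> y)"

definition nontrivial_on :: "(real ^ 'm) set \<Rightarrow> (real ^ 'm \<Rightarrow> real ^ 'n) \<Rightarrow> bool" where
  "nontrivial_on S \<pi> \<longleftrightarrow> (\<exists>x\<in>S. x \<noteq> 0 \<and> \<pi> x \<noteq> 0)"

definition measure_preserving_map :: "'a measure \<Rightarrow> ('a \<Rightarrow> 'a) \<Rightarrow> bool" where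
  "measure_preserving_map M \<phi> \<longleftrightarrow>
     \<phi> \<in> measurable M M \<and> (\<forall>A\<in>sets M. emeasure M (\<phi> -` A \<inter> space M) = emeasure M A)"

definition semigroup_action ::
    "'a measure \<Rightarrow> (real ^ 'n) set \<Rightarrow> (real ^ 'n \<Rightarrow> 'a \<Rightarrow> 'a) \<Rightarrow> bool" where
  "semigroup_action M T g \<longleftrightarrow>
     (\<forall>y\<in>T. measure_preserving_map M (g y)) \<and>
     (\<forall>y\<in>T. \<forall>z\<in>T. \<forall>\<omega>\<in>space M. g (y + z) \<omega> = g y (g z \<omega>)) \<and>
     (0 \<in> T \<longrightarrow> (\<forall>\<omega>\<in>space M. g 0 \<omega> = \<omega>))"

text \<open>Every single nonzero element of \<open>T\<close> is required to act ergodically.\<close>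

definition ergodic_action ::
    "'a measure \<Rightarrow> (real ^ 'n) set \<Rightarrow> (real ^ 'n \<Rightarrow> 'a \<Rightarrow> 'a) \<Rightarrow> bool" where
  "ergodic_action M T g \<longleftrightarrow>
     semigroup_action M T g \<and>
     (\<forall>y\<in>T - {0}. \<forall>W\<in>sets M. g y -` W \<inter> space M = W \<longrightarrow> measure M W \<in> {0, 1})"

definition random_function ::
    "'a measure \<Rightarrow> (real ^ 'm) set \<Rightarrow> (real ^ 'm \<Rightarrow> 'a \<Rightarrow> real) \<Rightarrow> bool" where
  "random_function M S h \<longleftrightarrow> (\<forall>x\<in>S. h x \<in> borel_measurable M)"

definition subadditive_random_function ::
    "'a measure \<Rightarrow> (real ^ 'm) set \<Rightarrow> (real ^ 'm \<Rightarrow> 'a \<Rightarrow> 'a) \<Rightarrow>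
     (real ^ 'm \<Rightarrow> 'a \<Rightarrow> real) \<Rightarrow> bool" where
  "subadditive_random_function M S f h \<longleftrightarrow>
     random_function M S h \<and>
     (\<forall>x\<in>S. \<forall>y\<in>S. \<forall>\<omega>\<in>space M. h (x + y) \<omega> \<le> h x \<omega> + h y (f x \<omega>)) \<and>
     (0 \<in> S \<longrightarrow> (\<forall>\<omega>\<in>space M. h 0 \<omega> = 0))"

text \<open>Used for nonempty sets only; the infimum is taken in \<^typ>\<open>real\<close>.\<close>

definition set_distance :: "('v::real_vector \<Rightarrow> real) \<Rightarrow> 'v set \<Rightarrow> 'v set \<Rightarrow> real" where
  "set_distance N A B = Inf {N (x - y) | x y. x \<in> A \<and> y \<in> B}"

text \<open>Independence of two subfamilies is independence of the random elements of the product
  spaces \<open>\<real>\<^sup>A\<close> and \<open>\<real>\<^sup>B\<close> that they form, that is, of the sigma-algebras they generate.\<close>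

definition almost_independent ::
    "'a measure \<Rightarrow> ('v::real_vector \<Rightarrow> real) \<Rightarrow> 'v set \<Rightarrow> ('v \<Rightarrow> 'a \<Rightarrow> real) \<Rightarrow> bool" where
  "almost_independent M N T Z \<longleftrightarrow>
     (\<exists>c::real. \<forall>A B. A \<subseteq> T \<longrightarrow> A \<noteq> {} \<longrightarrow> B \<subseteq> T \<longrightarrow> B \<noteq> {} \<longrightarrow> set_distance N A B > c \<longrightarrow>
        prob_space.indep_var M
          (PiM A (\<lambda>_. borel)) (\<lambda>\<omega>. \<lambda>y\<in>A. Z y \<omega>)
          (PiM B (\<lambda>_. borel)) (\<lambda>\<omega>. \<lambda>y\<in>B. Z y \<omega>))"

definition generated_cone :: "(real ^ 'm) set \<Rightarrow> (real ^ 'm) set" where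
  "generated_cone S =
     {(\<Sum>x\<in>F. c x *\<^sub>R x) | F c. finite F \<and> F \<subseteq> S \<and> (\<forall>x\<in>F. 0 \<le> c x)}"

definition asymptotic_cone :: "(real ^ 'm) set \<Rightarrow> (real ^ 'm) set" where
  "asymptotic_cone S = (top_of_set (span S)) interior_of (generated_cone S)"

definition gauge_on :: "(real ^ 'm) set \<Rightarrow> (real ^ 'm \<Rightarrow> ereal) \<Rightarrow> bool" where
  "gauge_on C q \<longleftrightarrow>
     (\<forall>x\<in>C. q x < \<infinity>) \<and>
     (\<forall>x\<in>C. \<forall>y\<in>C. q (x + y) \<le> q x + q y) \<and>
     (\<forall>x\<in>C. \<forall>s::real. s > 0 \<longrightarrow> q (s *\<^sub>R x) = ereal s * q x)"

text \<open>The gauge associated with \<open>h\<close> is given by its defining property, which determines its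
  values on the asymptotic cone; values of \<open>q\<close> outside the cone are irrelevant.\<close>

definition associated_gauge ::
    "'a measure \<Rightarrow> (real ^ 'm) set \<Rightarrow> (real ^ 'm \<Rightarrow> 'a \<Rightarrow> real) \<Rightarrow>
     (real ^ 'm \<Rightarrow> ereal) \<Rightarrow> bool" where
  "associated_gauge M S h q \<longleftrightarrow>
     gauge_on (asymptotic_cone S) q \<and>
     (\<forall>x\<in>asymptotic_cone S \<inter> S.
        AE \<omega> in M. (\<lambda>k::nat. ereal (h (real k *\<^sub>R x) \<omega> / real k)) \<longlonglongrightarrow> q x)"

definition asymptotic_direction ::
    "(real ^ 'm \<Rightarrow> real) \<Rightarrow> (nat \<Rightarrow> real ^ 'm) \<Rightarrow> real ^ 'm \<Rightarrow> bool" where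
  "asymptotic_direction N xs x \<longleftrightarrow>
     filterlim (\<lambda>k. N (xs k)) at_top sequentially \<and>
     (\<lambda>k. xs k /\<^sub>R N (xs k)) \<longlonglongrightarrow> x"

end

theory Submission
  imports Defs
begin

text \<open>
  Fix a basis \<open>A \<subseteq> S\<close> of the linear hull of \<open>S\<close> on which \<open>\<pi>\<close> does not vanish, and put \<open>e = \<Sum>A\<close>. If \<open>w - z\<close>
  is close to \<open>\<tau> *\<^sub>R e\<close>, then \<open>w\<close> is reached from \<open>z\<close> by one step from a fixed finite set and at most
  \<open>2 * \<tau>\<close> steps along each \<open>a \<in> A\<close>, so by subadditivity \<open>h w - h z\<close> is at most a sum of values of \<open>h_plus\<close>
  over these steps. The steps along \<open>a\<close> form segments in direction \<open>\<pi> a \<noteq> 0\<close> in \<open>T\<close>. By almost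
  independence and the moment condition, almost surely the sums of \<open>h_plus a\<close> over all segments of
  length at most \<open>\<eta> * t\<close> in the ball of radius \<open>t\<close> are at most \<open>\<epsilon> * t\<close>, once \<open>\<eta>\<close> is small and \<open>t\<close> is large. A
  sequence with direction \<open>x\<close> is then compared from above and from below with the multiples of an
  element of \<open>S\<close> whose direction is close to \<open>x - \<sigma> *\<^sub>R e\<close> and \<open>x + \<sigma> *\<^sub>R e\<close>, along which \<open>h\<close> converges by the
  definition of \<open>q\<close>, and \<open>q\<close> is continuous.
\<close>

section \<open>Lattice points and semigroups\<close>

text \<open>Since \<open>S\<close> is countable and the step sets \<open>A\<close> and
  \<open>F\<close> are finite, convergence along multiples and all bounds for \<open>h_plus\<close>
  hold off one null set; for \<omega> outside it the passage to all directions is deterministic. The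
  exponent \<open>l\<close> ties moment to geometry: a ball of radius \<open>t\<close> in
  \<open>T\<close> has at most a constant times \<open>t ^ l\<close> points, so the
  \<open>l\<close>-th moment bounds all values of \<open>h_plus a\<close> in it by \<delta> * t.
  Sums over segments of length \<eta> * t need more, a law of large numbers uniform in the starting
  point. A step with \<pi> a = 0 would repeat a single value and allow no averaging. If
  \<open>l = 1\<close>, a second moment may be missing, but the ball has only linearly many points;
  if \<open>l \<ge> 2\<close>, there are too many starting points for Chebyshev's inequality, but
  the second moment permits an exponential one. Elements of \<open>S\<close> cannot be subtracted,
  hence the shift along \<open>e\<close>: it makes all coordinates of the difference positive, and a
  small \<sigma> makes its cost at most \<epsilon> * t.\<close>

lemma independent_coordinates:
  fixes A :: "'v::euclidean_space set"
  assumes "independent A"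
  obtains \<phi> :: "'v \<Rightarrow> 'v \<Rightarrow> real" and C :: real
  where "\<And>a. linear (\<phi> a)"
    and "\<And>x. x \<in> span A \<Longrightarrow> (\<Sum>a\<in>A. \<phi> a x *\<^sub>R a) = x"
    and "C > 0" and "\<And>a x. a \<in> A \<Longrightarrow> \<bar>\<phi> a x\<bar> \<le> C * norm x"
proof -
  have fin: "finite A" using assms by (simp add: independent_imp_finite)
  have "\<exists>g. linear g \<and> (\<forall>x\<in>A. g x = (if x = a then 1 else (0::real)))" for a
    using linear_independent_extend[OF assms, of "\<lambda>x. if x = a then 1 else (0::real)"] by auto
  then obtain \<phi> where lin: "\<And>a. linear (\<phi> a)"
    and val: "\<And>a x. x \<in> A \<Longrightarrow> \<phi> a x = (if x = a then 1 else (0::real))"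
    by metis
  have rep: "(\<Sum>a\<in>A. \<phi> a x *\<^sub>R a) = x" if "x \<in> span A" for x
  proof (rule linear_eq_on[where f = "\<lambda>x. (\<Sum>a\<in>A. \<phi> a x *\<^sub>R a)" and g = "\<lambda>x. x", OF _ _ that])
    show "linear (\<lambda>x. \<Sum>a\<in>A. \<phi> a x *\<^sub>R a)"
      using lin by (simp add: linear_iff sum.distrib scaleR_left_distrib scaleR_sum_right)
    show "linear (\<lambda>x::'v. x)" by (simp add: linear_iff)
    fix b assume b: "b \<in> A"
    have "(\<Sum>a\<in>A. \<phi> a b *\<^sub>R a) = (\<Sum>a\<in>A. if b = a then a else 0)"
      by (intro sum.cong) (auto simp: val[OF b])
    then show "(\<Sum>a\<in>A. \<phi> a b *\<^sub>R a) = b" using b fin by simp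
  qed
  have "\<exists>K>0. \<forall>x. norm (\<phi> a x) \<le> K * norm x" for a
    using linear_bounded_pos[OF lin[of a]] by (auto simp: mult.commute)
  then obtain K where K: "\<And>a. K a > 0" "\<And>a x. \<bar>\<phi> a x\<bar> \<le> K a * norm x"
    by (metis real_norm_def)
  \<comment> \<open>The summand 1 keeps the constant positive when \<open>A\<close> is
    empty.\<close>
  define C where "C = 1 + sum K A"
  have "K a \<le> C" if "a \<in> A" for a
    using member_le_sum[of a A K] fin that K(1) by (auto simp: C_def less_imp_le intro: order_trans)
  then have bd: "\<bar>\<phi> a x\<bar> \<le> C * norm x" if "a \<in> A" for a x
    using K(2)[of a x] that by (meson mult_right_mono norm_ge_zero order_trans)
  have "C > 0" using K(1) by (simp add: C_def add_pos_nonneg less_imp_le sum_nonneg)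
  from that[OF lin rep this bd] show ?thesis by blast
qed

lemma finite_lattice_ball: "finite {x \<in> int_lattice. norm (x :: real ^ 'm) \<le> R}"
proof -
  define Z where "Z = real_of_int ` {- \<lceil>R\<rceil> .. \<lceil>R\<rceil>}"
  have "{x \<in> int_lattice. norm (x :: real ^ 'm) \<le> R} \<subseteq> vec_lambda ` (PiE UNIV (\<lambda>_. Z))"
  proof
    fix x :: "real ^ 'm" assume x: "x \<in> {x \<in> int_lattice. norm x \<le> R}"
    have "x $ i \<in> Z" for i
    proof -
      obtain z where z: "x $ i = of_int z" using x by (auto simp: int_lattice_def elim: Ints_cases)
      have "\<bar>of_int z\<bar> \<le> R" using component_le_norm_cart[of x i] x z by auto
      then have "z \<in> {- \<lceil>R\<rceil> .. \<lceil>R\<rceil>}" by (auto simp: abs_le_iff) linarith+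
      then show ?thesis using z by (auto simp: Z_def)
    qed
    then have "(\<lambda>i. x $ i) \<in> PiE UNIV (\<lambda>_. Z)" by auto
    then show "x \<in> vec_lambda ` (PiE UNIV (\<lambda>_. Z))"
      by (metis image_eqI vec_lambda_eta)
  qed
  moreover have "finite (vec_lambda ` (PiE (UNIV :: 'm set) (\<lambda>_. Z)))"
    by (intro finite_imageI finite_PiE) (auto simp: Z_def)
  ultimately show ?thesis by (rule finite_subset)
qed

lemma int_lattice_add: "x \<in> int_lattice \<Longrightarrow> y \<in> int_lattice \<Longrightarrow> x + y \<in> int_lattice"
  by (auto simp: int_lattice_def)

lemma int_lattice_scale: "x \<in> int_lattice \<Longrightarrow> c \<in> \<int> \<Longrightarrow> c *\<^sub>R x \<in> int_lattice"
  by (auto simp: int_lattice_def)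

lemma int_lattice_diff: "x \<in> int_lattice \<Longrightarrow> y \<in> int_lattice \<Longrightarrow> x - y \<in> int_lattice"
  by (auto simp: int_lattice_def)

lemma int_lattice_sum: "(\<And>a. a \<in> A \<Longrightarrow> f a \<in> int_lattice) \<Longrightarrow> sum f A \<in> int_lattice"
  by (induction A rule: infinite_finite_induct) (auto simp: int_lattice_add int_lattice_def)

lemma countable_int_lattice: "countable (int_lattice :: (real ^ 'm) set)"
proof -
  have "int_lattice \<subseteq> (\<Union>n::nat. {x \<in> int_lattice. norm (x :: real ^ 'm) \<le> real n})"
  proof
    fix x :: "real ^ 'm" assume x: "x \<in> int_lattice"
    obtain n :: nat where "norm x \<le> real n" using real_arch_simple by blast
    then show "x \<in> (\<Union>n::nat. {x \<in> int_lattice. norm x \<le> real n})" using x by blast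
  qed
  moreover have "countable (\<Union>n::nat. {x \<in> int_lattice. norm (x :: real ^ 'm) \<le> real n})"
    by (rule countable_UN) (auto intro: countable_finite finite_lattice_ball)
  ultimately show ?thesis by (rule countable_subset)
qed

lemma vector_semigroup_scale:
  assumes "vector_semigroup S" "s \<in> S" "k \<ge> 1"
  shows "real k *\<^sub>R s \<in> S"
  using assms(3)
proof (induction k rule: dec_induct)
  case base then show ?case using assms by simp
next
  case (step k)
  then show ?case using assms unfolding vector_semigroup_def
    by (simp add: scaleR_left_distrib add.commute)
qed

text \<open>\<open>S\<close> need not contain 0, so a combination whose coefficients may all vanish
  is anchored at an element \<open>s\<close> of \<open>S\<close>.\<close>

lemma vector_semigroup_sum:
  assumes S: "vector_semigroup S" and "finite A" "A \<subseteq> S" "s \<in> S"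
  shows "s + (\<Sum>a\<in>A. real (m a) *\<^sub>R a) \<in> S"
  using assms(2,3)
proof (induction A rule: finite_induct)
  case empty then show ?case using assms by simp
next
  case (insert a A)
  then have IH: "s + (\<Sum>a\<in>A. real (m a) *\<^sub>R a) \<in> S" by simp
  show ?case
  proof (cases "m a = 0")
    case True then show ?thesis using insert IH by simp
  next
    case False
    then have "real (m a) *\<^sub>R a \<in> S" using insert S by (intro vector_semigroup_scale) auto
    then have "real (m a) *\<^sub>R a + (s + (\<Sum>a\<in>A. real (m a) *\<^sub>R a)) \<in> S"
      using IH S by (auto simp: vector_semigroup_def)
    then show ?thesis using insert by (simp add: algebra_simps)
  qed
qed

text \<open>One summand with positive coefficient takes the place of the anchor
  \<open>s\<close>.\<close>

lemma vector_semigroup_pos_sum: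
  assumes S: "vector_semigroup S" and "finite A" "A \<subseteq> S" "A \<noteq> {}" "\<And>a. a \<in> A \<Longrightarrow> m a \<ge> 1"
  shows "(\<Sum>a\<in>A. real (m a) *\<^sub>R a) \<in> S"
proof -
  obtain a where a: "a \<in> A" using assms by auto
  have "real (m a) *\<^sub>R a \<in> S" using assms(3,5) a by (intro vector_semigroup_scale S) auto
  then have "real (m a) *\<^sub>R a + (\<Sum>a\<in>A - {a}. real (m a) *\<^sub>R a) \<in> S"
    using assms(2,3) by (intro vector_semigroup_sum S) auto
  then show ?thesis by (subst sum.remove[OF assms(2) a])
qed

section \<open>Integer parts of coordinates with respect to a basis inside the semigroup\<close>

text \<open>\<open>A\<close> is a basis of the real space \<open>span S\<close>, but in general not
  of the lattice points in it, so integer parts of the coordinates \<open>\<phi> a\<close> leave a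
  remainder. The constant \<open>C0\<close> turns closeness in norm into closeness of all
  coordinates.\<close>

locale semigroup_basis =
  fixes S A :: "(real ^ 'm) set" and e :: "real ^ 'm"
    and \<phi> :: "real ^ 'm \<Rightarrow> real ^ 'm \<Rightarrow> real" and C0 :: real
  assumes S: "vector_semigroup S" and AS: "A \<subseteq> S" and ind: "independent A"
    and spanA: "span A = span S" and Ane: "A \<noteq> {}" and e_def: "e = \<Sum>A"
    and linear_coord: "\<And>a. linear (\<phi> a)"
    and coord_sum: "\<And>x. x \<in> span S \<Longrightarrow> (\<Sum>a\<in>A. \<phi> a x *\<^sub>R a) = x"
    and C0_pos: "C0 > 0"
    and coord_bound: "\<And>a x. a \<in> A \<Longrightarrow> \<bar>\<phi> a x\<bar> \<le> C0 * norm x"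
begin

lemma finA: "finite A"
  using ind by (simp add: independent_imp_finite)

lemma S_lattice: "S \<subseteq> int_lattice"
  using S by (simp add: vector_semigroup_def)

text \<open>A finite set that contains every remainder: once integer parts are removed, all
  coordinates lie in [0, 1), which bounds the norm by the sum of the norms of the basis.\<close>

definition "Rem = {x \<in> int_lattice :: (real ^ 'm) set. norm x \<le> (\<Sum>a\<in>A. norm a)}"

lemma finite_Rem: "finite Rem"
  unfolding Rem_def by (rule finite_lattice_ball)

lemma remainder:
  assumes x: "x \<in> span S" "x \<in> int_lattice"
  shows "x - (\<Sum>a\<in>A. of_int \<lfloor>\<phi> a x\<rfloor> *\<^sub>R a) \<in> Rem"
proof -
  have "x - (\<Sum>a\<in>A. of_int \<lfloor>\<phi> a x\<rfloor> *\<^sub>R a) = (\<Sum>a\<in>A. frac (\<phi> a x) *\<^sub>R a)"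
    using coord_sum[OF x(1)] by (simp add: frac_def scaleR_left_diff_distrib sum_subtractf)
  moreover have "norm (\<Sum>a\<in>A. frac (\<phi> a x) *\<^sub>R a) \<le> (\<Sum>a\<in>A. norm a)"
  proof (rule order_trans[OF norm_sum sum_mono])
    fix a have "\<bar>frac (\<phi> a x)\<bar> \<le> 1" using frac_lt_1[of "\<phi> a x"] frac_ge_0[of "\<phi> a x"] by linarith
    then show "norm (frac (\<phi> a x) *\<^sub>R a) \<le> norm a" by (simp add: mult_left_le_one_le)
  qed
  moreover have "x - (\<Sum>a\<in>A. of_int \<lfloor>\<phi> a x\<rfloor> *\<^sub>R a) \<in> int_lattice"
    using x AS S_lattice by (intro int_lattice_diff int_lattice_sum int_lattice_scale) auto
  ultimately show ?thesis by (simp add: Rem_def)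
qed

text \<open>By the pigeonhole principle two multiples of \<open>x\<close> have the same remainder.\<close>

lemma integer_multiple:
  assumes x: "x \<in> span S" "x \<in> int_lattice"
  obtains D :: nat and d :: "real ^ 'm \<Rightarrow> int"
  where "D \<ge> 1" "real D *\<^sub>R x = (\<Sum>a\<in>A. of_int (d a) *\<^sub>R a)"
proof -
  define r where "r k = real k *\<^sub>R x - (\<Sum>a\<in>A. of_int \<lfloor>\<phi> a (real k *\<^sub>R x)\<rfloor> *\<^sub>R a)" for k :: nat
  have "r k \<in> Rem" for k
    unfolding r_def using x by (intro remainder span_scale int_lattice_scale) auto
  then have "finite (range r)" using finite_Rem by (meson finite_subset image_subsetI)
  then have "\<not> inj r" using finite_imageD infinite_UNIV_nat by blast
  then obtain j k where jk: "j < k" "r j = r k"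
    by (metis injI linorder_neqE_nat)
  have "real (k - j) *\<^sub>R x
      = (\<Sum>a\<in>A. of_int (\<lfloor>\<phi> a (real k *\<^sub>R x)\<rfloor> - \<lfloor>\<phi> a (real j *\<^sub>R x)\<rfloor>) *\<^sub>R a)"
    using jk by (simp add: r_def of_nat_diff scaleR_left_diff_distrib sum_subtractf algebra_simps)
  moreover have "k - j \<ge> 1" using jk by simp
  ultimately show ?thesis by (rule that[rotated])
qed

text \<open>Some multiple \<open>D s\<close> is an integer combination of \<open>A\<close>. Then
  \<open>M e - s\<close> is the sum of \<open>(D - 1) s\<close> and \<open>M e - D s\<close>, and
  the latter has positive integer coefficients once \<open>M\<close> exceeds those of
  \<open>D s\<close>.\<close>

lemma neg_translate:
  assumes s: "s \<in> S"
  shows "\<exists>M0::nat. \<forall>M\<ge>M0. real M *\<^sub>R e - s \<in> S"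
proof -
  obtain D and d :: "real ^ 'm \<Rightarrow> int" where D: "D \<ge> 1" "real D *\<^sub>R s = (\<Sum>a\<in>A. of_int (d a) *\<^sub>R a)"
    by (rule integer_multiple[of s]) (use s S_lattice span_base in auto)
  \<comment> \<open>The bound exceeds every \<open>d a\<close> by at least 1, so all coefficients
    \<open>M - d a\<close> are positive.\<close>
  define M0 where "M0 = 1 + (\<Sum>a\<in>A. nat \<bar>d a\<bar>)"
  have "real M *\<^sub>R e - s \<in> S" if M: "M \<ge> M0" for M
  proof -
    define m where "m a = nat (int M - d a)" for a
    have mpos: "int M - d a \<ge> 1" if "a \<in> A" for a
    proof -
      have "nat \<bar>d a\<bar> \<le> (\<Sum>a\<in>A. nat \<bar>d a\<bar>)" using that finA by (intro member_le_sum) auto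
      then show ?thesis using M by (simp add: M0_def)
    qed
    have ms: "(\<Sum>a\<in>A. real (m a) *\<^sub>R a) \<in> S"
      using mpos by (intro vector_semigroup_pos_sum S finA AS Ane) (force simp: m_def)
    have "(\<Sum>a\<in>A. real (m a) *\<^sub>R a) = (\<Sum>a\<in>A. real M *\<^sub>R a - of_int (d a) *\<^sub>R a)"
    proof (intro sum.cong refl)
      fix a assume "a \<in> A"
      then have "real (m a) = real M - of_int (d a)" using mpos[of a] by (simp add: m_def)
      then show "real (m a) *\<^sub>R a = real M *\<^sub>R a - of_int (d a) *\<^sub>R a"
        by (simp add: scaleR_left_diff_distrib)
    qed
    also have "\<dots> = real M *\<^sub>R e - real D *\<^sub>R s"
      using D by (simp add: sum_subtractf e_def scaleR_sum_right)
    finally have eq: "real M *\<^sub>R e - s = real (D - 1) *\<^sub>R s + (\<Sum>a\<in>A. real (m a) *\<^sub>R a)"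
      using D by (simp add: of_nat_diff scaleR_left_diff_distrib algebra_simps)
    show ?thesis
    \<comment> \<open>For \<open>D = 1\<close> the first summand is 0, which may lie outside
      \<open>S\<close>.\<close>
    proof (cases "D = 1")
      case True then show ?thesis using eq ms by simp
    next
      case False
      then have "real (D - 1) *\<^sub>R s \<in> S" using D s S by (intro vector_semigroup_scale) auto
      then show ?thesis using eq ms S by (auto simp: vector_semigroup_def)
    qed
  qed
  then show ?thesis by blast
qed

text \<open>Near the direction \<open>e\<close> all coordinates are large and positive, so their integer parts are natural
  numbers, and a fixed number of copies of \<open>e\<close> can be spent on moving the remainder into \<open>S\<close>.\<close>

lemma decomposition:
  obtains \<delta> \<tau>0 :: real and F :: "(real ^ 'm) set"
  where "\<delta> > 0" "\<tau>0 > 0" "finite F" "F \<subseteq> S"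
    "\<And>w z \<tau>. w \<in> S \<Longrightarrow> z \<in> S \<Longrightarrow> \<tau> \<ge> \<tau>0 \<Longrightarrow> norm (w - z - \<tau> *\<^sub>R e) \<le> \<delta> * \<tau> \<Longrightarrow>
      \<exists>s\<in>F. \<exists>m. (\<forall>a\<in>A. real (m a) \<le> 2 * \<tau>) \<and> w = z + s + (\<Sum>a\<in>A. real (m a) *\<^sub>R a)"
proof -
  note C = C0_pos coord_bound
  \<comment> \<open>Besides lying in \<open>Rem\<close>, the remainder found below is a difference
    of two elements of \<open>S\<close>; for such differences, adding enough copies of
    \<open>e\<close> leads into \<open>S\<close>.\<close>
  define G where "G = {x - y | x y. x \<in> S \<and> y \<in> S}"
  have "\<exists>M0::nat. \<forall>M\<ge>M0. r + real M *\<^sub>R e \<in> S" if rG: "r \<in> G" for r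
  proof -
    obtain x y where xy: "x \<in> S" "y \<in> S" "r = x - y" using rG unfolding G_def by blast
    obtain M0 where "\<forall>M\<ge>M0. real M *\<^sub>R e - y \<in> S" using neg_translate xy by blast
    then have "\<forall>M\<ge>M0. x + (real M *\<^sub>R e - y) \<in> S" using xy S by (auto simp: vector_semigroup_def)
    moreover have "x + (real M *\<^sub>R e - y) = r + real M *\<^sub>R e" for M using xy by simp
    ultimately show ?thesis by metis
  qed
  then obtain M0 :: "real ^ 'm \<Rightarrow> nat" where M0: "\<And>r M. r \<in> G \<Longrightarrow> M \<ge> M0 r \<Longrightarrow> r + real M *\<^sub>R e \<in> S"
    by metis
  \<comment> \<open>One \<open>M\<close> for all remainders: the sum dominates each
    threshold.\<close>
  define M where "M = (\<Sum>r\<in>Rem. M0 r)"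
  have M: "r + real M *\<^sub>R e \<in> S" if "r \<in> G" "r \<in> Rem" for r
    using that M0 finite_Rem unfolding M_def by (meson member_le_sum le0)
  define F where "F = (\<lambda>r. r + real M *\<^sub>R e) ` (G \<inter> Rem)"
  \<comment> \<open>A deviation of norm at most \<delta> * \<tau> then changes each coordinate by at
    most \<tau> / 2, and all coordinates of \<open>w - z\<close> stay between \<tau> / 2 and 3 / 2 *
    \<tau>.\<close>
  define \<delta> where "\<delta> = 1 / (2 * C0)"
  \<comment> \<open>For \<tau> \<ge> \<tau>0 every coordinate is at least \<open>M + 1\<close>,
    which leaves room for taking out \<open>M\<close> copies of \<open>e\<close>.\<close>
  define \<tau>0 where "\<tau>0 = 2 * real (M + 1)"
  have "\<exists>s\<in>F. \<exists>m. (\<forall>a\<in>A. real (m a) \<le> 2 * \<tau>) \<and> w = z + s + (\<Sum>a\<in>A. real (m a) *\<^sub>R a)"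
    if w: "w \<in> S" and z: "z \<in> S" and \<tau>: "\<tau> \<ge> \<tau>0" and near: "norm (w - z - \<tau> *\<^sub>R e) \<le> \<delta> * \<tau>" for w z \<tau>
  proof -
    define u where "u = w - z"
    have eS: "e \<in> span S" unfolding e_def using AS by (intro span_sum span_base) auto
    have uS: "u \<in> span S" using w z by (simp add: u_def span_base span_diff)
    have uL: "u \<in> int_lattice" using w z S_lattice by (auto simp: u_def intro: int_lattice_diff)
    define c where "c a = \<phi> a u" for a
    have c: "\<tau> / 2 \<le> c a \<and> c a \<le> 3 / 2 * \<tau>" if a: "a \<in> A" for a
    proof -
      have "\<phi> a e = 1"
      proof -
        have "(\<Sum>b\<in>A. \<phi> b e *\<^sub>R b) = (\<Sum>b\<in>A. 1 *\<^sub>R b)" using coord_sum[OF eS] by (simp add: e_def)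
        then have "(\<Sum>b\<in>A. (\<phi> b e - 1) *\<^sub>R b) = 0" by (simp add: scaleR_left_diff_distrib sum_subtractf)
        then have "\<phi> a e - 1 = 0" by (rule independentD[OF ind finA subset_refl _ a])
        then show ?thesis by simp
      qed
      then have "\<phi> a (u - \<tau> *\<^sub>R e) = c a - \<tau>"
        by (simp add: c_def linear_diff[OF linear_coord] linear_scale[OF linear_coord])
      moreover have "\<bar>\<phi> a (u - \<tau> *\<^sub>R e)\<bar> \<le> C0 * (\<delta> * \<tau>)"
        using C(2)[OF a, of "u - \<tau> *\<^sub>R e"] near C(1) unfolding u_def
        by (smt (verit) mult_left_mono)
      moreover have "C0 * (\<delta> * \<tau>) = \<tau> / 2" using C(1) by (simp add: \<delta>_def)
      ultimately show ?thesis by linarith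
    qed
    define r where "r = u - (\<Sum>a\<in>A. of_int \<lfloor>c a\<rfloor> *\<^sub>R a)"
    have rRem: "r \<in> Rem" unfolding r_def c_def using uS uL by (rule remainder)
    define m0 where "m0 a = nat \<lfloor>c a\<rfloor>" for a
    define m where "m a = m0 a - M" for a
    have m0: "real (m0 a) = of_int \<lfloor>c a\<rfloor>" "m0 a \<ge> M" "m0 a \<ge> 1" "real (m0 a) \<le> 2 * \<tau>" if a: "a \<in> A" for a
    proof -
      have "c a \<ge> real (M + 1)" using c[OF a] \<tau> by (simp add: \<tau>0_def)
      then have "\<lfloor>c a\<rfloor> \<ge> int (M + 1)" by (simp add: le_floor_iff)
      then show "real (m0 a) = of_int \<lfloor>c a\<rfloor>" "m0 a \<ge> M" "m0 a \<ge> 1" by (auto simp: m0_def)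
      have "of_int \<lfloor>c a\<rfloor> \<le> c a" by simp
      also have "\<dots> \<le> 2 * \<tau>" using c[OF a] by auto
      finally show "real (m0 a) \<le> 2 * \<tau>" using \<open>real (m0 a) = of_int \<lfloor>c a\<rfloor>\<close> by simp
    qed
    have sum0: "(\<Sum>a\<in>A. of_int \<lfloor>c a\<rfloor> *\<^sub>R a) = (\<Sum>a\<in>A. real (m0 a) *\<^sub>R a)"
      using m0 by (intro sum.cong) auto
    have "(\<Sum>a\<in>A. real (m0 a) *\<^sub>R a) \<in> S"
      using m0 S finA AS Ane by (intro vector_semigroup_pos_sum) auto
    then have "z + (\<Sum>a\<in>A. real (m0 a) *\<^sub>R a) \<in> S" using z S by (auto simp: vector_semigroup_def)
    moreover have "r = w - (z + (\<Sum>a\<in>A. real (m0 a) *\<^sub>R a))" by (simp add: r_def sum0 u_def)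
    ultimately have rG: "r \<in> G" unfolding G_def using w by blast
    have "(\<Sum>a\<in>A. real (m0 a) *\<^sub>R a) = (\<Sum>a\<in>A. real (m a) *\<^sub>R a + real M *\<^sub>R a)"
      using m0 by (intro sum.cong) (auto simp: m_def of_nat_diff scaleR_left_diff_distrib)
    also have "\<dots> = (\<Sum>a\<in>A. real (m a) *\<^sub>R a) + real M *\<^sub>R e"
      by (simp add: sum.distrib e_def scaleR_sum_right)
    finally have "w = z + (r + real M *\<^sub>R e) + (\<Sum>a\<in>A. real (m a) *\<^sub>R a)"
      by (simp add: r_def sum0 u_def)
    moreover have "\<forall>a\<in>A. real (m a) \<le> 2 * \<tau>" using m0(4) by (force simp: m_def)
    moreover have "r + real M *\<^sub>R e \<in> F" using rG rRem by (auto simp: F_def)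
    ultimately show ?thesis by blast
  qed
  moreover have "F \<subseteq> S" using M by (auto simp: F_def)
  moreover have "finite F" unfolding F_def by (intro finite_imageI finite_Int disjI2 finite_Rem)
  ultimately show ?thesis using that[of \<delta> \<tau>0 F] C by (simp add: \<delta>_def \<tau>0_def)
qed

text \<open>A point of the ball is determined by the integer parts of its coordinates, with at most
  a constant times \<open>R\<close> choices for each of the \<open>card A\<close> coordinates, and
  by one of finitely many remainders. For \<open>T\<close> this links the size of balls with the
  exponent of the moment condition.\<close>

lemma card_ball:
  "\<exists>C>0. \<forall>R\<ge>1. real (card {y \<in> S. norm y \<le> R}) \<le> C * R ^ card A"
proof -
  note C = C0_pos coord_bound
  define C where "C = (2 * C0 + 3) ^ card A * (1 + real (card Rem))"
  have "real (card {y \<in> S. norm y \<le> R}) \<le> C * R ^ card A" if R: "R \<ge> 1" for R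
  proof -
    define I where "I = {- \<lceil>C0 * R\<rceil> .. \<lfloor>C0 * R\<rfloor>}"
    define P where "P = PiE A (\<lambda>_. I)"
    have finP: "finite P" using finA by (auto simp: P_def I_def intro: finite_PiE)
    have sub: "{y \<in> S. norm y \<le> R} \<subseteq> (\<lambda>(d, r). r + (\<Sum>a\<in>A. of_int (d a) *\<^sub>R a)) ` (P \<times> Rem)"
    proof
      fix y assume y: "y \<in> {y \<in> S. norm y \<le> R}"
      define d where "d = restrict (\<lambda>a. \<lfloor>\<phi> a y\<rfloor>) A"
      define r where "r = y - (\<Sum>a\<in>A. of_int \<lfloor>\<phi> a y\<rfloor> *\<^sub>R a)"
      have "r \<in> Rem" unfolding r_def using y S_lattice by (intro remainder) (auto simp: span_base)
      moreover have "\<lfloor>\<phi> a y\<rfloor> \<in> I" if a: "a \<in> A" for a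
      proof -
        have "\<bar>\<phi> a y\<bar> \<le> C0 * R" using C(2)[OF a, of y] y C(1) by (smt (verit) mem_Collect_eq mult_left_mono)
        then have "\<phi> a y \<le> C0 * R" "- (C0 * R) \<le> \<phi> a y" by auto
        then have "\<lfloor>\<phi> a y\<rfloor> \<le> \<lfloor>C0 * R\<rfloor>" "\<lfloor>- (C0 * R)\<rfloor> \<le> \<lfloor>\<phi> a y\<rfloor>" by (auto intro: floor_mono)
        then show ?thesis by (auto simp: I_def ceiling_def)
      qed
      ultimately have "(d, r) \<in> P \<times> Rem" by (auto simp: P_def d_def)
      moreover have "y = r + (\<Sum>a\<in>A. of_int (d a) *\<^sub>R a)" by (simp add: r_def d_def)
      ultimately show "y \<in> (\<lambda>(d, r). r + (\<Sum>a\<in>A. of_int (d a) *\<^sub>R a)) ` (P \<times> Rem)"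
        by (auto intro!: image_eqI[of _ _ "(d, r)"])
    qed
    have "card {y \<in> S. norm y \<le> R} \<le> card (P \<times> Rem)"
      by (rule surj_card_le[OF finite_cartesian_product[OF finP finite_Rem] sub])
    also have "card (P \<times> Rem) = card I ^ card A * card Rem"
      using finA by (simp add: card_cartesian_product P_def card_PiE)
    finally have "real (card {y \<in> S. norm y \<le> R}) \<le> real (card I) ^ card A * real (card Rem)"
      by (metis of_nat_le_iff of_nat_mult of_nat_power)
    also have "\<dots> \<le> ((2 * C0 + 3) * R) ^ card A * (1 + real (card Rem))"
    proof (intro mult_mono power_mono)
      have "real (card I) \<le> 2 * (C0 * R) + 2"
      proof -
        have "0 \<le> C0 * R" using C(1) R by simp
        then have "0 \<le> \<lfloor>C0 * R\<rfloor>" "0 \<le> \<lceil>C0 * R\<rceil>" by auto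
        then have "real (card I) = of_int \<lfloor>C0 * R\<rfloor> + of_int \<lceil>C0 * R\<rceil> + 1" unfolding I_def by simp
        then show ?thesis by linarith
      qed
      also have "\<dots> \<le> (2 * C0 + 3) * R" using R C(1) by (simp add: algebra_simps)
      finally show "real (card I) \<le> (2 * C0 + 3) * R" .
    qed (use C(1) R in auto)
    also have "\<dots> = C * R ^ card A" unfolding C_def power_mult_distrib by (simp only: mult_ac)
    finally show ?thesis .
  qed
  moreover have "C > 0" using C(1) by (simp add: C_def add_pos_nonneg)
  ultimately show ?thesis by blast
qed

end

section \<open>Homomorphisms, the asymptotic cone and gauges\<close>

lemma semigroup_hom_scale:
  assumes S: "vector_semigroup S" and hom: "semigroup_hom S T \<pi>" and s: "s \<in> S" and "k \<ge> 1"
  shows "\<pi> (real k *\<^sub>R s) = real k *\<^sub>R \<pi> s"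
  using assms(4)
proof (induction k rule: dec_induct)
  case base then show ?case by simp
next
  case (step k)
  have "\<pi> (s + real k *\<^sub>R s) = \<pi> s + \<pi> (real k *\<^sub>R s)"
    using hom s vector_semigroup_scale[OF S s step.hyps(1)] by (auto simp: semigroup_hom_def)
  then show ?case using step.IH by (simp add: scaleR_left_distrib)
qed

lemma semigroup_hom_add_scale:
  assumes S: "vector_semigroup S" and hom: "semigroup_hom S T \<pi>" and s: "s \<in> S" and z: "z \<in> S"
  shows "\<pi> (z + real k *\<^sub>R s) = \<pi> z + real k *\<^sub>R \<pi> s"
proof (cases "k = 0")
  case False
  then have "\<pi> (z + real k *\<^sub>R s) = \<pi> z + \<pi> (real k *\<^sub>R s)"
    using hom z vector_semigroup_scale[OF S s, of k] by (auto simp: semigroup_hom_def)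
  then show ?thesis using False semigroup_hom_scale[OF S hom s, of k] by simp
qed simp

lemma semigroup_hom_sum:
  assumes S: "vector_semigroup S" and hom: "semigroup_hom S T \<pi>" and z: "z \<in> S"
    and "finite A" "A \<subseteq> S"
  shows "\<pi> (z + (\<Sum>a\<in>A. real (m a) *\<^sub>R a)) = \<pi> z + (\<Sum>a\<in>A. real (m a) *\<^sub>R \<pi> a)"
  using assms(4,5)
proof (induction A rule: finite_induct)
  case (insert a A)
  have "z + (\<Sum>a\<in>A. real (m a) *\<^sub>R a) \<in> S"
    using insert by (intro vector_semigroup_sum S z) auto
  then have "\<pi> ((z + (\<Sum>a\<in>A. real (m a) *\<^sub>R a)) + real (m a) *\<^sub>R a)
      = \<pi> (z + (\<Sum>a\<in>A. real (m a) *\<^sub>R a)) + real (m a) *\<^sub>R \<pi> a"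
    using insert by (intro semigroup_hom_add_scale[OF S hom]) auto
  then show ?case using insert by (simp add: algebra_simps)
qed simp

text \<open>The homomorphism is given on \<open>S\<close> only. The decomposition of
  \<open>x + e + N e\<close> relative to \<open>e\<close>, with \<open>N\<close> of the order of
  \<open>norm x + 1\<close>, expresses \<open>\<pi> x\<close> through \<open>\<pi> e\<close>, one of
  finitely many values on \<open>F\<close> and at most \<open>2 N\<close> copies of each
  \<open>\<pi> a\<close>. The extra \<open>e\<close> is there because both points compared have to
  lie in \<open>S\<close>.\<close>

lemma (in semigroup_basis) hom_growth:
  assumes hom: "semigroup_hom S T \<pi>"
  shows "\<exists>K>0. \<forall>x\<in>S. norm (\<pi> x) \<le> K * (norm x + 1)"
proof (rule decomposition)
  fix \<delta> \<tau>0 :: real and F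
  assume pos: "\<delta> > 0" "\<tau>0 > 0" and F: "finite F" "F \<subseteq> S"
    and dec: "\<And>w z \<tau>. w \<in> S \<Longrightarrow> z \<in> S \<Longrightarrow> \<tau> \<ge> \<tau>0 \<Longrightarrow> norm (w - z - \<tau> *\<^sub>R e) \<le> \<delta> * \<tau> \<Longrightarrow>
      \<exists>s\<in>F. \<exists>m. (\<forall>a\<in>A. real (m a) \<le> 2 * \<tau>) \<and> w = z + s + (\<Sum>a\<in>A. real (m a) *\<^sub>R a)"
  define K1 where "K1 = norm (\<pi> e) + (\<Sum>s\<in>F. norm (\<pi> s)) + 2 * (\<Sum>a\<in>A. norm (\<pi> a))"
  define K2 where "K2 = \<tau>0 + 1 / \<delta> + 2"
  have K1: "K1 \<ge> 0" by (simp add: K1_def sum_nonneg)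
  have K2: "K2 > 0" using pos by (simp add: K2_def add_pos_pos)
  have eS: "e \<in> S"
    using vector_semigroup_pos_sum[OF S finA AS Ane, of "\<lambda>_. 1"] by (simp add: e_def)
  have "norm (\<pi> x) \<le> (K1 * K2 + 1) * (norm x + 1)" if x: "x \<in> S" for x
  proof -
    \<comment> \<open>The ceiling gives both \<open>N \<ge> \<tau>0\<close> and
      \<open>norm x \<le> \<delta> * N\<close>, as the decomposition with \<tau> = N
      demands.\<close>
    define N where "N = nat \<lceil>\<tau>0 + norm x / \<delta>\<rceil> + 1"
    have N1: "N \<ge> 1" by (simp add: N_def)
    have q0: "0 \<le> \<tau>0 + norm x / \<delta>" using pos by simp
    have N2: "real N \<ge> \<tau>0 + norm x / \<delta>" unfolding N_def by (simp, linarith)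
    have N3: "real N \<le> \<tau>0 + norm x / \<delta> + 2"
      using q0 of_int_ceiling_le_add_one[of "\<tau>0 + norm x / \<delta>"]
      by (simp add: N_def del: of_int_ceiling_le_add_one)
    have "real N \<le> K2 * (norm x + 1)"
    proof -
      have "K2 * (norm x + 1) = (\<tau>0 + norm x / \<delta> + 2) + (\<tau>0 * norm x + 1 / \<delta> + 2 * norm x)"
        by (simp add: K2_def algebra_simps)
      moreover have "\<tau>0 * norm x + 1 / \<delta> + 2 * norm x \<ge> 0" using pos by simp
      ultimately show ?thesis using N3 by linarith
    qed
    have N\<tau>: "real N \<ge> \<tau>0" and "norm x / \<delta> \<le> real N" using N2 pos by (auto intro: order_trans[rotated])
    then have nx: "norm x \<le> \<delta> * real N" using pos by (simp add: field_simps)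
    have NeS: "real N *\<^sub>R e \<in> S" using vector_semigroup_scale[OF S eS N1] .
    have xe: "x + e \<in> S" using x eS S by (auto simp: vector_semigroup_def)
    have wS: "x + e + real N *\<^sub>R e \<in> S"
      using xe NeS S by (auto simp: vector_semigroup_def)
    obtain s m where sm: "s \<in> F" "\<forall>a\<in>A. real (m a) \<le> 2 * real N"
      "x + e + real N *\<^sub>R e = e + s + (\<Sum>a\<in>A. real (m a) *\<^sub>R a)"
      using dec[OF wS eS N\<tau>] nx by (auto simp: algebra_simps)
    have "\<pi> x + \<pi> e + real N *\<^sub>R \<pi> e = \<pi> (x + e + real N *\<^sub>R e)"
      using semigroup_hom_add_scale[OF S hom eS xe, of N] hom x eS by (simp add: semigroup_hom_def)
    also have "\<dots> = \<pi> (e + s) + (\<Sum>a\<in>A. real (m a) *\<^sub>R \<pi> a)"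
      unfolding sm(3) using sm(1) F eS S
      by (intro semigroup_hom_sum[OF S hom _ finA AS]) (auto simp: vector_semigroup_def)
    also have "\<pi> (e + s) = \<pi> e + \<pi> s" using hom sm(1) F eS by (auto simp: semigroup_hom_def)
    finally have eq: "\<pi> x = \<pi> s + (\<Sum>a\<in>A. real (m a) *\<^sub>R \<pi> a) - real N *\<^sub>R \<pi> e"
      by (simp add: algebra_simps)
    have b1: "norm (\<pi> s) \<le> (\<Sum>s\<in>F. norm (\<pi> s)) * real N"
    proof -
      have "norm (\<pi> s) \<le> (\<Sum>s\<in>F. norm (\<pi> s))" using sm(1) F by (intro member_le_sum) auto
      also have "\<dots> \<le> (\<Sum>s\<in>F. norm (\<pi> s)) * real N"
        using mult_left_mono[of 1 "real N" "\<Sum>s\<in>F. norm (\<pi> s)"] N1 by (simp add: sum_nonneg)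
      finally show ?thesis .
    qed
    have b2: "norm (\<Sum>a\<in>A. real (m a) *\<^sub>R \<pi> a) \<le> 2 * (\<Sum>a\<in>A. norm (\<pi> a)) * real N"
    proof -
      have "norm (\<Sum>a\<in>A. real (m a) *\<^sub>R \<pi> a) \<le> (\<Sum>a\<in>A. norm (real (m a) *\<^sub>R \<pi> a))" by (rule norm_sum)
      also have "\<dots> \<le> (\<Sum>a\<in>A. 2 * real N * norm (\<pi> a))"
        using sm(2) by (intro sum_mono) (auto intro: mult_right_mono)
      also have "\<dots> = 2 * (\<Sum>a\<in>A. norm (\<pi> a)) * real N"
        by (simp add: sum_distrib_left sum_distrib_right mult_ac)
      finally show ?thesis .
    qed
    have "norm (\<pi> x) \<le> norm (\<pi> s) + norm (\<Sum>a\<in>A. real (m a) *\<^sub>R \<pi> a) + norm (real N *\<^sub>R \<pi> e)"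
      unfolding eq by (meson add_right_mono norm_triangle_ineq norm_triangle_ineq4 order_trans)
    also have "\<dots> \<le> K1 * real N" using b1 b2 by (simp add: K1_def algebra_simps)
    also have "\<dots> \<le> K1 * (K2 * (norm x + 1))"
      using \<open>real N \<le> K2 * (norm x + 1)\<close> K1 by (rule mult_left_mono)
    also have "\<dots> \<le> (K1 * K2 + 1) * (norm x + 1)" by (simp add: algebra_simps)
    finally show ?thesis .
  qed
  moreover have "K1 * K2 + 1 > 0" using K1 K2 by (simp add: add_nonneg_pos)
  ultimately show ?thesis by blast
qed

text \<open>A basis containing some \<open>a0\<close> with \<open>\<pi> a0 \<noteq> 0\<close> is
  corrected by adding \<open>a0\<close> to those members that \<pi> annihilates. Since
  \<open>a0\<close> itself is kept, the span is unchanged, and independence follows by counting: at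
  most \<open>dim S\<close> vectors span a space of dimension \<open>dim S\<close>.\<close>

lemma exists_semigroup_basis:
  fixes S :: "(real ^ 'm) set"
  assumes S: "vector_semigroup S" and hom: "semigroup_hom S T \<pi>" and nt: "nontrivial_on S \<pi>"
  obtains A \<phi> C where "semigroup_basis S A (\<Sum>A) \<phi> C" "card A = semigroup_dim S" "\<And>a. a \<in> A \<Longrightarrow> \<pi> a \<noteq> 0"
proof -
  obtain a0 where a0: "a0 \<in> S" "a0 \<noteq> 0" "\<pi> a0 \<noteq> 0" using nt by (auto simp: nontrivial_on_def)
  have "independent {a0}" using a0 by simp
  then obtain B where B: "{a0} \<subseteq> B" "B \<subseteq> S" "independent B" "S \<subseteq> span B"
    using maximal_independent_subset_extend[of "{a0}" S] a0 by auto
  define A where "A = (\<lambda>b. if \<pi> b = 0 then b + a0 else b) ` B"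
  have finB: "finite B" using B(3) by (simp add: independent_imp_finite)
  have AS: "A \<subseteq> S" using B(2) a0 S by (auto simp: A_def vector_semigroup_def)
  have \<pi>A: "\<pi> a \<noteq> 0" if "a \<in> A" for a
  proof -
    obtain b where b: "b \<in> B" "a = (if \<pi> b = 0 then b + a0 else b)" using \<open>a \<in> A\<close> by (auto simp: A_def)
    have "\<pi> (b + a0) = \<pi> b + \<pi> a0" using hom b(1) B(2) a0 by (auto simp: semigroup_hom_def)
    then show ?thesis using b(2) a0 by auto
  qed
  have a0A: "a0 \<in> A" using B(1) a0(3) by (auto simp: A_def intro!: image_eqI[of _ _ a0])
  have "b \<in> span A" if b: "b \<in> B" for b
  proof (cases "\<pi> b = 0")
    case True
    then have "b + a0 \<in> A" using b by (auto simp: A_def intro!: image_eqI[of _ _ b])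
    then have "(b + a0) - a0 \<in> span A" using a0A by (intro span_diff span_base)
    then show ?thesis by simp
  next
    case False
    then have "b \<in> A" using b by (auto simp: A_def intro!: image_eqI[of _ _ b])
    then show ?thesis by (rule span_base)
  qed
  then have "span B \<subseteq> span A" by (intro span_minimal) auto
  then have SA: "S \<subseteq> span A" using B(4) by auto
  have dimS: "dim S = card B" using basis_card_eq_dim[OF B(2,4,3)] by simp
  have finA: "finite A" using finB by (simp add: A_def)
  have cA: "card A \<le> dim S" unfolding dimS A_def using finB by (rule card_image_le)
  have indA: "independent A" using card_le_dim_spanning[OF AS SA finA cA] .
  have cardA: "card A = semigroup_dim S"
    using basis_card_eq_dim[OF AS SA indA] by (simp add: semigroup_dim_def)
  have spanA: "span A = span S"
    using AS SA span_mono[of A S] span_minimal[of S "span A"] by auto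
  show ?thesis
  proof (rule independent_coordinates[OF indA])
    fix \<phi> C
    assume lin: "\<And>a. linear (\<phi> a)" and "\<And>x. x \<in> span A \<Longrightarrow> (\<Sum>a\<in>A. \<phi> a x *\<^sub>R a) = x"
      and "C > 0" and "\<And>a x. a \<in> A \<Longrightarrow> \<bar>\<phi> a x\<bar> \<le> C * norm x"
    then have "semigroup_basis S A (\<Sum>A) \<phi> C"
      using S AS indA spanA a0A by (intro semigroup_basis.intro lin) auto
    then show ?thesis using that cardA \<pi>A by blast
  qed
qed

section \<open>The generated cone and its relative interior\<close>

lemma generated_cone_add:
  assumes "x \<in> generated_cone S" "y \<in> generated_cone S"
  shows "x + y \<in> generated_cone S"
proof -
  obtain F c where x: "x = (\<Sum>s\<in>F. c s *\<^sub>R s)" "finite F" "F \<subseteq> S" "\<forall>s\<in>F. 0 \<le> c s"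
    using assms(1) unfolding generated_cone_def by blast
  obtain G d where y: "y = (\<Sum>s\<in>G. d s *\<^sub>R s)" "finite G" "G \<subseteq> S" "\<forall>s\<in>G. 0 \<le> d s"
    using assms(2) unfolding generated_cone_def by blast
  define c' where "c' s = (if s \<in> F then c s else 0)" for s
  define d' where "d' s = (if s \<in> G then d s else 0)" for s
  have "x = (\<Sum>s\<in>F \<union> G. c' s *\<^sub>R s)"
    unfolding x(1) c'_def using x(2) y(2) by (intro sum.mono_neutral_cong_left) auto
  moreover have "y = (\<Sum>s\<in>F \<union> G. d' s *\<^sub>R s)"
    unfolding y(1) d'_def using x(2) y(2) by (intro sum.mono_neutral_cong_left) auto
  ultimately have "x + y = (\<Sum>s\<in>F \<union> G. (c' s + d' s) *\<^sub>R s)"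
    by (simp add: sum.distrib scaleR_left_distrib)
  moreover have "\<forall>s\<in>F \<union> G. 0 \<le> c' s + d' s" using x(4) y(4) by (simp add: c'_def d'_def)
  ultimately show ?thesis unfolding generated_cone_def using x(2,3) y(2,3)
    by (intro CollectI exI[of _ "F \<union> G"] exI[of _ "\<lambda>s. c' s + d' s"]) auto
qed

lemma generated_cone_scale:
  assumes "x \<in> generated_cone S" "k \<ge> 0"
  shows "k *\<^sub>R x \<in> generated_cone S"
proof -
  obtain F c where x: "x = (\<Sum>s\<in>F. c s *\<^sub>R s)" "finite F" "F \<subseteq> S" "\<forall>s\<in>F. 0 \<le> c s"
    using assms(1) unfolding generated_cone_def by blast
  then have "k *\<^sub>R x = (\<Sum>s\<in>F. (k * c s) *\<^sub>R s)" by (simp add: scaleR_sum_right)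
  then show ?thesis unfolding generated_cone_def using x assms(2)
    by (intro CollectI exI[of _ F] exI[of _ "\<lambda>s. k * c s"]) auto
qed

lemma asymptotic_cone_iff:
  "x \<in> asymptotic_cone S \<longleftrightarrow>
     x \<in> span S \<and> (\<exists>\<rho>>0. \<forall>z\<in>span S. norm (z - x) < \<rho> \<longrightarrow> z \<in> generated_cone S)"
proof -
  have "x \<in> asymptotic_cone S \<longleftrightarrow>
     (\<exists>U. openin (top_of_set (span S)) U \<and> x \<in> U \<and> U \<subseteq> generated_cone S)"
    by (simp add: asymptotic_cone_def interior_of_def)
  also have "\<dots> \<longleftrightarrow> x \<in> span S \<and> (\<exists>\<rho>>0. \<forall>z\<in>span S. norm (z - x) < \<rho> \<longrightarrow> z \<in> generated_cone S)"
  proof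
    assume "\<exists>U. openin (top_of_set (span S)) U \<and> x \<in> U \<and> U \<subseteq> generated_cone S"
    then obtain U where U: "openin (top_of_set (span S)) U" "x \<in> U" "U \<subseteq> generated_cone S" by blast
    then obtain \<rho> where "\<rho> > 0" "\<forall>z\<in>span S. dist z x < \<rho> \<longrightarrow> z \<in> U"
      unfolding openin_euclidean_subtopology_iff by blast
    then show "x \<in> span S \<and> (\<exists>\<rho>>0. \<forall>z\<in>span S. norm (z - x) < \<rho> \<longrightarrow> z \<in> generated_cone S)"
      using U openin_subset[OF U(1)] by (auto simp: dist_norm)
  next
    assume "x \<in> span S \<and> (\<exists>\<rho>>0. \<forall>z\<in>span S. norm (z - x) < \<rho> \<longrightarrow> z \<in> generated_cone S)"
    then obtain \<rho> where "x \<in> span S" "\<rho> > 0" "\<forall>z\<in>span S. norm (z - x) < \<rho> \<longrightarrow> z \<in> generated_cone S"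
      by blast
    then show "\<exists>U. openin (top_of_set (span S)) U \<and> x \<in> U \<and> U \<subseteq> generated_cone S"
      by (intro exI[of _ "span S \<inter> ball x \<rho>"]) (auto simp: dist_norm norm_minus_commute)
  qed
  finally show ?thesis .
qed

lemma asymptotic_cone_open:
  assumes "x \<in> asymptotic_cone S"
  obtains \<rho> where "\<rho> > 0" "\<And>z. z \<in> span S \<Longrightarrow> norm (z - x) < \<rho> \<Longrightarrow> z \<in> asymptotic_cone S"
proof -
  obtain \<rho> where x: "x \<in> span S" and \<rho>: "\<rho> > 0" "\<And>z. z \<in> span S \<Longrightarrow> norm (z - x) < \<rho> \<Longrightarrow> z \<in> generated_cone S"
    using assms unfolding asymptotic_cone_iff by blast
  have "z \<in> asymptotic_cone S" if z: "z \<in> span S" "norm (z - x) < \<rho> / 2" for z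
    unfolding asymptotic_cone_iff
  proof (intro conjI exI ballI impI)
    fix w assume w: "w \<in> span S" "norm (w - z) < \<rho> / 2"
    have "norm (w - x) \<le> norm (w - z) + norm (z - x)" by (metis norm_triangle_ineq diff_add_cancel add_diff_eq)
    then show "w \<in> generated_cone S" using w z by (intro \<rho>) auto
  qed (use z \<rho> in auto)
  then show ?thesis using that[of "\<rho> / 2"] \<rho>(1) by auto
qed

text \<open>A ball around \<open>x\<close> inside the cone, translated by the cone element
  \<open>y\<close>, stays inside the cone.\<close>

lemma asymptotic_cone_add:
  assumes "x \<in> asymptotic_cone S" "y \<in> asymptotic_cone S"
  shows "x + y \<in> asymptotic_cone S"
proof -
  obtain \<rho> where x: "x \<in> span S" and \<rho>: "\<rho> > 0" "\<And>z. z \<in> span S \<Longrightarrow> norm (z - x) < \<rho> \<Longrightarrow> z \<in> generated_cone S"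
    using assms(1) unfolding asymptotic_cone_iff by blast
  have y: "y \<in> span S" "y \<in> generated_cone S"
    using assms(2) unfolding asymptotic_cone_iff by auto
  show ?thesis unfolding asymptotic_cone_iff
  proof (intro conjI exI ballI impI)
    fix z assume z: "z \<in> span S" "norm (z - (x + y)) < \<rho>"
    have "z - y \<in> generated_cone S"
      using z y by (intro \<rho>(2) span_diff) (auto simp: algebra_simps)
    from generated_cone_add[OF this y(2)] show "z \<in> generated_cone S" by simp
  qed (use x y \<rho> in \<open>auto intro: span_add\<close>)
qed

lemma asymptotic_cone_scale:
  assumes "x \<in> asymptotic_cone S" "k > 0"
  shows "k *\<^sub>R x \<in> asymptotic_cone S"
proof -
  obtain \<rho> where x: "x \<in> span S" and \<rho>: "\<rho> > 0" "\<And>z. z \<in> span S \<Longrightarrow> norm (z - x) < \<rho> \<Longrightarrow> z \<in> generated_cone S"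
    using assms(1) unfolding asymptotic_cone_iff by blast
  show ?thesis unfolding asymptotic_cone_iff
  proof (intro conjI exI ballI impI)
    fix z assume z: "z \<in> span S" "norm (z - k *\<^sub>R x) < k * \<rho>"
    have "norm (z /\<^sub>R k - x) = norm (z - k *\<^sub>R x) / k"
    proof -
      have "z /\<^sub>R k - x = (z - k *\<^sub>R x) /\<^sub>R k" using assms(2) by (simp add: scaleR_right_diff_distrib)
      then show ?thesis using assms(2) by (simp add: divide_inverse mult.commute)
    qed
    then have "z /\<^sub>R k \<in> generated_cone S"
      using z assms(2) by (intro \<rho>(2) span_scale) (auto simp: pos_divide_less_eq mult.commute)
    from generated_cone_scale[OF this, of k] show "z \<in> generated_cone S" using assms(2) by simp
  qed (use x \<rho> assms(2) in \<open>auto intro: span_scale\<close>)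
qed

text \<open>A rounded multiple of a point of the cone is a combination of elements of \<open>S\<close> with positive
  integer coefficients.\<close>

lemma generated_cone_approx:
  assumes S: "vector_semigroup S" and y: "y \<in> generated_cone S" and "\<epsilon> > 0"
  obtains v and N :: nat where "v \<in> S" "N \<ge> 1" "norm (v /\<^sub>R real N - y) < \<epsilon>"
proof -
  obtain F c where F: "y = (\<Sum>s\<in>F. c s *\<^sub>R s)" "finite F" "F \<subseteq> S" "\<forall>s\<in>F. 0 \<le> c s"
    using y unfolding generated_cone_def by blast
  \<comment> \<open>The element \<open>s0\<close> anchors \<open>v\<close> in \<open>S\<close>
    should all rounded coefficients vanish; division by \<open>N\<close> makes its contribution
    small.\<close>
  obtain s0 where s0: "s0 \<in> S" using S by (auto simp: vector_semigroup_def)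
  define L where "L = norm s0 + (\<Sum>s\<in>F. norm s)"
  have L0: "L \<ge> 0" by (simp add: L_def sum_nonneg)
  obtain N :: nat where N: "real N > L / \<epsilon>" using reals_Archimedean2 by blast
  have "L / \<epsilon> \<ge> 0" using L0 \<open>\<epsilon> > 0\<close> by simp
  then have Npos: "real N > 0" using N by linarith
  define v where "v = s0 + (\<Sum>s\<in>F. real (nat \<lceil>real N * c s\<rceil>) *\<^sub>R s)"
  have vS: "v \<in> S" unfolding v_def using F S s0 by (intro vector_semigroup_sum)
  have "norm (v - real N *\<^sub>R y) \<le> L"
  proof -
    have "v - real N *\<^sub>R y = s0 + (\<Sum>s\<in>F. (real (nat \<lceil>real N * c s\<rceil>) - real N * c s) *\<^sub>R s)"
      by (simp add: v_def F(1) scaleR_sum_right scaleR_left_diff_distrib sum_subtractf)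
    also have "norm \<dots> \<le> norm s0 + norm (\<Sum>s\<in>F. (real (nat \<lceil>real N * c s\<rceil>) - real N * c s) *\<^sub>R s)"
      by (rule norm_triangle_ineq)
    also have "\<dots> \<le> norm s0 + (\<Sum>s\<in>F. norm ((real (nat \<lceil>real N * c s\<rceil>) - real N * c s) *\<^sub>R s))"
      by (intro add_left_mono norm_sum)
    also have "\<dots> \<le> L" unfolding L_def
    proof (intro add_left_mono sum_mono)
      fix s assume s: "s \<in> F"
      have "0 \<le> real N * c s" using F(4) s by simp
      then have "\<bar>real (nat \<lceil>real N * c s\<rceil>) - real N * c s\<bar> \<le> 1" by simp linarith
      then show "norm ((real (nat \<lceil>real N * c s\<rceil>) - real N * c s) *\<^sub>R s) \<le> norm s"
        by (simp add: mult_left_le_one_le)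
    qed
    finally show ?thesis .
  qed
  moreover have "norm (v /\<^sub>R real N - y) = norm (v - real N *\<^sub>R y) / real N"
  proof -
    have "v /\<^sub>R real N - y = (v - real N *\<^sub>R y) /\<^sub>R real N" using Npos by (simp add: scaleR_right_diff_distrib)
    then show ?thesis using Npos by (simp add: divide_inverse mult.commute)
  qed
  ultimately have "norm (v /\<^sub>R real N - y) \<le> L / real N" using Npos by (simp add: divide_right_mono)
  also have "\<dots> < \<epsilon>" using N Npos \<open>\<epsilon> > 0\<close> by (simp add: field_simps)
  finally show ?thesis using that[of v N] vS Npos by simp
qed

section \<open>Finiteness and continuity of gauges\<close>

text \<open>Each \<open>y\<close> is the sum of \<open>y - \<theta> *\<^sub>R x\<close> and
  \<open>\<theta> *\<^sub>R x\<close>, both in the cone for small \<theta>. The gauge of the first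
  is below infinity, that of the second is minus infinity, and subadditivity decides. So a gauge is
  either finite everywhere or constantly minus infinity.\<close>

lemma gauge_minus_infinity:
  assumes q: "gauge_on (asymptotic_cone S) q" and x: "x \<in> asymptotic_cone S" and "q x = -\<infinity>"
    and y: "y \<in> asymptotic_cone S"
  shows "q y = -\<infinity>"
proof (rule ccontr)
  assume fin: "q y \<noteq> -\<infinity>"
  obtain \<rho> where \<rho>: "\<rho> > 0" "\<And>z. z \<in> span S \<Longrightarrow> norm (z - y) < \<rho> \<Longrightarrow> z \<in> asymptotic_cone S"
    using asymptotic_cone_open[OF y] by blast
  have sp: "x \<in> span S" "y \<in> span S" using x y by (auto simp: asymptotic_cone_iff)
  define \<theta> where "\<theta> = \<rho> / (2 * (norm x + 1))"
  have nx: "norm x + 1 > 0" by (simp add: add_nonneg_pos)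
  have \<theta>: "\<theta> > 0" using \<rho>(1) nx by (simp add: \<theta>_def)
  have "\<theta> * norm x \<le> \<theta> * (norm x + 1)" using \<theta> by simp
  also have "\<dots> = \<rho> / 2" unfolding \<theta>_def using nx by (subst times_divide_eq_left, subst nonzero_divide_eq_eq) auto
  finally have "\<theta> * norm x < \<rho>" using \<rho>(1) by simp
  then have "y - \<theta> *\<^sub>R x \<in> asymptotic_cone S"
    using \<theta> sp by (intro \<rho>(2) span_diff span_scale) auto
  moreover have "\<theta> *\<^sub>R x \<in> asymptotic_cone S" using x \<theta> by (rule asymptotic_cone_scale)
  ultimately have "q ((y - \<theta> *\<^sub>R x) + \<theta> *\<^sub>R x) \<le> q (y - \<theta> *\<^sub>R x) + q (\<theta> *\<^sub>R x)" "q (y - \<theta> *\<^sub>R x) < \<infinity>"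
    using q unfolding gauge_on_def by blast+
  moreover have "q (\<theta> *\<^sub>R x) = -\<infinity>" using q x \<theta> assms(3) unfolding gauge_on_def by auto
  ultimately show False using fin by (cases "q (y - \<theta> *\<^sub>R x)") auto
qed

text \<open>A finite gauge is convex, and a convex function on an open set is continuous. The cone
  is open only relative to \<open>span S\<close>; composition with the linear projection
  \<open>P\<close> onto \<open>span S\<close> yields a convex function \<open>Q\<close> on an open
  subset \<open>U\<close> of the whole space.\<close>

lemma (in semigroup_basis) gauge_continuous:
  assumes q: "gauge_on (asymptotic_cone S) q" and x: "x \<in> asymptotic_cone S" and fin: "q x \<noteq> -\<infinity>"
    and \<epsilon>: "\<epsilon> > (0::real)"
  obtains \<rho> where "\<rho> > 0" "\<And>y. y \<in> asymptotic_cone S \<Longrightarrow> norm (y - x) < \<rho> \<Longrightarrow>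
    \<exists>r. q y = ereal r \<and> \<bar>r - real_of_ereal (q x)\<bar> < \<epsilon>"
proof -
  let ?O = "asymptotic_cone S"
  have fin': "\<bar>q y\<bar> \<noteq> \<infinity>" if y: "y \<in> ?O" for y
  proof -
    have "q y \<noteq> -\<infinity>" using gauge_minus_infinity[OF q y _ x] fin by blast
    moreover have "q y \<noteq> \<infinity>" using q y unfolding gauge_on_def by auto
    ultimately show ?thesis by auto
  qed
  define P where "P z = (\<Sum>a\<in>A. \<phi> a z *\<^sub>R a)" for z
  have linP: "linear P" unfolding P_def
    using linear_coord by (simp add: linear_iff sum.distrib scaleR_left_distrib scaleR_sum_right)
  have Pid: "P z = z" if "z \<in> span S" for z using coord_sum[OF that] by (simp add: P_def)
  have Psp: "P z \<in> span S" for z unfolding P_def using AS by (intro span_sum span_scale span_base) auto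
  define U where "U = {z. P z \<in> ?O}"
  define Q where "Q z = real_of_ereal (q (P z))" for z
  have Q: "q (P z) = ereal (Q z)" if "z \<in> U" for z
    using fin'[of "P z"] that by (simp add: U_def Q_def ereal_real)
  have contP: "continuous_on UNIV P" using linP by (simp add: linear_continuous_on linear_conv_bounded_linear)
  have openU: "open U"
  proof -
    have "openin (top_of_set (span S)) ?O" unfolding asymptotic_cone_def by (rule openin_interior_of)
    then obtain G where G: "open G" "?O = span S \<inter> G" by (auto simp: openin_open)
    have "U = P -` G" using G Psp by (auto simp: U_def)
    then show ?thesis using contP G(1) by (simp add: continuous_on_open_vimage[OF open_UNIV])
  qed
  have Umul: "(1 - t) *\<^sub>R y + t *\<^sub>R z \<in> U \<and> Q ((1 - t) *\<^sub>R y + t *\<^sub>R z) \<le> (1 - t) * Q y + t * Q z"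
    if t: "0 < t" "t < 1" and yz: "y \<in> U" "z \<in> U" for t y z
  proof -
    have Py: "(1 - t) *\<^sub>R P y \<in> ?O" and Pz: "t *\<^sub>R P z \<in> ?O"
      using yz t by (auto simp: U_def intro!: asymptotic_cone_scale)
    have eq: "P ((1 - t) *\<^sub>R y + t *\<^sub>R z) = (1 - t) *\<^sub>R P y + t *\<^sub>R P z"
      using linP by (simp add: linear_add linear_scale)
    have inU: "(1 - t) *\<^sub>R y + t *\<^sub>R z \<in> U"
      using asymptotic_cone_add[OF Py Pz] eq by (simp add: U_def)
    have "q ((1 - t) *\<^sub>R P y + t *\<^sub>R P z) \<le> q ((1 - t) *\<^sub>R P y) + q (t *\<^sub>R P z)"
      using q Py Pz unfolding gauge_on_def by blast
    also have "\<dots> = ereal (1 - t) * q (P y) + ereal t * q (P z)"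
      using q yz t unfolding gauge_on_def U_def by auto
    finally have "ereal (Q ((1 - t) *\<^sub>R y + t *\<^sub>R z)) \<le> ereal ((1 - t) * Q y + t * Q z)"
      using Q[OF inU] Q[OF yz(1)] Q[OF yz(2)] eq by simp
    then show ?thesis using inU by simp
  qed
  \<comment> \<open>Cone and gauge are scaled by positive factors only, so the end points are
    separate cases.\<close>
  have "convex U" unfolding convex_alt
  proof (intro ballI allI impI)
    fix y z and u :: real assume "y \<in> U" "z \<in> U" "0 \<le> u \<and> u \<le> 1"
    then show "(1 - u) *\<^sub>R y + u *\<^sub>R z \<in> U"
      using Umul[of u y z] by (cases "u = 0"; cases "u = 1") auto
  qed
  then have "convex_on U Q" using Umul by (intro convex_onI) auto
  then have "continuous_on U Q" using openU by (intro convex_on_continuous)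
  moreover have xU: "x \<in> U" using x Pid[of x] by (simp add: U_def asymptotic_cone_iff)
  ultimately have "isCont Q x" using openU by (simp add: continuous_on_eq_continuous_at)
  then obtain \<rho> where \<rho>: "\<rho> > 0" "\<And>y. norm (y - x) < \<rho> \<Longrightarrow> \<bar>Q y - Q x\<bar> < \<epsilon>"
    using \<epsilon> unfolding continuous_at_eps_delta dist_norm real_norm_def by blast
  have Px: "P y = y" if "y \<in> ?O" for y using that Pid[of y] by (simp add: asymptotic_cone_iff)
  show ?thesis
  proof (rule that[OF \<rho>(1)])
    fix y assume y: "y \<in> ?O" "norm (y - x) < \<rho>"
    have "y \<in> U" using y Px[OF y(1)] by (simp add: U_def)
    then show "\<exists>r. q y = ereal r \<and> \<bar>r - real_of_ereal (q x)\<bar> < \<epsilon>"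
      using Q[of y] \<rho>(2)[OF y(2)] Px[OF y(1)] Px[OF x] by (auto simp: Q_def)
  qed
qed

section \<open>Almost independent fields\<close>

text \<open>Serves the Borel-Cantelli arguments: a pointwise bound of the partial sums by a single
  integrable function replaces a computation with tail probabilities.\<close>

lemma summable_integral_bounded:
  fixes f :: "nat \<Rightarrow> 'a \<Rightarrow> real"
  assumes f: "\<And>k. integrable M (f k)" and nonneg: "\<And>k \<omega>. \<omega> \<in> space M \<Longrightarrow> 0 \<le> f k \<omega>"
    and G: "integrable M G" and le: "\<And>n \<omega>. \<omega> \<in> space M \<Longrightarrow> (\<Sum>k<n. f k \<omega>) \<le> G \<omega>"
  shows "summable (\<lambda>k. integral\<^sup>L M (f k))"
proof (rule summableI_nonneg_bounded)
  show "0 \<le> integral\<^sup>L M (f k)" for k by (rule Bochner_Integration.integral_nonneg) (rule nonneg)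
  show "(\<Sum>k<n. integral\<^sup>L M (f k)) \<le> integral\<^sup>L M G" for n
  proof -
    have "(\<Sum>k<n. integral\<^sup>L M (f k)) = (\<integral>\<omega>. (\<Sum>k<n. f k \<omega>) \<partial>M)"
      using f by (simp add: Bochner_Integration.integral_sum)
    also have "\<dots> \<le> integral\<^sup>L M G" using f G le by (intro integral_mono) auto
    finally show ?thesis .
  qed
qed

lemma dyadic_bracket:
  assumes t: "t \<ge> (1::real)"
  obtains k :: nat where "t \<le> 2 ^ k" "2 ^ k \<le> 2 * t"
proof -
  define k where "k = (LEAST k. t \<le> 2 ^ k)"
  have ex: "\<exists>k. t \<le> 2 ^ k" using real_arch_pow[of 2 t] by (auto intro: less_imp_le)
  have le: "t \<le> 2 ^ k" unfolding k_def using ex by (rule LeastI_ex)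
  have "2 ^ k \<le> 2 * t"
  proof (cases k)
    case 0 then show ?thesis using t by simp
  next
    case (Suc j)
    then have "\<not> t \<le> 2 ^ j" using not_less_Least[of j "\<lambda>k. t \<le> 2 ^ k"] unfolding k_def by auto
    then show ?thesis using Suc by simp
  qed
  with that le show ?thesis by blast
qed

text \<open>The random estimates are proved along the radii \<open>2 ^ k\<close>; passing to an
  arbitrary real \<open>t\<close> costs a factor of at most 2.\<close>

lemma eventually_dyadic:
  assumes "eventually P sequentially"
  obtains t0 :: real where "t0 \<ge> 1" "\<And>t. t \<ge> t0 \<Longrightarrow> \<exists>k. t \<le> 2 ^ k \<and> 2 ^ k \<le> 2 * t \<and> P k"
proof -
  obtain k0 where k0: "\<And>k. k \<ge> k0 \<Longrightarrow> P k" using assms by (auto simp: eventually_sequentially)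
  show ?thesis
  proof (rule that[of "2 ^ k0"])
    show "1 \<le> (2::real) ^ k0" by simp
    fix t :: real assume t: "t \<ge> 2 ^ k0"
    have "1 \<le> (2::real) ^ k0" by simp
    with t have "t \<ge> 1" by linarith
    then obtain k :: nat where k: "t \<le> 2 ^ k" "2 ^ k \<le> 2 * t" by (rule dyadic_bracket)
    have "(2::real) ^ k0 \<le> 2 ^ k" using t k by linarith
    then have "k \<ge> k0" by simp
    then show "\<exists>k. t \<le> 2 ^ k \<and> 2 ^ k \<le> 2 * t \<and> P k" using k k0 by blast
  qed
qed

text \<open>If \<open>2 ^ n < w\<close>, the earlier terms together and the new term are each at
  most \<open>(2 ^ n) ^ l\<close>, hence at most \<open>w ^ l\<close>; the first conjunct is carried
  along to supply this bound for the earlier terms. With \<open>w = Y / \<delta>\<close> the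
  \<open>l\<close>-th moment controls the series of \<open>(2 ^ k) ^ l\<close> times the probability
  of \<open>Y > \<delta> * 2 ^ k\<close>.\<close>

lemma sum_dyadic_indicator_le:
  assumes "w \<ge> (0::real)" "l \<ge> 1"
  shows "(\<Sum>k<n. if 2 ^ k < w then (2 ^ k) ^ l else (0::real)) \<le> (2 ^ n) ^ l \<and>
    (\<Sum>k<n. if 2 ^ k < w then (2 ^ k) ^ l else 0) \<le> 2 * w ^ l"
proof (induction n)
  case 0 then show ?case using assms by simp
next
  case (Suc n)
  have two: "2 * (2 ^ n) ^ l \<le> ((2::real) ^ Suc n) ^ l"
  proof -
    have "(2::real) ^ 1 \<le> 2 ^ l" using assms by (intro power_increasing) auto
    then show ?thesis by (simp add: power_mult_distrib)
  qed
  have mono: "((2::real) ^ n) ^ l \<le> (2 ^ Suc n) ^ l" by (intro power_mono) auto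
  show ?case
  proof (cases "2 ^ n < w")
    case True
    then have "(2 ^ n) ^ l \<le> w ^ l" by (intro power_mono) auto
    then show ?thesis using Suc.IH two unfolding sum.lessThan_Suc if_P[OF True] by linarith
  next
    case False then show ?thesis using Suc.IH mono unfolding sum.lessThan_Suc if_not_P[OF False] by linarith
  qed
qed

section \<open>Growth of an identically distributed field\<close>

text \<open>Models the values \<open>h_plus a (g y \<omega>)\<close> for one fixed \<open>a\<close>,
  with \<open>Y = h_plus a\<close>. The variable \<open>Y\<close> is kept apart from the family
  because \<open>T\<close> need not contain 0. Measure preservation enters as equality of
  distributions, and the exponent \<open>l\<close> occurs both in the moment and in the number of
  points of a ball.\<close>

locale noise_field = prob_space M for M :: "'a measure" +
  fixes T :: "(real ^ 'n) set" and N :: "real ^ 'n \<Rightarrow> real"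
    and X :: "real ^ 'n \<Rightarrow> 'a \<Rightarrow> real" and Y :: "'a \<Rightarrow> real" and l :: nat and K0 gap :: real
  assumes T: "vector_semigroup T" and N: "norm_function N" and l: "l \<ge> 1"
    and X_measurable: "\<And>y. y \<in> T \<Longrightarrow> X y \<in> borel_measurable M"
    and X_nonneg: "\<And>y \<omega>. y \<in> T \<Longrightarrow> \<omega> \<in> space M \<Longrightarrow> 0 \<le> X y \<omega>"
    and Y_measurable: "Y \<in> borel_measurable M"
    and Y_nonneg: "\<And>\<omega>. \<omega> \<in> space M \<Longrightarrow> 0 \<le> Y \<omega>"
    and identically_distributed: "\<And>y. y \<in> T \<Longrightarrow> distr M borel (X y) = distr M borel Y"
    and moment: "integrable M (\<lambda>\<omega>. Y \<omega> ^ l)"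
    and gap: "gap \<ge> 0"
    and indep: "\<And>A B. A \<subseteq> T \<Longrightarrow> A \<noteq> {} \<Longrightarrow> B \<subseteq> T \<Longrightarrow> B \<noteq> {} \<Longrightarrow> set_distance N A B > gap \<Longrightarrow>
      indep_var (PiM A (\<lambda>_. borel)) (\<lambda>\<omega>. \<lambda>y\<in>A. X y \<omega>) (PiM B (\<lambda>_. borel)) (\<lambda>\<omega>. \<lambda>y\<in>B. X y \<omega>)"
    and K0: "K0 > 0" and card_le: "\<And>R. R \<ge> 1 \<Longrightarrow> real (card {y \<in> T. norm y \<le> R}) \<le> K0 * R ^ l"
begin

definition "Tball R = {y \<in> T. norm y \<le> R}"

lemma finite_Tball: "finite (Tball R)"
proof -
  have "Tball R \<subseteq> {x \<in> int_lattice. norm x \<le> R}"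
    using T by (auto simp: Tball_def vector_semigroup_def)
  then show ?thesis using finite_lattice_ball by (rule finite_subset)
qed

lemma integral_X:
  assumes "y \<in> T" "\<psi> \<in> borel_measurable borel"
  shows "(\<integral>\<omega>. (\<psi> (X y \<omega>) :: real) \<partial>M) = (\<integral>\<omega>. \<psi> (Y \<omega>) \<partial>M)"
  using integral_distr[OF X_measurable[OF assms(1)] assms(2)] integral_distr[OF Y_measurable assms(2)]
    identically_distributed[OF assms(1)] by simp

lemma prob_X:
  assumes "y \<in> T" "A \<in> sets borel"
  shows "prob {\<omega> \<in> space M. X y \<omega> \<in> A} = prob {\<omega> \<in> space M. Y \<omega> \<in> A}"
proof -
  have "measure (distr M borel (X y)) A = measure (distr M borel Y) A"
    using identically_distributed[OF assms(1)] by simp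
  then show ?thesis
    using assms X_measurable Y_measurable
    by (simp add: measure_distr vimage_def Int_def conj_commute)
qed

lemma expectation_mult:
  fixes F G :: "(real ^ 'n \<Rightarrow> real) \<Rightarrow> real"
  assumes A: "A \<subseteq> T" "A \<noteq> {}" and B: "B \<subseteq> T" "B \<noteq> {}" and d: "set_distance N A B > gap"
    and F: "F \<in> borel_measurable (PiM A (\<lambda>_. borel))" and G: "G \<in> borel_measurable (PiM B (\<lambda>_. borel))"
    and int: "integrable M (\<lambda>\<omega>. F (\<lambda>y\<in>A. X y \<omega>))" "integrable M (\<lambda>\<omega>. G (\<lambda>y\<in>B. X y \<omega>))"
  shows "(\<integral>\<omega>. F (\<lambda>y\<in>A. X y \<omega>) * G (\<lambda>y\<in>B. X y \<omega>) \<partial>M) =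
    (\<integral>\<omega>. F (\<lambda>y\<in>A. X y \<omega>) \<partial>M) * (\<integral>\<omega>. G (\<lambda>y\<in>B. X y \<omega>) \<partial>M)"
proof -
  from indep_var_compose[OF indep[OF A B d] F G]
  have "indep_var borel (\<lambda>\<omega>. F (\<lambda>y\<in>A. X y \<omega>)) borel (\<lambda>\<omega>. G (\<lambda>y\<in>B. X y \<omega>))"
    by (simp add: comp_def)
  from indep_var_lebesgue_integral[OF this int] show ?thesis .
qed

lemma set_distance_singletons: "set_distance N {y} {z} = N (y - z)"
proof -
  have "{N (x - w) | x w. x \<in> {y} \<and> w \<in> {z}} = {N (y - z)}" by auto
  then show ?thesis by (simp add: set_distance_def)
qed

text \<open>The ball of radius \<open>2 ^ k\<close> has at most \<open>K0 * (2 ^ k) ^ l\<close>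
  points, so the probability that one of the values exceeds \<open>\<delta> * 2 ^ k\<close> is at
  most \<open>K0\<close> times the integral of \<open>f k\<close>. Pointwise the sum of the
  \<open>f k\<close> is at most a constant times \<open>Y ^ l\<close>, and the Borel-Cantelli lemma
  applies.\<close>

lemma AE_eventually_le_dyadic:
  assumes \<delta>: "\<delta> > 0"
  shows "AE \<omega> in M. \<forall>\<^sub>F k in sequentially. \<forall>y\<in>Tball (2 ^ k). X y \<omega> \<le> \<delta> * 2 ^ k"
proof -
  define E where "E k = (\<Union>y\<in>Tball (2 ^ k). {\<omega> \<in> space M. X y \<omega> \<in> {\<delta> * 2 ^ k <..}})" for k :: nat
  define f where "f k \<omega> = (if 2 ^ k < Y \<omega> / \<delta> then (2 ^ k) ^ l else (0::real))" for k :: nat and \<omega>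
  note [measurable] = Y_measurable
  have f_meas [measurable]: "f k \<in> borel_measurable M" for k unfolding f_def by measurable
  have Esets: "{\<omega> \<in> space M. X y \<omega> \<in> {\<delta> * 2 ^ k <..}} \<in> sets M" if "y \<in> T" for y and k :: nat
    using X_measurable[OF that] by measurable
  have int_f: "integrable M (f k)" for k
    by (rule integrable_const_bound[of _ "(2 ^ k) ^ l"]) (auto simp: f_def)
  have Ef: "integral\<^sup>L M (f k) = (2 ^ k) ^ l * prob {\<omega> \<in> space M. Y \<omega> \<in> {\<delta> * 2 ^ k <..}}" for k
  proof -
    have "integral\<^sup>L M (f k) = (\<integral>\<omega>. (2 ^ k) ^ l * indicator {\<omega> \<in> space M. Y \<omega> \<in> {\<delta> * 2 ^ k <..}} \<omega> \<partial>M)"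
      using \<delta> by (intro Bochner_Integration.integral_cong)
        (auto simp: f_def field_simps split: split_indicator)
    moreover have "{\<omega> \<in> space M. Y \<omega> \<in> {\<delta> * 2 ^ k <..}} \<inter> space M = {\<omega> \<in> space M. Y \<omega> \<in> {\<delta> * 2 ^ k <..}}"
      by auto
    ultimately show ?thesis by simp
  qed
  have "summable (\<lambda>k. integral\<^sup>L M (f k))"
  proof (rule summable_integral_bounded[OF int_f])
    show "integrable M (\<lambda>\<omega>. 2 / \<delta> ^ l * Y \<omega> ^ l)" using moment by simp
    fix \<omega> and n :: nat assume \<omega>: "\<omega> \<in> space M"
    show "(\<Sum>k<n. f k \<omega>) \<le> 2 / \<delta> ^ l * Y \<omega> ^ l"
      using sum_dyadic_indicator_le[of "Y \<omega> / \<delta>" l n] Y_nonneg[OF \<omega>] \<delta> l by (simp add: f_def power_divide)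
  qed (simp add: f_def)
  then have sum: "summable (\<lambda>k. K0 * integral\<^sup>L M (f k))" by (rule summable_mult)
  have "prob (E k) \<le> K0 * integral\<^sup>L M (f k)" for k
  proof -
    have "prob (E k) \<le> (\<Sum>y\<in>Tball (2 ^ k). prob {\<omega> \<in> space M. X y \<omega> \<in> {\<delta> * 2 ^ k <..}})"
      unfolding E_def using Esets by (intro finite_measure_subadditive_finite finite_Tball) (auto simp: Tball_def)
    also have "\<dots> = real (card (Tball (2 ^ k))) * prob {\<omega> \<in> space M. Y \<omega> \<in> {\<delta> * 2 ^ k <..}}"
      using prob_X[of _ "{\<delta> * 2 ^ k <..}"] by (simp add: Tball_def)
    also have "\<dots> \<le> K0 * (2 ^ k) ^ l * prob {\<omega> \<in> space M. Y \<omega> \<in> {\<delta> * 2 ^ k <..}}"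
      unfolding Tball_def by (intro mult_right_mono card_le) auto
    finally show ?thesis by (simp add: Ef mult.assoc)
  qed
  then have "summable (\<lambda>k. prob (E k))"
    by (intro summable_comparison_test'[OF sum, of 0]) auto
  moreover have "E k \<in> sets M" for k
    unfolding E_def using Esets by (intro sets.finite_UN finite_Tball) (auto simp: Tball_def)
  ultimately have "AE \<omega> in M. \<forall>\<^sub>F k in sequentially. \<omega> \<in> space M - E k"
    by (intro borel_cantelli_AE1) (auto simp: emeasure_eq_measure)
  then show ?thesis
    by (rule AE_mp) (intro AE_I2 impI, elim eventually_mono, auto simp: E_def not_less)
qed

definition "sublinear_at \<omega> \<longleftrightarrow> (\<forall>\<delta>>0. \<exists>t0\<ge>1. \<forall>t\<ge>t0. \<forall>y\<in>Tball t. X y \<omega> \<le> \<delta> * t)"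

lemma AE_sublinear: "AE \<omega> in M. sublinear_at \<omega>"
proof -
  have "AE \<omega> in M. \<forall>i::nat. \<forall>\<^sub>F k in sequentially. \<forall>y\<in>Tball (2 ^ k). X y \<omega> \<le> 1 / Suc i * 2 ^ k"
    by (subst AE_all_countable) (intro allI AE_eventually_le_dyadic, simp)
  then show ?thesis
  proof (rule AE_mp, intro AE_I2 impI)
    fix \<omega> assume ev: "\<forall>i::nat. \<forall>\<^sub>F k in sequentially. \<forall>y\<in>Tball (2 ^ k). X y \<omega> \<le> 1 / Suc i * 2 ^ k"
    show "sublinear_at \<omega>" unfolding sublinear_at_def
    proof (intro allI impI)
      fix \<delta> :: real assume "\<delta> > 0"
      \<comment> \<open>The half is for the factor 2 lost between \<open>t\<close> and the dyadic
        radius.\<close>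
      then obtain i where i: "1 / Suc i < \<delta> / 2"
        using reals_Archimedean[of "\<delta> / 2"] by (auto simp: inverse_eq_divide)
      obtain t0 :: real where t0: "t0 \<ge> 1" "\<And>t. t \<ge> t0 \<Longrightarrow> \<exists>k. t \<le> 2 ^ k \<and> 2 ^ k \<le> 2 * t \<and>
          (\<forall>y\<in>Tball (2 ^ k). X y \<omega> \<le> 1 / Suc i * 2 ^ k)"
        using eventually_dyadic[OF ev[rule_format, of i]] by blast
      have "X y \<omega> \<le> \<delta> * t" if t: "t \<ge> t0" and y: "y \<in> Tball t" for t y
      proof -
        obtain k where k: "t \<le> 2 ^ k" "2 ^ k \<le> 2 * t" "\<forall>y\<in>Tball (2 ^ k). X y \<omega> \<le> 1 / Suc i * 2 ^ k"
          using t0(2)[OF t] by blast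
        have "X y \<omega> \<le> 1 / Suc i * 2 ^ k" using k y by (auto simp: Tball_def)
        also have "\<dots> \<le> \<delta> / 2 * 2 ^ k" using i by (intro mult_right_mono) auto
        also have "\<dots> \<le> \<delta> * t" using k(2) \<open>\<delta> > 0\<close> by simp
        finally show ?thesis .
      qed
      then show "\<exists>t0\<ge>1. \<forall>t\<ge>t0. \<forall>y\<in>Tball t. X y \<omega> \<le> \<delta> * t" using t0(1) by blast
    qed
  qed
qed

end

section \<open>Truncated second moments and variances\<close>

text \<open>Terms with \<open>2 ^ k \<le> x\<close> equal \<open>2 ^ k\<close>, the others decay
  geometrically. With \<open>x = Y\<close> this makes the truncated second moments, divided by the
  truncation level, summable when only the first moment is finite.\<close>

lemma sum_min_square_le:
  assumes x: "x \<ge> (0::real)"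
  shows "(\<Sum>k<n. (min x (2 ^ k))\<^sup>2 / 2 ^ k) \<le> 4 * x"
proof -
  have "(\<Sum>k<n. (min x (2 ^ k))\<^sup>2 / 2 ^ k) \<le> (if 2 ^ n \<le> x then 2 ^ n else 4 * x - 2 * x\<^sup>2 / 2 ^ n)"
    \<comment> \<open>once \<open>2 ^ n\<close> exceeds \<open>x\<close>, the terms from index \<open>n\<close> on add up to \<open>2 * x\<^sup>2 / 2 ^ n\<close>\<close>
  proof (induction n)
    case 0
    have "0 \<le> 2 * x * (2 - x)" if "x < 1" using that x by simp
    then show ?case by (auto simp: power2_eq_square algebra_simps)
  next
    case (Suc n)
    define p where "p = (2::real) ^ n"
    have p: "p > 0" by (simp add: p_def)
    have p2: "2 ^ Suc n = 2 * p" by (simp add: p_def)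
    define s where "s = (\<Sum>k<n. (min x (2 ^ k))\<^sup>2 / 2 ^ k)"
    have IH: "s \<le> (if p \<le> x then p else 4 * x - 2 * x\<^sup>2 / p)" using Suc by (simp only: s_def p_def)
    have step: "(\<Sum>k<Suc n. (min x (2 ^ k))\<^sup>2 / 2 ^ k) = s + (min x p)\<^sup>2 / p" by (simp add: s_def p_def)
    show ?case
    proof (cases "p \<le> x")
      case True
      then have "(\<Sum>k<Suc n. (min x (2 ^ k))\<^sup>2 / 2 ^ k) \<le> 2 * p"
        unfolding step using IH p by (simp add: power2_eq_square)
      moreover have "2 * p \<le> 4 * x - 2 * x\<^sup>2 / (2 * p)" if "x < 2 * p"
      proof -
        \<comment> \<open>The three products add up to \<open>4 * x * p - 2 * p * p - x * x\<close>;
          this is the index at which the powers of 2 pass \<open>x\<close>.\<close>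
        have "0 \<le> (x - p) * (2 * p - x) + p * (x - p) + p * p" using True that p by (intro add_nonneg_nonneg mult_nonneg_nonneg) auto
        then have "2 * p * p + x * x \<le> 4 * x * p" by (simp add: algebra_simps)
        then have "(2 * p * p + x * x) / p \<le> 4 * x" using p by (simp add: pos_divide_le_eq)
        then show ?thesis using p by (simp add: add_divide_distrib power2_eq_square)
      qed
      ultimately show ?thesis unfolding p2 by auto
    next
      case False
      then have "(\<Sum>k<Suc n. (min x (2 ^ k))\<^sup>2 / 2 ^ k) \<le> 4 * x - 2 * x\<^sup>2 / p + x\<^sup>2 / p"
        unfolding step using IH p by simp
      also have "\<dots> = 4 * x - 2 * x\<^sup>2 / (2 * p)" by simp
      finally show ?thesis using False p unfolding p2 by auto
    qed
  qed
  also have "\<dots> \<le> 4 * x" using x by auto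
  finally show ?thesis .
qed

lemma norm_function_nonneg:
  assumes "norm_function N" shows "N x \<ge> 0"
proof -
  have "N (0 *\<^sub>R x) = 0 * N x" "N (- 1 *\<^sub>R x) = N x" "N (x + - 1 *\<^sub>R x) \<le> N x + N (- 1 *\<^sub>R x)"
    using assms unfolding norm_function_def by (metis abs_0, metis abs_minus_cancel abs_one mult_1, metis)
  then show ?thesis by simp
qed

text \<open>By compactness \<open>N\<close> attains a positive minimum on the Euclidean unit sphere.
  Almost independence measures distances by the given norm, whereas lattice points are counted in
  Euclidean balls.\<close>

lemma norm_function_lower_bound:
  fixes N :: "'v::euclidean_space \<Rightarrow> real"
  assumes N: "norm_function N"
  shows "\<exists>\<kappa>>0. \<forall>x. \<kappa> * norm x \<le> N x"
proof -
  have sub: "N (x + y) \<le> N x + N y" and scale: "N (c *\<^sub>R x) = \<bar>c\<bar> * N x" and def: "N x = 0 \<Longrightarrow> x = 0" for x y c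
    using N by (auto simp: norm_function_def)
  have N0: "N 0 = 0" using scale[of 0 0] by simp
  define L where "L = (\<Sum>b\<in>Basis. N (b::'v))"
  have N_sum: "N (sum f B) \<le> (\<Sum>b\<in>B. N (f b))" if "finite B" for f and B :: "'v set"
    using that by (induction B rule: finite_induct) (auto simp: N0 intro: order_trans[OF sub])
  have upper: "N x \<le> L * norm x" for x
  proof -
    have "N x = N (\<Sum>b\<in>Basis. (x \<bullet> b) *\<^sub>R b)" by (simp add: euclidean_representation)
    also have "\<dots> \<le> (\<Sum>b\<in>Basis. N ((x \<bullet> b) *\<^sub>R b))" by (rule N_sum) simp
    also have "\<dots> \<le> (\<Sum>b\<in>Basis. norm x * N b)"
      by (intro sum_mono) (auto simp: scale Basis_le_norm intro!: mult_right_mono norm_function_nonneg[OF N])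
    finally show ?thesis by (simp add: L_def sum_distrib_left mult.commute sum_distrib_right)
  qed
  have diff: "\<bar>N x - N y\<bar> \<le> L * dist x y" for x y
    using sub[of "x - y" y] sub[of "y - x" x] upper[of "x - y"] upper[of "y - x"]
    by (simp add: dist_norm norm_minus_commute abs_le_iff)
  have "continuous_on UNIV N"
  proof (rule continuous_onI)
    fix x :: 'v and e :: real assume "e > 0"
    have L: "L \<ge> 0" unfolding L_def by (intro sum_nonneg norm_function_nonneg[OF N])
    show "\<exists>d>0. \<forall>y\<in>UNIV. dist y x < d \<longrightarrow> dist (N y) (N x) \<le> e"
    proof (intro exI[of _ "e / (L + 1)"] conjI ballI impI)
      fix y assume "dist y x < e / (L + 1)"
      then have "(L + 1) * dist y x \<le> e" using L by (simp add: field_simps)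
      then show "dist (N y) (N x) \<le> e" using diff[of y x] L by (simp add: dist_real_def algebra_simps)
        (smt (verit) zero_le_dist)
    qed (use L \<open>e > 0\<close> in auto)
  qed
  then have cont: "continuous_on (sphere 0 1) N" by (rule continuous_on_subset) auto
  have "\<exists>b::'v. b \<in> Basis" using nonempty_Basis by blast
  then have "sphere (0::'v) 1 \<noteq> {}" by (auto intro!: exI[of _ "SOME b. b \<in> Basis"] norm_Basis someI_ex)
  then obtain u where u: "u \<in> sphere 0 1" "\<And>x. x \<in> sphere 0 1 \<Longrightarrow> N u \<le> N x"
    using continuous_attains_inf[OF compact_sphere _ cont] by blast
  have "N u \<noteq> 0" using u(1) def[of u] by auto
  then have pos: "N u > 0" using norm_function_nonneg[OF N, of u] by simp
  have "N u * norm x \<le> N x" for x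
  proof (cases "x = 0")
    case False
    then have "x /\<^sub>R norm x \<in> sphere 0 1" by simp
    then have "N u \<le> N (x /\<^sub>R norm x)" by (rule u(2))
    then show ?thesis using False by (simp add: scale field_simps)
  qed (simp add: N0)
  then show ?thesis using pos by blast
qed

context noise_field begin

definition "segment_small p \<omega> \<longleftrightarrow> (\<forall>\<epsilon>>0. \<exists>\<eta>>0. \<exists>t0\<ge>1. \<forall>t\<ge>t0. \<forall>y\<in>Tball t. \<forall>m.
   real m \<le> \<eta> * t \<longrightarrow> (\<Sum>j<m. X (y + real j *\<^sub>R p) \<omega>) \<le> \<epsilon> * t)"

lemma segment_in_T:
  assumes "y \<in> T" "p \<in> T" shows "y + real j *\<^sub>R p \<in> T"
proof (cases "j = 0")
  case False
  then have "real j *\<^sub>R p \<in> T" using vector_semigroup_scale[OF T assms(2)] by simp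
  then show ?thesis using T assms by (auto simp: vector_semigroup_def)
qed (use assms in simp)

lemma truncated_moment_integrable: "integrable M (\<lambda>\<omega>. (min (Y \<omega>) b)\<^sup>2)" if "b \<ge> 0"
  using Y_measurable Y_nonneg that
  by (intro integrable_const_bound[of _ "b\<^sup>2"]) (auto intro!: AE_I2 power_mono)

lemma Y_integrable: "integrable M Y"
proof (rule Bochner_Integration.integrable_bound[of _ "\<lambda>\<omega>. 1 + Y \<omega> ^ l"])
  show "AE \<omega> in M. norm (Y \<omega>) \<le> norm (1 + Y \<omega> ^ l)"
  proof (rule AE_I2)
    fix \<omega> assume \<omega>: "\<omega> \<in> space M"
    have "Y \<omega> \<le> 1 + Y \<omega> ^ l"
    proof (cases "Y \<omega> \<le> 1")
      case True then show ?thesis using Y_nonneg[OF \<omega>] by (simp add: add_increasing2)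
    next
      case False
      then have "Y \<omega> ^ 1 \<le> Y \<omega> ^ l" using l by (intro power_increasing) auto
      then show ?thesis by simp
    qed
    then show "norm (Y \<omega>) \<le> norm (1 + Y \<omega> ^ l)" using Y_nonneg[OF \<omega>] by simp
  qed
qed (use moment Y_measurable in auto)

text \<open>Covariances of values at distance more than \<open>gap\<close> vanish, and all others
  are at most the second moment. Each point has at most \<open>L\<close> points within
  \<open>gap\<close>, since the differences are lattice points of Euclidean norm at most
  \<open>gap / \<kappa>\<close>; so the variance grows only linearly with \<open>card B\<close>.
  That \<open>L\<close> depends neither on \<psi> nor on \<open>B\<close> matters, because both will
  change with the radius.\<close>

lemma variance_sum_le:
  "\<exists>L\<ge>0. \<forall>(\<psi>::real \<Rightarrow> real) B b. \<psi> \<in> borel_measurable borel \<longrightarrow> finite B \<longrightarrow> B \<subseteq> T \<longrightarrow> (\<forall>x\<ge>0. 0 \<le> \<psi> x \<and> \<psi> x \<le> b) \<longrightarrow>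
     variance (\<lambda>\<omega>. \<Sum>y\<in>B. \<psi> (X y \<omega>)) \<le> L * real (card B) * expectation (\<lambda>\<omega>. (\<psi> (Y \<omega>))\<^sup>2)"
proof -
  obtain \<kappa> where \<kappa>: "\<kappa> > 0" "\<And>x. \<kappa> * norm x \<le> N x" using norm_function_lower_bound[OF N] by blast
  define D where "D = {d \<in> int_lattice :: (real ^ 'n) set. norm d \<le> gap / \<kappa>}"
  have finD: "finite D" unfolding D_def by (rule finite_lattice_ball)
  define L where "L = real (card D)"
  have near: "card {z \<in> B. N (y - z) \<le> gap} \<le> card D" if "y \<in> T" "B \<subseteq> T" for y B
  proof (rule card_inj_on_le[where f = "\<lambda>z. y - z"])
    show "inj_on (\<lambda>z. y - z) {z \<in> B. N (y - z) \<le> gap}" by (auto simp: inj_on_def)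
    show "(\<lambda>z. y - z) ` {z \<in> B. N (y - z) \<le> gap} \<subseteq> D"
    proof
      fix d assume "d \<in> (\<lambda>z. y - z) ` {z \<in> B. N (y - z) \<le> gap}"
      then obtain z where z: "z \<in> B" "N (y - z) \<le> gap" "d = y - z" by auto
      have "\<kappa> * norm d \<le> gap" using \<kappa>(2)[of d] z by simp
      then have "norm d \<le> gap / \<kappa>" using \<kappa>(1) by (simp add: field_simps)
      moreover have "d \<in> int_lattice"
        using z T that unfolding vector_semigroup_def by (blast intro: int_lattice_diff)
      ultimately show "d \<in> D" by (simp add: D_def)
    qed
  qed (rule finD)
  have "variance (\<lambda>\<omega>. \<Sum>y\<in>B. \<psi> (X y \<omega>)) \<le> L * real (card B) * expectation (\<lambda>\<omega>. (\<psi> (Y \<omega>))\<^sup>2)"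
    if \<psi> [measurable]: "\<psi> \<in> borel_measurable borel" and finB: "finite B" and BT: "B \<subseteq> T"
      and \<psi>b: "\<forall>x\<ge>0. 0 \<le> \<psi> x \<and> \<psi> x \<le> b" for \<psi> :: "real \<Rightarrow> real" and B b
  proof -
    define Z where "Z y \<omega> = \<psi> (X y \<omega>)" for y \<omega>
    define m where "m = expectation (\<lambda>\<omega>. \<psi> (Y \<omega>))"
    define v where "v = expectation (\<lambda>\<omega>. (\<psi> (Y \<omega>))\<^sup>2)"
    have Zm [measurable]: "Z y \<in> borel_measurable M" if "y \<in> B" for y
      unfolding Z_def using that BT by (intro measurable_compose[OF X_measurable \<psi>]) auto
    have b0: "b \<ge> 0" using \<psi>b by (meson order_refl order_trans)
    have Zb: "0 \<le> Z y \<omega> \<and> Z y \<omega> \<le> b" if "y \<in> B" "\<omega> \<in> space M" for y \<omega>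
      using \<psi>b X_nonneg that BT by (auto simp: Z_def)
    have intZ: "integrable M (Z y)" if "y \<in> B" for y
      using Zb[OF that] Zm[OF that] by (intro integrable_const_bound[of _ b]) (auto intro!: AE_I2)
    have intZZ: "integrable M (\<lambda>\<omega>. Z y \<omega> * Z z \<omega>)" if "y \<in> B" "z \<in> B" for y z
      using Zb[OF that(1)] Zb[OF that(2)] Zm[OF that(1)] Zm[OF that(2)]
        b0 by (intro integrable_const_bound[of _ "b * b"]) (auto intro!: AE_I2 mult_mono simp: abs_mult)
    have EZ: "expectation (Z y) = m" if "y \<in> B" for y
      unfolding Z_def m_def using that BT by (intro integral_X) auto
    have EZ2: "expectation (\<lambda>\<omega>. (Z y \<omega>)\<^sup>2) = v" if "y \<in> B" for y
      unfolding Z_def v_def using that BT integral_X[of y "\<lambda>x. (\<psi> x)\<^sup>2"] by auto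
    have v0: "v \<ge> 0" unfolding v_def by (intro integral_nonneg_AE) auto
    have cov: "expectation (\<lambda>\<omega>. (Z y \<omega> - m) * (Z z \<omega> - m)) = expectation (\<lambda>\<omega>. Z y \<omega> * Z z \<omega>) - m * m"
      if "y \<in> B" "z \<in> B" for y z
    proof -
      have "expectation (\<lambda>\<omega>. (Z y \<omega> - m) * (Z z \<omega> - m))
          = expectation (\<lambda>\<omega>. Z y \<omega> * Z z \<omega> - m * Z y \<omega> - m * Z z \<omega> + m * m)"
        by (intro Bochner_Integration.integral_cong) (auto simp: algebra_simps)
      also have "\<dots> = expectation (\<lambda>\<omega>. Z y \<omega> * Z z \<omega>) - m * m - m * m + m * m"
        using intZZ[OF that] intZ[OF that(1)] intZ[OF that(2)] EZ[OF that(1)] EZ[OF that(2)]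
        by (simp add: prob_space)
      finally show ?thesis by simp
    qed
    have cov_far: "expectation (\<lambda>\<omega>. (Z y \<omega> - m) * (Z z \<omega> - m)) = 0" if yz: "y \<in> B" "z \<in> B" "N (y - z) > gap" for y z
    proof -
      have "expectation (\<lambda>\<omega>. \<psi> ((\<lambda>x\<in>{y}. X x \<omega>) y) * \<psi> ((\<lambda>x\<in>{z}. X x \<omega>) z))
        = expectation (\<lambda>\<omega>. \<psi> ((\<lambda>x\<in>{y}. X x \<omega>) y)) * expectation (\<lambda>\<omega>. \<psi> ((\<lambda>x\<in>{z}. X x \<omega>) z))"
        using yz BT intZ[OF yz(1), unfolded Z_def] intZ[OF yz(2), unfolded Z_def]
        by (intro expectation_mult[of "{y}" "{z}" "\<lambda>f. \<psi> (f y)" "\<lambda>f. \<psi> (f z)"])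
          (auto simp: set_distance_singletons)
      then have "expectation (\<lambda>\<omega>. Z y \<omega> * Z z \<omega>) = m * m"
        using EZ[OF yz(1)] EZ[OF yz(2)] by (simp add: Z_def[abs_def])
      then show ?thesis using cov yz by simp
    qed
    have cov_near: "expectation (\<lambda>\<omega>. (Z y \<omega> - m) * (Z z \<omega> - m)) \<le> v" if yz: "y \<in> B" "z \<in> B" for y z
    proof -
      \<comment> \<open>The mixed moment is bounded by
        \<open>2 * a * b \<le> a\<^sup>2 + b\<^sup>2\<close> and equality of distributions.\<close>
      have "expectation (\<lambda>\<omega>. Z y \<omega> * Z z \<omega>) \<le> expectation (\<lambda>\<omega>. ((Z y \<omega>)\<^sup>2 + (Z z \<omega>)\<^sup>2) / 2)"
      proof (rule integral_mono)
        show "integrable M (\<lambda>\<omega>. ((Z y \<omega>)\<^sup>2 + (Z z \<omega>)\<^sup>2) / 2)"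
          using intZZ[OF yz(1) yz(1)] intZZ[OF yz(2) yz(2)] by (simp add: power2_eq_square)
        show "Z y \<omega> * Z z \<omega> \<le> ((Z y \<omega>)\<^sup>2 + (Z z \<omega>)\<^sup>2) / 2" for \<omega>
          using zero_le_power2[of "Z y \<omega> - Z z \<omega>"] by (simp add: power2_eq_square algebra_simps)
      qed (rule intZZ[OF yz])
      also have "\<dots> = (v + v) / 2"
        using intZZ[OF yz(1) yz(1)] intZZ[OF yz(2) yz(2)] EZ2[OF yz(1)] EZ2[OF yz(2)] by (simp add: power2_eq_square)
      also have "(v + v) / 2 = v" by simp
      finally have le: "expectation (\<lambda>\<omega>. Z y \<omega> * Z z \<omega>) \<le> v" .
      have "expectation (\<lambda>\<omega>. Z y \<omega> * Z z \<omega>) - m * m \<le> expectation (\<lambda>\<omega>. Z y \<omega> * Z z \<omega>)"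
        by (simp only: diff_le_eq le_add_same_cancel1 zero_le_square)
      then show ?thesis unfolding cov[OF yz] using le by (rule order_trans)
    qed
    have intW: "integrable M (\<lambda>\<omega>. (Z y \<omega> - m) * (Z z \<omega> - m))" if "y \<in> B" "z \<in> B" for y z
    proof -
      have "(\<lambda>\<omega>. (Z y \<omega> - m) * (Z z \<omega> - m)) = (\<lambda>\<omega>. Z y \<omega> * Z z \<omega> - m * Z y \<omega> - m * Z z \<omega> + m * m)"
        by (auto simp: algebra_simps)
      then show ?thesis using intZZ[OF that] intZ[OF that(1)] intZ[OF that(2)] by simp
    qed
    have "expectation (\<lambda>\<omega>. \<Sum>y\<in>B. Z y \<omega>) = real (card B) * m"
      using intZ EZ by (simp add: Bochner_Integration.integral_sum)
    then have "variance (\<lambda>\<omega>. \<Sum>y\<in>B. Z y \<omega>) = expectation (\<lambda>\<omega>. ((\<Sum>y\<in>B. Z y \<omega>) - real (card B) * m)\<^sup>2)"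
      by simp
    also have "\<dots> = expectation (\<lambda>\<omega>. \<Sum>y\<in>B. \<Sum>z\<in>B. (Z y \<omega> - m) * (Z z \<omega> - m))"
    proof (rule Bochner_Integration.integral_cong[OF refl])
      fix \<omega>
      have "(\<Sum>y\<in>B. Z y \<omega>) - real (card B) * m = (\<Sum>y\<in>B. Z y \<omega> - m)" by (simp add: sum_subtractf)
      then show "((\<Sum>y\<in>B. Z y \<omega>) - real (card B) * m)\<^sup>2 = (\<Sum>y\<in>B. \<Sum>z\<in>B. (Z y \<omega> - m) * (Z z \<omega> - m))"
        by (simp only: power2_eq_square sum_product)
    qed
    also have "\<dots> = (\<Sum>y\<in>B. \<Sum>z\<in>B. expectation (\<lambda>\<omega>. (Z y \<omega> - m) * (Z z \<omega> - m)))"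
      using intW by (simp add: Bochner_Integration.integral_sum Bochner_Integration.integrable_sum)
    also have "\<dots> \<le> (\<Sum>y\<in>B. L * v)"
    proof (rule sum_mono)
      fix y assume y: "y \<in> B"
      have "(\<Sum>z\<in>B. expectation (\<lambda>\<omega>. (Z y \<omega> - m) * (Z z \<omega> - m))) \<le> (\<Sum>z\<in>B. if N (y - z) \<le> gap then v else 0)"
        using cov_far cov_near y by (intro sum_mono) (auto simp: not_le)
      also have "\<dots> = real (card {z \<in> B. N (y - z) \<le> gap}) * v"
        using finB by (simp add: sum.If_cases Int_def)
      also have "\<dots> \<le> L * v" unfolding L_def using near[of y B] y BT v0 by (intro mult_right_mono) auto
      finally show "(\<Sum>z\<in>B. expectation (\<lambda>\<omega>. (Z y \<omega> - m) * (Z z \<omega> - m))) \<le> L * v" .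
    qed
    also have "\<dots> = L * real (card B) * v" by simp
    finally show ?thesis unfolding Z_def v_def .
  qed
  then show ?thesis by (intro exI[of _ L]) (auto simp: L_def)
qed

end

text \<open>The linear term keeps coefficient 1, so that the mean enters the exponential moment
  without loss; only the quadratic term carries the factor \<open>exp u\<close>, which truncation
  will bound. Multiplying \<open>1 - u \<le> exp (- u)\<close> by \<open>exp u\<close> gives
  \<open>exp u - 1 \<le> u * exp u\<close>, and this is used twice.\<close>

lemma exp_le_quadratic:
  assumes "u \<ge> (0::real)"
  shows "exp u \<le> 1 + u + u\<^sup>2 * exp u"
proof -
  have "(1 - u) * exp u \<le> exp (- u) * exp u"
    using exp_ge_add_one_self[of "- u"] by (intro mult_right_mono) auto
  then have a: "exp u - 1 \<le> u * exp u" by (simp add: exp_minus algebra_simps)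
  then have "u * (exp u - 1) \<le> u * (u * exp u)" using assms by (rule mult_left_mono)
  then show ?thesis using a by (simp add: power2_eq_square algebra_simps)
qed

text \<open>Bounds the quadratic term of the exponential estimate for a parameter proportional to
  \<open>k / 2 ^ k\<close> whose product with the truncation level is \<open>k / 4\<close>. The
  quarter leaves room: \<open>(real k)\<^sup>2\<close> costs another factor
  \<open>exp (k / 4)\<close>, and \<open>exp (1 / 2) \<le> 2\<close>.\<close>

lemma square_times_exp_quarter_le: "(real k)\<^sup>2 * exp (real k / 4) / 2 ^ k \<le> 32"
proof -
  have "(real k / 4)\<^sup>2 / 2 \<le> exp (real k / 4)"
    using exp_lower_Taylor_quadratic[of "real k / 4"] by simp
  then have "(real k)\<^sup>2 \<le> 32 * exp (real k / 4)" by (simp add: power_divide)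
  then have "(real k)\<^sup>2 * exp (real k / 4) \<le> 32 * exp (real k / 4) * exp (real k / 4)"
    by (intro mult_right_mono) auto
  also have "\<dots> = 32 * exp (real k * (1 / 2))" by (simp add: mult.assoc flip: exp_add)
  also have "\<dots> = 32 * exp (1 / 2) ^ k" by (simp only: exp_of_nat_mult)
  also have "\<dots> \<le> 32 * 2 ^ k"
  proof -
    have "(exp (1 / 2) :: real)\<^sup>2 = exp 1" by (simp add: power2_eq_square flip: exp_add)
    also have "\<dots> \<le> 2\<^sup>2" using exp_le by simp
    finally have "exp (1 / 2 :: real) \<le> 2" by (rule power2_le_imp_le) simp
    then show ?thesis by (intro mult_left_mono power_mono) auto
  qed
  finally show ?thesis by (simp add: field_simps)
qed

section \<open>Segments in dimension one\<close>

context noise_field begin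

lemma exists_small_excess:
  assumes "\<epsilon> > 0"
  obtains K where "K \<ge> 0" "expectation (\<lambda>\<omega>. max (Y \<omega> - K) 0) \<le> \<epsilon>"
proof -
  have "(\<lambda>n. expectation (\<lambda>\<omega>. max (Y \<omega> - real n) 0)) \<longlonglongrightarrow> expectation (\<lambda>\<omega>. 0)"
  proof (rule integral_dominated_convergence[where w = Y])
    show "AE \<omega> in M. (\<lambda>n. max (Y \<omega> - real n) 0) \<longlonglongrightarrow> 0"
    proof (rule AE_I2)
      fix \<omega>
      obtain n0 :: nat where "Y \<omega> \<le> real n0" using real_arch_simple by blast
      then have "\<forall>n\<ge>n0. max (Y \<omega> - real n) 0 = 0" by auto
      then have "\<forall>\<^sub>F n in sequentially. max (Y \<omega> - real n) 0 = 0" by (auto simp: eventually_sequentially)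
      then show "(\<lambda>n. max (Y \<omega> - real n) 0) \<longlonglongrightarrow> 0" by (rule tendsto_eventually)
    qed
    show "AE \<omega> in M. norm (max (Y \<omega> - real n) 0) \<le> Y \<omega>" for n
      using Y_nonneg by (intro AE_I2) auto
  qed (use Y_measurable Y_integrable in auto)
  then have "\<forall>\<^sub>F n in sequentially. expectation (\<lambda>\<omega>. max (Y \<omega> - real n) 0) < \<epsilon>"
    using assms by (auto dest: order_tendstoD(2))
  then obtain n :: nat where "expectation (\<lambda>\<omega>. max (Y \<omega> - real n) 0) < \<epsilon>"
    by (auto simp: eventually_sequentially)
  then show ?thesis using that[of "real n"] by simp
qed

text \<open>In dimension one all short segments lie in a ball with linearly many points, so it suffices to
  bound the total excess over a constant: truncate at the radius and apply Chebyshev's inequality.\<close>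

lemma AE_excess_small:
  assumes l1: "l = 1" and \<epsilon>: "\<epsilon> > 0"
  shows "\<exists>K\<ge>0. AE \<omega> in M. \<forall>\<^sub>F k in sequentially. (\<Sum>y\<in>Tball (2 ^ k). max (X y \<omega> - K) 0) \<le> \<epsilon> * 2 ^ k"
proof -
  note [measurable] = Y_measurable
  \<comment> \<open>With this \<open>K\<close> the mean of the total excess over a ball of at most
    \<open>K0 * 2 ^ k\<close> points is at most \<open>\<epsilon> / 2 * 2 ^ k\<close>; the other
    half is for the fluctuation.\<close>
  obtain K where K: "K \<ge> 0" "expectation (\<lambda>\<omega>. max (Y \<omega> - K) 0) \<le> \<epsilon> / (2 * K0)"
    using exists_small_excess[of "\<epsilon> / (2 * K0)"] \<epsilon> K0 by auto
  obtain L where L: "L \<ge> 0" and var: "\<And>(\<psi>::real \<Rightarrow> real) B b. \<psi> \<in> borel_measurable borel \<Longrightarrow> finite B \<Longrightarrow> B \<subseteq> T \<Longrightarrow>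
     (\<forall>x\<ge>0. 0 \<le> \<psi> x \<and> \<psi> x \<le> b) \<Longrightarrow>
     variance (\<lambda>\<omega>. \<Sum>y\<in>B. \<psi> (X y \<omega>)) \<le> L * real (card B) * expectation (\<lambda>\<omega>. (\<psi> (Y \<omega>))\<^sup>2)"
    using variance_sum_le by blast
  define \<psi> where "\<psi> k x = max (min x (2 ^ k) - K) 0" for k :: nat and x :: real
  define V where "V k \<omega> = (\<Sum>y\<in>Tball (2 ^ k). \<psi> k (X y \<omega>))" for k :: nat and \<omega>
  \<comment> \<open>The integral of \<open>f k\<close> is the Chebyshev bound up to a constant: the
    variance of \<open>V k\<close> is at most of order \<open>2 ^ k\<close> times the truncated
    second moment, and it is divided by the square of a multiple of \<open>2 ^ k\<close>.\<close>
  define f where "f k \<omega> = (min (Y \<omega>) (2 ^ k))\<^sup>2 / 2 ^ k" for k :: nat and \<omega>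
  define E where "E k = {\<omega> \<in> space M. \<epsilon> / 2 * 2 ^ k \<le> \<bar>V k \<omega> - expectation (V k)\<bar>}" for k :: nat
  have \<psi>m [measurable]: "\<psi> k \<in> borel_measurable borel" for k unfolding \<psi>_def by measurable
  have \<psi>b: "\<forall>x\<ge>0. 0 \<le> \<psi> k x \<and> \<psi> k x \<le> 2 ^ k" for k using K(1) by (auto simp: \<psi>_def)
  have BT: "Tball R \<subseteq> T" for R by (auto simp: Tball_def)
  have \<psi>Xm: "(\<lambda>\<omega>. \<psi> k (X y \<omega>)) \<in> borel_measurable M" if "y \<in> T" for k y
    using measurable_compose[OF X_measurable[OF that] \<psi>m] .
  have Vm [measurable]: "V k \<in> borel_measurable M" for k
    unfolding V_def using \<psi>Xm BT by (intro borel_measurable_sum) auto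
  have int\<psi>: "integrable M (\<lambda>\<omega>. \<psi> k (X y \<omega>))" if "y \<in> T" for k y
    using \<psi>b[of k] X_nonneg[OF that] by (intro integrable_const_bound[of _ "2 ^ k"] \<psi>Xm[OF that] AE_I2) auto
  have V0: "0 \<le> V k \<omega>" if "\<omega> \<in> space M" for k \<omega>
    unfolding V_def by (intro sum_nonneg) (simp add: \<psi>_def)
  have intV2: "integrable M (\<lambda>\<omega>. (V k \<omega>)\<^sup>2)" for k
  proof (rule integrable_const_bound[of _ "(real (card (Tball (2 ^ k))) * 2 ^ k)\<^sup>2"])
    show "AE \<omega> in M. norm ((V k \<omega>)\<^sup>2) \<le> (real (card (Tball (2 ^ k))) * 2 ^ k)\<^sup>2"
    proof (rule AE_I2)
      fix \<omega> assume \<omega>: "\<omega> \<in> space M"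
      have "V k \<omega> \<le> real (card (Tball (2 ^ k))) * 2 ^ k"
        unfolding V_def using \<psi>b[of k] X_nonneg[OF _ \<omega>] BT by (intro sum_bounded_above) auto
      then show "norm ((V k \<omega>)\<^sup>2) \<le> (real (card (Tball (2 ^ k))) * 2 ^ k)\<^sup>2"
        using V0[OF \<omega>, of k] by (simp add: power_mono)
    qed
  qed measurable
  have card: "real (card (Tball (2 ^ k))) \<le> K0 * 2 ^ k" for k
    using card_le[of "2 ^ k"] l1 by (simp add: Tball_def)
  have EV: "expectation (V k) \<le> \<epsilon> / 2 * 2 ^ k" for k
  proof -
    have "expectation (V k) = (\<Sum>y\<in>Tball (2 ^ k). expectation (\<lambda>\<omega>. \<psi> k (X y \<omega>)))"
      unfolding V_def using int\<psi> BT by (intro Bochner_Integration.integral_sum) auto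
    also have "\<dots> = (\<Sum>y\<in>Tball (2 ^ k). expectation (\<lambda>\<omega>. \<psi> k (Y \<omega>)))"
      using BT by (intro sum.cong integral_X) auto
    also have "\<dots> = real (card (Tball (2 ^ k))) * expectation (\<lambda>\<omega>. \<psi> k (Y \<omega>))" by simp
    also have "\<dots> \<le> (K0 * 2 ^ k) * (\<epsilon> / (2 * K0))"
    proof (intro mult_mono card)
      have "expectation (\<lambda>\<omega>. \<psi> k (Y \<omega>)) \<le> expectation (\<lambda>\<omega>. max (Y \<omega> - K) 0)"
      proof (rule integral_mono)
        show "integrable M (\<lambda>\<omega>. max (Y \<omega> - K) 0)" using Y_integrable by auto
        show "integrable M (\<lambda>\<omega>. \<psi> k (Y \<omega>))"
          using \<psi>b[of k] Y_nonneg by (intro integrable_const_bound[of _ "2 ^ k"] AE_I2) auto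
      qed (auto simp: \<psi>_def)
      then show "expectation (\<lambda>\<omega>. \<psi> k (Y \<omega>)) \<le> \<epsilon> / (2 * K0)" using K(2) by simp
      show "0 \<le> expectation (\<lambda>\<omega>. \<psi> k (Y \<omega>))" by (rule Bochner_Integration.integral_nonneg) (simp add: \<psi>_def)
    qed (use K0 in auto)
    also have "\<dots> = \<epsilon> / 2 * 2 ^ k" using K0 by (simp add: field_simps)
    finally show ?thesis .
  qed
  have intf: "integrable M (f k)" for k unfolding f_def using truncated_moment_integrable by simp
  have sumf: "summable (\<lambda>k. integral\<^sup>L M (f k))"
  proof (rule summable_integral_bounded[OF intf])
    show "integrable M (\<lambda>\<omega>. 4 * Y \<omega>)" using Y_integrable by simp
    show "(\<Sum>k<n. f k \<omega>) \<le> 4 * Y \<omega>" if "\<omega> \<in> space M" for n \<omega>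
      unfolding f_def using sum_min_square_le[OF Y_nonneg[OF that]] .
  qed (simp add: f_def)
  have probE: "prob (E k) \<le> 4 * L * K0 / \<epsilon>\<^sup>2 * integral\<^sup>L M (f k)" for k
  proof -
    have "prob (E k) \<le> variance (V k) / (\<epsilon> / 2 * 2 ^ k)\<^sup>2"
      unfolding E_def using \<epsilon> intV2 by (intro Chebyshev_inequality) auto
    also have "\<dots> \<le> (L * (K0 * 2 ^ k) * (2 ^ k * integral\<^sup>L M (f k))) / (\<epsilon> / 2 * 2 ^ k)\<^sup>2"
    proof (intro divide_right_mono)
      have "variance (V k) \<le> L * real (card (Tball (2 ^ k))) * expectation (\<lambda>\<omega>. (\<psi> k (Y \<omega>))\<^sup>2)"
        unfolding V_def by (rule var[OF \<psi>m finite_Tball BT \<psi>b])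
      also have "\<dots> \<le> L * (K0 * 2 ^ k) * (2 ^ k * integral\<^sup>L M (f k))"
      proof (intro mult_mono mult_left_mono card L)
        have "2 ^ k * integral\<^sup>L M (f k) = expectation (\<lambda>\<omega>. (min (Y \<omega>) (2 ^ k))\<^sup>2)"
          by (simp add: f_def[abs_def])
        moreover have "expectation (\<lambda>\<omega>. (\<psi> k (Y \<omega>))\<^sup>2) \<le> expectation (\<lambda>\<omega>. (min (Y \<omega>) (2 ^ k))\<^sup>2)"
        proof (rule integral_mono)
          show "integrable M (\<lambda>\<omega>. (\<psi> k (Y \<omega>))\<^sup>2)"
            using \<psi>b[of k] Y_nonneg
            by (intro integrable_const_bound[of _ "(2 ^ k)\<^sup>2"] AE_I2) (auto intro: power_mono)
          show "(\<psi> k (Y \<omega>))\<^sup>2 \<le> (min (Y \<omega>) (2 ^ k))\<^sup>2" if "\<omega> \<in> space M" for \<omega>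
            using Y_nonneg[OF that] K(1) by (intro power_mono) (auto simp: \<psi>_def)
        qed (rule truncated_moment_integrable, simp)
        ultimately show "expectation (\<lambda>\<omega>. (\<psi> k (Y \<omega>))\<^sup>2) \<le> 2 ^ k * integral\<^sup>L M (f k)" by simp
        show "0 \<le> expectation (\<lambda>\<omega>. (\<psi> k (Y \<omega>))\<^sup>2)" by (rule Bochner_Integration.integral_nonneg) simp
      qed (use L K0 in auto)
      finally show "variance (V k) \<le> L * (K0 * 2 ^ k) * (2 ^ k * integral\<^sup>L M (f k))" .
    qed simp
    also have "\<dots> = 4 * L * K0 / \<epsilon>\<^sup>2 * integral\<^sup>L M (f k)"
      using \<epsilon> by (simp add: power2_eq_square field_simps)
    finally show ?thesis .
  qed
  have "summable (\<lambda>k. prob (E k))"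
    by (rule summable_comparison_test'[OF summable_mult[OF sumf, of "4 * L * K0 / \<epsilon>\<^sup>2"], of 0])
      (use probE in auto)
  then have "AE \<omega> in M. \<forall>\<^sub>F k in sequentially. \<omega> \<in> space M - E k"
    by (intro borel_cantelli_AE1) (auto simp: emeasure_eq_measure E_def)
  \<comment> \<open>Eventually no value in the ball exceeds \<open>2 ^ k\<close>, so truncation
    changes nothing and \<open>V k\<close> is the full excess.\<close>
  moreover have "AE \<omega> in M. \<forall>\<^sub>F k in sequentially. \<forall>y\<in>Tball (2 ^ k). X y \<omega> \<le> 1 * 2 ^ k"
    by (rule AE_eventually_le_dyadic) simp
  ultimately have "AE \<omega> in M. \<forall>\<^sub>F k in sequentially. (\<Sum>y\<in>Tball (2 ^ k). max (X y \<omega> - K) 0) \<le> \<epsilon> * 2 ^ k"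
  proof eventually_elim
    case (elim \<omega>)
    from elim show ?case
    proof eventually_elim
      case (elim k)
      have "(\<Sum>y\<in>Tball (2 ^ k). max (X y \<omega> - K) 0) = V k \<omega>"
        unfolding V_def \<psi>_def using elim(2) by (intro sum.cong) (auto simp: min_absorb1)
      also have "\<dots> \<le> expectation (V k) + \<epsilon> / 2 * 2 ^ k"
        using elim(1) unfolding E_def by (simp add: not_le abs_diff_less_iff less_imp_le del: times_divide_eq_left)
      also have "\<dots> \<le> \<epsilon> / 2 * 2 ^ k + \<epsilon> / 2 * 2 ^ k" using EV by (rule add_right_mono)
      also have "\<dots> = \<epsilon> * 2 ^ k" by simp
      finally show ?case .
    qed
  qed
  then show ?thesis using K(1) by blast
qed

text \<open>Cutting at \<open>K i\<close> leaves at most \<open>m * K i\<close>, small for small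
  \<eta>, plus excesses at the points of the segment, which are distinct since
  \<open>p \<noteq> 0\<close>. The total excess in a ball bounds the latter for all starting points
  at once.\<close>

lemma AE_segment_small_dim1:
  assumes l1: "l = 1" and p: "p \<in> T" "p \<noteq> 0"
  shows "AE \<omega> in M. segment_small p \<omega>"
proof -
  have "\<forall>i::nat. \<exists>K\<ge>0. AE \<omega> in M. \<forall>\<^sub>F k in sequentially. (\<Sum>y\<in>Tball (2 ^ k). max (X y \<omega> - K) 0) \<le> 1 / Suc i * 2 ^ k"
    by (intro allI AE_excess_small l1) simp
  then obtain K where K: "\<And>i::nat. K i \<ge> 0"
    "\<And>i. AE \<omega> in M. \<forall>\<^sub>F k in sequentially. (\<Sum>y\<in>Tball (2 ^ k). max (X y \<omega> - K i) 0) \<le> 1 / Suc i * 2 ^ k"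
    by (auto dest!: choice)
  have "AE \<omega> in M. \<forall>i. \<forall>\<^sub>F k in sequentially. (\<Sum>y\<in>Tball (2 ^ k). max (X y \<omega> - K i) 0) \<le> 1 / Suc i * 2 ^ k"
    using K(2) by (subst AE_all_countable) blast
  then show ?thesis
  proof (rule AE_mp, intro AE_I2 impI)
    fix \<omega> assume ev: "\<forall>i. \<forall>\<^sub>F k in sequentially. (\<Sum>y\<in>Tball (2 ^ k). max (X y \<omega> - K i) 0) \<le> 1 / Suc i * 2 ^ k"
    show "segment_small p \<omega>" unfolding segment_small_def
    proof (intro allI impI)
      fix \<epsilon> :: real assume \<epsilon>: "\<epsilon> > 0"
      \<comment> \<open>The 8 accounts for \<open>2 ^ k \<le> 4 * t\<close> and for the half of
        \<epsilon> reserved for the excess.\<close>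
      then obtain i where i: "1 / Suc i < \<epsilon> / 8"
        using reals_Archimedean[of "\<epsilon> / 8"] by (auto simp: inverse_eq_divide)
      \<comment> \<open>The first entry keeps a segment from a point of norm at most
        \<open>t\<close> within radius \<open>2 * t\<close>; the second makes the part below
        \<open>K i\<close> contribute at most \<open>\<epsilon> / 2 * t\<close>.\<close>
      define \<eta> where "\<eta> = min (1 / norm p) (\<epsilon> / (2 * (K i + 1)))"
      have \<eta>: "\<eta> > 0" using p \<epsilon> K(1)[of i] by (simp add: \<eta>_def)
      have \<eta>p: "\<eta> * norm p \<le> 1"
      proof -
        have "\<eta> * norm p \<le> 1 / norm p * norm p" unfolding \<eta>_def by (intro mult_right_mono) auto
        then show ?thesis using p by simp
      qed
      have \<eta>K: "\<eta> * K i \<le> \<epsilon> / 2"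
      proof -
        have "\<eta> * K i \<le> \<epsilon> / (2 * (K i + 1)) * (K i + 1)"
          unfolding \<eta>_def using K(1)[of i] \<epsilon> by (intro mult_mono) auto
        also have "\<dots> = \<epsilon> / 2"
        proof -
          have "\<epsilon> / (2 * c) * c = \<epsilon> / 2" if "c \<noteq> 0" for c using that by simp
          then show ?thesis using K(1)[of i] by (metis add_nonneg_pos less_irrefl zero_less_one)
        qed
        finally show ?thesis .
      qed
      obtain t0 :: real where t0: "t0 \<ge> 1" "\<And>t. t \<ge> t0 \<Longrightarrow> \<exists>k. t \<le> 2 ^ k \<and> 2 ^ k \<le> 2 * t \<and>
          (\<Sum>y\<in>Tball (2 ^ k). max (X y \<omega> - K i) 0) \<le> 1 / Suc i * 2 ^ k"
        using eventually_dyadic[OF ev[rule_format, of i]] by blast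
      have "(\<Sum>j<m. X (y + real j *\<^sub>R p) \<omega>) \<le> \<epsilon> * t"
        if t: "t \<ge> t0" and y: "y \<in> Tball t" and m: "real m \<le> \<eta> * t" for t y m
      proof -
        have "2 * t \<ge> t0" using t t0(1) by linarith
        then obtain k where k: "2 * t \<le> 2 ^ k" "2 ^ k \<le> 2 * (2 * t)"
          "(\<Sum>y\<in>Tball (2 ^ k). max (X y \<omega> - K i) 0) \<le> 1 / Suc i * 2 ^ k"
          using t0(2) by blast
        have inj: "inj_on (\<lambda>j. y + real j *\<^sub>R p) {..<m}" using p by (auto simp: inj_on_def)
        have sub: "(\<lambda>j. y + real j *\<^sub>R p) ` {..<m} \<subseteq> Tball (2 ^ k)"
        proof
          fix z assume "z \<in> (\<lambda>j. y + real j *\<^sub>R p) ` {..<m}"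
          then obtain j where j: "j < m" "z = y + real j *\<^sub>R p" by auto
          have "real j * norm p \<le> \<eta> * t * norm p" using j m by (intro mult_right_mono) auto
          also have "\<dots> \<le> 1 * t" using mult_right_mono[OF \<eta>p, of t] t t0(1) by (simp add: mult_ac)
          finally have "norm z \<le> 2 * t" using j y norm_triangle_ineq[of y "real j *\<^sub>R p"] by (simp add: Tball_def)
          then show "z \<in> Tball (2 ^ k)" using j y k(1) segment_in_T[of y p j] p by (simp add: Tball_def)
        qed
        have "(\<Sum>j<m. X (y + real j *\<^sub>R p) \<omega>) \<le> (\<Sum>j<m. K i + max (X (y + real j *\<^sub>R p) \<omega> - K i) 0)"
          by (intro sum_mono) auto
        also have "\<dots> = real m * K i + (\<Sum>z\<in>(\<lambda>j. y + real j *\<^sub>R p) ` {..<m}. max (X z \<omega> - K i) 0)"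
          by (simp add: sum.distrib sum.reindex[OF inj])
        also have "\<dots> \<le> \<eta> * t * K i + (\<Sum>z\<in>Tball (2 ^ k). max (X z \<omega> - K i) 0)"
          using m K(1)[of i] by (intro add_mono mult_right_mono sum_mono2 finite_Tball sub) auto
        also have "\<dots> \<le> \<epsilon> / 2 * t + \<epsilon> / 8 * (4 * t)"
        proof (intro add_mono)
          show "\<eta> * t * K i \<le> \<epsilon> / 2 * t" using mult_right_mono[OF \<eta>K, of t] t t0(1) by (simp add: mult_ac)
          have "1 / Suc i * 2 ^ k \<le> \<epsilon> / 8 * (4 * t)" using i k(2) t t0(1) \<epsilon> by (intro mult_mono) auto
          then show "(\<Sum>z\<in>Tball (2 ^ k). max (X z \<omega> - K i) 0) \<le> \<epsilon> / 8 * (4 * t)" using k(3) by (rule order_trans[rotated])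
        qed
        also have "\<dots> = \<epsilon> * t" by simp
        finally show ?thesis .
      qed
      then show "\<exists>\<eta>>0. \<exists>t0\<ge>1. \<forall>t\<ge>t0. \<forall>y\<in>Tball t. \<forall>m. real m \<le> \<eta> * t \<longrightarrow>
          (\<Sum>j<m. X (y + real j *\<^sub>R p) \<omega>) \<le> \<epsilon> * t"
        using \<eta> t0(1) by blast
    qed
  qed
qed

section \<open>Segments in dimension at least two\<close>

text \<open>Almost independence speaks of two families only. It is applied to the first
  \<open>m\<close> points of the segment and the next one, whose distance is at least
  \<open>N p > gap\<close>, and induction factors the product completely.\<close>

lemma expectation_prod_segment:
  assumes y: "y \<in> T" and p: "p \<in> T" and gap_p: "N p > gap"
    and \<psi> [measurable]: "\<psi> \<in> borel_measurable borel" and \<psi>b: "\<And>x::real. x \<ge> 0 \<Longrightarrow> 0 \<le> \<psi> x \<and> \<psi> x \<le> (b::real)"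
  shows "expectation (\<lambda>\<omega>. \<Prod>j<m. \<psi> (X (y + real j *\<^sub>R p) \<omega>)) = expectation (\<lambda>\<omega>. \<psi> (Y \<omega>)) ^ m"
proof (induction m)
  case 0 then show ?case by (simp add: prob_space)
next
  case (Suc m)
  define z where "z j = y + real j *\<^sub>R p" for j :: nat
  have zT: "z j \<in> T" for j unfolding z_def by (rule segment_in_T[OF y p])
  have Zm: "(\<lambda>\<omega>. \<psi> (X (z j) \<omega>)) \<in> borel_measurable M" for j
    by (rule measurable_compose[OF X_measurable[OF zT] \<psi>])
  have Zb: "0 \<le> \<psi> (X (z j) \<omega>) \<and> \<psi> (X (z j) \<omega>) \<le> b" if "\<omega> \<in> space M" for j \<omega>
    using \<psi>b X_nonneg[OF zT that] by blast
  have int1: "integrable M (\<lambda>\<omega>. \<psi> (X (z j) \<omega>))" for j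
    using Zb by (intro integrable_const_bound[of _ b] Zm AE_I2) auto
  have intP: "integrable M (\<lambda>\<omega>. \<Prod>j<m. \<psi> (X (z j) \<omega>))"
  proof (rule integrable_const_bound[of _ "b ^ m"])
    show "AE \<omega> in M. norm (\<Prod>j<m. \<psi> (X (z j) \<omega>)) \<le> b ^ m"
    proof (rule AE_I2)
      fix \<omega> assume \<omega>: "\<omega> \<in> space M"
      have "(\<Prod>j<m. \<psi> (X (z j) \<omega>)) \<le> (\<Prod>j<m. b)" using Zb[OF \<omega>] by (intro prod_mono) auto
      moreover have "0 \<le> (\<Prod>j<m. \<psi> (X (z j) \<omega>))" using Zb[OF \<omega>] by (intro prod_nonneg) auto
      ultimately show "norm (\<Prod>j<m. \<psi> (X (z j) \<omega>)) \<le> b ^ m" by simp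
    qed
  qed (intro borel_measurable_prod Zm)
  have E1: "expectation (\<lambda>\<omega>. \<psi> (X (z j) \<omega>)) = expectation (\<lambda>\<omega>. \<psi> (Y \<omega>))" for j
    by (rule integral_X[OF zT \<psi>])
  show ?case
  proof (cases "m = 0")
    case True then show ?thesis using E1[of 0] by (simp add: z_def)
  next
    case False
    define A where "A = z ` {..<m}"
    have dist: "set_distance N A {z m} > gap"
    proof -
      have "N p \<le> set_distance N A {z m}" unfolding set_distance_def
      proof (rule cInf_greatest)
        show "{N (x - w) |x w. x \<in> A \<and> w \<in> {z m}} \<noteq> {}" using False by (auto simp: A_def)
        fix d assume "d \<in> {N (x - w) |x w. x \<in> A \<and> w \<in> {z m}}"
        then obtain j where j: "j < m" "d = N (z j - z m)" by (auto simp: A_def)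
        have "z j - z m = (real j - real m) *\<^sub>R p" by (simp add: z_def scaleR_left_diff_distrib)
        then have d: "d = \<bar>real j - real m\<bar> * N p" using N j(2) by (simp add: norm_function_def)
        have "1 * N p \<le> \<bar>real j - real m\<bar> * N p"
          using j(1) norm_function_nonneg[OF N] by (intro mult_right_mono) auto
        then show "N p \<le> d" using d by simp
      qed
      then show ?thesis using gap_p by simp
    qed
    have "expectation (\<lambda>\<omega>. (\<Prod>j<m. \<psi> ((\<lambda>x\<in>A. X x \<omega>) (z j))) * \<psi> ((\<lambda>x\<in>{z m}. X x \<omega>) (z m)))
      = expectation (\<lambda>\<omega>. \<Prod>j<m. \<psi> ((\<lambda>x\<in>A. X x \<omega>) (z j))) * expectation (\<lambda>\<omega>. \<psi> ((\<lambda>x\<in>{z m}. X x \<omega>) (z m)))"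
    proof (rule expectation_mult[of A "{z m}" "\<lambda>f. \<Prod>j<m. \<psi> (f (z j))" "\<lambda>f. \<psi> (f (z m))", OF _ _ _ _ dist])
      show "(\<lambda>f. \<Prod>j<m. \<psi> (f (z j))) \<in> borel_measurable (PiM A (\<lambda>_. borel))"
        by (intro borel_measurable_prod measurable_compose[OF _ \<psi>] measurable_component_singleton) (auto simp: A_def)
      show "(\<lambda>f. \<psi> (f (z m))) \<in> borel_measurable (PiM {z m} (\<lambda>_. borel))"
        by (intro measurable_compose[OF _ \<psi>] measurable_component_singleton) auto
      show "integrable M (\<lambda>\<omega>. \<Prod>j<m. \<psi> ((\<lambda>x\<in>A. X x \<omega>) (z j)))"
        using intP by (simp add: A_def)
    qed (use zT False int1 in \<open>auto simp: A_def\<close>)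
    then have "expectation (\<lambda>\<omega>. (\<Prod>j<m. \<psi> (X (z j) \<omega>)) * \<psi> (X (z m) \<omega>))
      = expectation (\<lambda>\<omega>. \<Prod>j<m. \<psi> (X (z j) \<omega>)) * expectation (\<lambda>\<omega>. \<psi> (X (z m) \<omega>))"
      by (simp add: A_def)
    then show ?thesis using Suc.IH E1[of m] by (simp add: z_def)
  qed
qed

lemma square_integrable:
  assumes "l \<ge> 2"
  shows "integrable M (\<lambda>\<omega>. (Y \<omega>)\<^sup>2)"
proof (rule Bochner_Integration.integrable_bound[of _ "\<lambda>\<omega>. 1 + Y \<omega> ^ l"])
  show "AE \<omega> in M. norm ((Y \<omega>)\<^sup>2) \<le> norm (1 + Y \<omega> ^ l)"
  proof (rule AE_I2)
    fix \<omega> assume \<omega>: "\<omega> \<in> space M"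
    have "(Y \<omega>)\<^sup>2 \<le> 1 + Y \<omega> ^ l"
    proof (cases "Y \<omega> \<le> 1")
      case True
      then have "(Y \<omega>)\<^sup>2 \<le> 1" using Y_nonneg[OF \<omega>] by (simp add: power_le_one)
      then show ?thesis using Y_nonneg[OF \<omega>] by (simp add: add_increasing2)
    next
      case False
      then have "(Y \<omega>)\<^sup>2 \<le> Y \<omega> ^ l" using assms by (intro power_increasing) auto
      then show ?thesis by simp
    qed
    then show "norm ((Y \<omega>)\<^sup>2) \<le> norm (1 + Y \<omega> ^ l)" using Y_nonneg[OF \<omega>] by simp
  qed
qed (use moment Y_measurable in auto)

text \<open>The exponential Markov inequality with parameter \<beta>. Truncation at \<open>D\<close>
  bounds \<open>exp u\<close> by \<open>exp (\<beta> * D)\<close>, the quadratic estimate bounds the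
  exponential moment by \<open>1 + a \<le> exp a\<close>, and factorization raises this to the power
  \<open>m\<close>.\<close>

lemma prob_segment_le:
  assumes l2: "l \<ge> 2" and y: "y \<in> T" and p: "p \<in> T" and gap_p: "N p > gap" and \<beta>: "\<beta> \<ge> 0" and D: "D \<ge> 0"
  shows "prob {\<omega> \<in> space M. (\<Sum>j<m. min (X (y + real j *\<^sub>R p) \<omega>) D) \<ge> \<theta>}
    \<le> exp (real m * (\<beta> * expectation Y + \<beta>\<^sup>2 * exp (\<beta> * D) * expectation (\<lambda>\<omega>. (Y \<omega>)\<^sup>2)) - \<beta> * \<theta>)"
proof -
  note [measurable] = Y_measurable
  define \<psi> where "\<psi> x = exp (\<beta> * min x D)" for x
  define a where "a = \<beta> * expectation Y + \<beta>\<^sup>2 * exp (\<beta> * D) * expectation (\<lambda>\<omega>. (Y \<omega>)\<^sup>2)"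
  have \<psi>m [measurable]: "\<psi> \<in> borel_measurable borel" unfolding \<psi>_def by measurable
  have \<psi>b: "0 \<le> \<psi> x \<and> \<psi> x \<le> exp (\<beta> * D)" for x using \<beta> by (auto simp: \<psi>_def intro: mult_left_mono)
  have "expectation (\<lambda>\<omega>. \<psi> (Y \<omega>)) \<le> expectation (\<lambda>\<omega>. 1 + \<beta> * Y \<omega> + \<beta>\<^sup>2 * exp (\<beta> * D) * (Y \<omega>)\<^sup>2)"
  proof (rule integral_mono)
    show "integrable M (\<lambda>\<omega>. \<psi> (Y \<omega>))" using \<psi>b by (intro integrable_const_bound[of _ "exp (\<beta> * D)"]) auto
    show "integrable M (\<lambda>\<omega>. 1 + \<beta> * Y \<omega> + \<beta>\<^sup>2 * exp (\<beta> * D) * (Y \<omega>)\<^sup>2)"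
      using Y_integrable square_integrable[OF l2] by simp
    fix \<omega> assume \<omega>: "\<omega> \<in> space M"
    define u where "u = \<beta> * min (Y \<omega>) D"
    have u: "0 \<le> u" "u \<le> \<beta> * Y \<omega>" "u \<le> \<beta> * D"
      using \<beta> D Y_nonneg[OF \<omega>] by (auto simp: u_def intro: mult_left_mono)
    have "exp u \<le> 1 + u + u\<^sup>2 * exp u" using u(1) by (rule exp_le_quadratic)
    also have "\<dots> \<le> 1 + \<beta> * Y \<omega> + (\<beta> * Y \<omega>)\<^sup>2 * exp (\<beta> * D)"
      using u by (intro add_mono mult_mono power_mono) auto
    finally show "\<psi> (Y \<omega>) \<le> 1 + \<beta> * Y \<omega> + \<beta>\<^sup>2 * exp (\<beta> * D) * (Y \<omega>)\<^sup>2"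
      by (simp add: \<psi>_def u_def power_mult_distrib mult_ac)
  qed
  also have "\<dots> = 1 + a" using Y_integrable square_integrable[OF l2] by (simp add: a_def prob_space)
  also have "\<dots> \<le> exp a" by (rule exp_ge_add_one_self)
  finally have E\<psi>: "expectation (\<lambda>\<omega>. \<psi> (Y \<omega>)) \<le> exp a" .
  define P where "P \<omega> = (\<Prod>j<m. \<psi> (X (y + real j *\<^sub>R p) \<omega>))" for \<omega>
  have Pexp: "P \<omega> = exp (\<beta> * (\<Sum>j<m. min (X (y + real j *\<^sub>R p) \<omega>) D))" for \<omega>
    by (simp add: P_def \<psi>_def exp_sum sum_distrib_left)
  have Pm: "P \<in> borel_measurable M" unfolding P_def
    by (intro borel_measurable_prod measurable_compose[OF X_measurable \<psi>m] segment_in_T y p)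
  have intP: "integrable M P"
  proof (rule integrable_const_bound[of _ "exp (\<beta> * D) ^ m", OF AE_I2 Pm])
    fix \<omega>
    have "P \<omega> \<le> (\<Prod>j<m. exp (\<beta> * D))" unfolding P_def using \<psi>b by (intro prod_mono) auto
    moreover have "0 \<le> P \<omega>" by (simp add: Pexp)
    ultimately show "norm (P \<omega>) \<le> exp (\<beta> * D) ^ m" by simp
  qed
  have "prob {\<omega> \<in> space M. (\<Sum>j<m. min (X (y + real j *\<^sub>R p) \<omega>) D) \<ge> \<theta>}
      \<le> prob {\<omega> \<in> space M. exp (\<beta> * \<theta>) \<le> P \<omega>}"
  proof (rule finite_measure_mono)
    show "{\<omega> \<in> space M. exp (\<beta> * \<theta>) \<le> P \<omega>} \<in> events" using Pm by measurable
  qed (auto simp: Pexp intro: mult_left_mono[OF _ \<beta>])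
  also have "\<dots> \<le> expectation P / exp (\<beta> * \<theta>)"
    by (rule integral_Markov_inequality_measure[OF intP, of "{}"]) (auto simp: Pexp)
  also have "expectation P = expectation (\<lambda>\<omega>. \<psi> (Y \<omega>)) ^ m"
    unfolding P_def using \<psi>b by (intro expectation_prod_segment[OF y p gap_p \<psi>m]) auto
  also have "\<dots> / exp (\<beta> * \<theta>) \<le> exp a ^ m / exp (\<beta> * \<theta>)"
    using E\<psi> \<psi>b by (intro divide_right_mono power_mono Bochner_Integration.integral_nonneg) auto
  also have "\<dots> = exp (real m * a - \<beta> * \<theta>)" by (simp add: exp_diff exp_of_nat_mult)
  finally show ?thesis by (simp only: a_def)
qed

text \<open>In dimension at least two the union bound over all segments starting in a ball needs a
  polynomially small probability for each of them. It follows from the exponential Markov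
  inequality with a parameter of order \<open>k / 2 ^ k\<close>, after truncation at a small multiple of \<open>2 ^ k\<close>.\<close>

lemma AE_truncated_segments_small:
  assumes l2: "l \<ge> 2" and p: "p \<in> T" and gap_p: "N p > gap" and \<epsilon>: "\<epsilon> > 0"
  shows "\<exists>\<eta>>(0::real). \<exists>\<delta>>0. AE \<omega> in M. \<forall>\<^sub>F k in sequentially. \<forall>y\<in>Tball (2 ^ k).
    (\<Sum>j<nat \<lfloor>\<eta> * 2 ^ k\<rfloor>. min (X (y + real j *\<^sub>R p) \<omega>) (\<delta> * 2 ^ k)) \<le> \<epsilon> * 2 ^ k"
proof -
  \<comment> \<open>With \<open>\<beta> = B * k / 2 ^ k\<close> the threshold contributes
    \<open>2 * (l + 1) * k\<close> to the exponent. Half of it may be lost to the mean; the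
    remaining \<open>(l + 1) * k\<close> beats the number of starting points, of order
    \<open>(2 ^ k) ^ l\<close>.\<close>
  define B where "B = 2 * (real l + 1) / \<epsilon>"
  \<comment> \<open>Makes \<beta> times the truncation level equal to \<open>k / 4\<close>.\<close>
  define \<delta> where "\<delta> = 1 / (4 * B)"
  define \<mu> where "\<mu> = expectation Y"
  define M2 where "M2 = expectation (\<lambda>\<omega>. (Y \<omega>)\<^sup>2)"
  \<comment> \<open>The mean over a whole segment is then at most
    \<open>\<epsilon> / 2 * 2 ^ k\<close>; the 1 prevents division by zero.\<close>
  define \<eta> where "\<eta> = \<epsilon> / (2 * (\<mu> + 1))"
  have B: "B > 0" using \<epsilon> by (simp add: B_def)
  have \<delta>: "\<delta> > 0" using B by (simp add: \<delta>_def)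
  have \<mu>: "\<mu> \<ge> 0" unfolding \<mu>_def using Y_nonneg by (intro Bochner_Integration.integral_nonneg)
  have M2: "M2 \<ge> 0" unfolding M2_def by (intro Bochner_Integration.integral_nonneg) simp
  have \<eta>: "\<eta> > 0" using \<epsilon> \<mu> by (simp add: \<eta>_def)
  have \<eta>\<mu>: "\<eta> * \<mu> \<le> \<epsilon> / 2"
  proof -
    have "\<eta> * \<mu> \<le> \<epsilon> / (2 * (\<mu> + 1)) * (\<mu> + 1)" unfolding \<eta>_def using \<mu> \<epsilon> by (intro mult_left_mono) auto
    also have "\<dots> = \<epsilon> / 2"
    proof -
      have "\<epsilon> / (2 * c) * c = \<epsilon> / 2" if "c \<noteq> 0" for c using that by simp
      then show ?thesis using \<mu> by (metis add_nonneg_pos less_irrefl zero_less_one)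
    qed
    finally show ?thesis .
  qed
  define n where "n k = nat \<lfloor>\<eta> * 2 ^ k\<rfloor>" for k :: nat
  have n: "real (n k) \<le> \<eta> * 2 ^ k" for k using \<eta> by (simp add: n_def)
  define S where "S k y = {\<omega> \<in> space M. (\<Sum>j<n k. min (X (y + real j *\<^sub>R p) \<omega>) (\<delta> * 2 ^ k)) \<ge> \<epsilon> * 2 ^ k}"
    for k :: nat and y
  have S_sets: "S k y \<in> sets M" if "y \<in> T" for k y
  proof -
    have "(\<lambda>\<omega>. \<Sum>j<n k. min (X (y + real j *\<^sub>R p) \<omega>) (\<delta> * 2 ^ k)) \<in> borel_measurable M"
      by (intro borel_measurable_sum borel_measurable_min borel_measurable_const X_measurable segment_in_T that p)
    then show ?thesis unfolding S_def by measurable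
  qed
  define C where "C = exp (\<eta> * B\<^sup>2 * M2 * 32)"
  have prob_S: "prob (S k y) \<le> C * exp (- (real l + 1)) ^ k" if y: "y \<in> T" for k y
  proof -
    define \<beta> where "\<beta> = B * real k / 2 ^ k"
    have \<beta>: "\<beta> \<ge> 0" using B by (simp add: \<beta>_def)
    have \<beta>D: "\<beta> * (\<delta> * 2 ^ k) = real k / 4" using B by (simp add: \<beta>_def \<delta>_def)
    have \<beta>\<epsilon>: "\<beta> * (\<epsilon> * 2 ^ k) = 2 * (real l + 1) * real k" using \<epsilon> by (simp add: \<beta>_def B_def)
    have "prob (S k y) \<le> exp (real (n k) * (\<beta> * \<mu> + \<beta>\<^sup>2 * exp (\<beta> * (\<delta> * 2 ^ k)) * M2) - \<beta> * (\<epsilon> * 2 ^ k))"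
      unfolding S_def \<mu>_def M2_def using \<delta> by (intro prob_segment_le[OF l2 y p gap_p \<beta>]) simp
    also have "\<dots> \<le> exp (\<eta> * B\<^sup>2 * M2 * 32 - (real l + 1) * real k)"
    proof -
      have "real (n k) * (\<beta> * \<mu> + \<beta>\<^sup>2 * exp (real k / 4) * M2) \<le> \<eta> * 2 ^ k * (\<beta> * \<mu> + \<beta>\<^sup>2 * exp (real k / 4) * M2)"
        using n \<beta> \<mu> M2 by (intro mult_right_mono) auto
      also have "\<dots> = \<eta> * \<mu> * (\<beta> * 2 ^ k) + \<eta> * M2 * B\<^sup>2 * ((real k)\<^sup>2 * exp (real k / 4) / 2 ^ k)"
        by (simp add: \<beta>_def field_simps power2_eq_square)
      also have "\<dots> \<le> \<epsilon> / 2 * (\<beta> * 2 ^ k) + \<eta> * M2 * B\<^sup>2 * 32"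
        using \<eta>\<mu> \<beta> \<eta> M2 square_times_exp_quarter_le
        by (intro add_mono mult_right_mono mult_left_mono) auto
      also have "\<epsilon> / 2 * (\<beta> * 2 ^ k) = (real l + 1) * real k" using \<beta>\<epsilon> by (simp add: algebra_simps)
      finally show ?thesis unfolding \<beta>D \<beta>\<epsilon> by (simp add: algebra_simps)
    qed
    also have "\<dots> = C * exp (real k * - (real l + 1))" by (simp add: C_def exp_diff exp_minus field_simps flip: exp_add)
    also have "\<dots> = C * exp (- (real l + 1)) ^ k" by (simp only: exp_of_nat_mult)
    finally show ?thesis .
  qed
  define E where "E k = (\<Union>y\<in>Tball (2 ^ k). S k y)" for k
  have BT: "Tball R \<subseteq> T" for R by (auto simp: Tball_def)
  have prob_E: "prob (E k) \<le> K0 * C * exp (- 1) ^ k" for k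
  proof -
    have "prob (E k) \<le> (\<Sum>y\<in>Tball (2 ^ k). prob (S k y))"
      unfolding E_def using S_sets BT by (intro finite_measure_subadditive_finite finite_Tball) auto
    also have "\<dots> \<le> (\<Sum>y\<in>Tball (2 ^ k). C * exp (- (real l + 1)) ^ k)"
      using prob_S BT by (intro sum_mono) auto
    also have "\<dots> = real (card (Tball (2 ^ k))) * (C * exp (- (real l + 1)) ^ k)" by simp
    also have "\<dots> \<le> K0 * (2 ^ k) ^ l * (C * exp (- (real l + 1)) ^ k)"
      unfolding Tball_def by (intro mult_right_mono card_le) (auto simp: C_def)
    also have "\<dots> = K0 * C * (2 ^ l * exp (- (real l + 1))) ^ k"
      by (simp add: power_mult_distrib flip: power_mult)
    also have "\<dots> \<le> K0 * C * exp (- 1) ^ k"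
    proof (intro mult_left_mono power_mono)
      \<comment> \<open>Since \<open>2 \<le> exp 1\<close>, a factor \<open>exp (- 1)\<close> per
        index survives.\<close>
      have "(2::real) ^ l \<le> exp 1 ^ l" using exp_ge_add_one_self[of "1::real"] by (intro power_mono) auto
      also have "\<dots> = exp (real l)" by (simp flip: exp_of_nat_mult)
      finally have "2 ^ l * exp (- (real l + 1)) \<le> exp (real l) * exp (- (real l + 1))" by (intro mult_right_mono) auto
      also have "\<dots> = exp (- 1)" by (simp flip: exp_add)
      finally show "2 ^ l * exp (- (real l + 1)) \<le> exp (- 1)" .
    qed (use K0 in \<open>auto simp: C_def\<close>)
    finally show ?thesis .
  qed
  have "summable (\<lambda>k. K0 * C * exp (- 1 :: real) ^ k)"
    by (intro summable_mult summable_geometric) simp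
  then have "summable (\<lambda>k. prob (E k))"
    by (rule summable_comparison_test'[where N = 0]) (simp add: prob_E)
  moreover have "E k \<in> sets M" for k
    unfolding E_def using S_sets BT by (intro sets.finite_UN finite_Tball) auto
  ultimately have "AE \<omega> in M. \<forall>\<^sub>F k in sequentially. \<omega> \<in> space M - E k"
    by (intro borel_cantelli_AE1) (auto simp: emeasure_eq_measure)
  then have "AE \<omega> in M. \<forall>\<^sub>F k in sequentially. \<forall>y\<in>Tball (2 ^ k).
    (\<Sum>j<n k. min (X (y + real j *\<^sub>R p) \<omega>) (\<delta> * 2 ^ k)) \<le> \<epsilon> * 2 ^ k"
  proof eventually_elim
    case (elim \<omega>)
    then show ?case by eventually_elim (auto simp: E_def S_def not_le intro: less_imp_le)
  qed
  then show ?thesis unfolding n_def using \<eta> \<delta> by blast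
qed

text \<open>For large radii the truncation is void: by sublinear growth all values met by the
  longest segments are at most the truncation level. A shorter segment is compared with the longest
  one from the same point, as all values are nonnegative.\<close>

lemma AE_segment_small_large_step:
  assumes l2: "l \<ge> 2" and p: "p \<in> T" and gap_p: "N p > gap"
  shows "AE \<omega> in M. segment_small p \<omega>"
proof -
  define Q where "Q i \<eta> \<delta> \<longleftrightarrow> (AE \<omega> in M. \<forall>\<^sub>F k in sequentially. \<forall>y\<in>Tball (2 ^ k).
    (\<Sum>j<nat \<lfloor>\<eta> * 2 ^ k\<rfloor>. min (X (y + real j *\<^sub>R p) \<omega>) (\<delta> * 2 ^ k)) \<le> 1 / Suc i * 2 ^ k)"
    for i :: nat and \<eta> \<delta> :: real
  have "\<exists>\<eta>>0. \<exists>\<delta>>0. Q i \<eta> \<delta>" for i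
    unfolding Q_def by (rule AE_truncated_segments_small[OF assms]) simp
  then obtain \<eta> \<delta> where \<eta>: "\<And>i. \<eta> i > 0" and \<delta>: "\<And>i. \<delta> i > 0" and AE: "\<And>i. Q i (\<eta> i) (\<delta> i)"
    by metis
  have "AE \<omega> in M. \<forall>i. \<forall>\<^sub>F k in sequentially. \<forall>y\<in>Tball (2 ^ k).
    (\<Sum>j<nat \<lfloor>\<eta> i * 2 ^ k\<rfloor>. min (X (y + real j *\<^sub>R p) \<omega>) (\<delta> i * 2 ^ k)) \<le> 1 / Suc i * 2 ^ k"
    using AE unfolding Q_def by (subst AE_all_countable) blast
  with AE_sublinear AE_space show ?thesis
  proof eventually_elim
    case (elim \<omega>)
    show ?case unfolding segment_small_def
    proof (intro allI impI)
      fix \<epsilon> :: real assume \<epsilon>: "\<epsilon> > 0"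
      then obtain i where i: "1 / Suc i < \<epsilon> / 2"
        using reals_Archimedean[of "\<epsilon> / 2"] by (auto simp: inverse_eq_divide)
      \<comment> \<open>A segment that starts in the ball of radius \<open>2 ^ k\<close> and has at
        most \<open>\<eta> i * 2 ^ k\<close> steps stays in the ball of radius
        \<open>c * 2 ^ k\<close>.\<close>
      define c where "c = 1 + \<eta> i * norm p"
      have c: "c \<ge> 1" using \<eta>[of i] by (simp add: c_def less_imp_le)
      obtain t1 :: real where t1: "t1 \<ge> 1" "\<And>t y. t \<ge> t1 \<Longrightarrow> y \<in> Tball t \<Longrightarrow> X y \<omega> \<le> \<delta> i / c * t"
        using elim(1) \<delta>[of i] c unfolding sublinear_at_def by (metis divide_pos_pos less_le_trans zero_less_one)
      obtain t2 :: real where t2: "t2 \<ge> 1" "\<And>t. t \<ge> t2 \<Longrightarrow> \<exists>k. t \<le> 2 ^ k \<and> 2 ^ k \<le> 2 * t \<and>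
          (\<forall>y\<in>Tball (2 ^ k). (\<Sum>j<nat \<lfloor>\<eta> i * 2 ^ k\<rfloor>. min (X (y + real j *\<^sub>R p) \<omega>) (\<delta> i * 2 ^ k)) \<le> 1 / Suc i * 2 ^ k)"
        using eventually_dyadic[OF elim(3)[rule_format, of i]] by blast
      have "(\<Sum>j<m. X (y + real j *\<^sub>R p) \<omega>) \<le> \<epsilon> * t"
        if t: "t \<ge> max t1 t2" and y: "y \<in> Tball t" and m: "real m \<le> \<eta> i * t" for t y m
      proof -
        have "t \<ge> t2" using t by simp
        then obtain k where k: "t \<le> 2 ^ k" "2 ^ k \<le> 2 * t"
          and sum: "\<forall>y\<in>Tball (2 ^ k). (\<Sum>j<nat \<lfloor>\<eta> i * 2 ^ k\<rfloor>. min (X (y + real j *\<^sub>R p) \<omega>) (\<delta> i * 2 ^ k)) \<le> 1 / Suc i * 2 ^ k"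
          using t2(2) by blast
        have yk: "y \<in> Tball (2 ^ k)" and yT: "y \<in> T" using y k(1) by (auto simp: Tball_def)
        have "\<eta> i * t \<le> \<eta> i * 2 ^ k" using k(1) \<eta>[of i] by (intro mult_left_mono) auto
        with m have mk: "real m \<le> \<eta> i * 2 ^ k" by linarith
        then have mn: "m \<le> nat \<lfloor>\<eta> i * 2 ^ k\<rfloor>" by (simp add: le_nat_iff le_floor_iff)
        have X_le: "X (y + real j *\<^sub>R p) \<omega> \<le> \<delta> i * 2 ^ k" if j: "j < nat \<lfloor>\<eta> i * 2 ^ k\<rfloor>" for j
        proof -
          have "0 \<le> \<eta> i * 2 ^ k" using \<eta>[of i] by simp
          then have "real j \<le> \<eta> i * 2 ^ k" using j by linarith
          then have "real j * norm p \<le> \<eta> i * 2 ^ k * norm p" by (intro mult_right_mono) auto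
          then have "norm (y + real j *\<^sub>R p) \<le> c * 2 ^ k"
            using yk norm_triangle_ineq[of y "real j *\<^sub>R p"] by (simp add: Tball_def c_def algebra_simps)
          then have "y + real j *\<^sub>R p \<in> Tball (c * 2 ^ k)" using segment_in_T[OF yT p] by (simp add: Tball_def)
          moreover have "t1 \<le> c * 2 ^ k"
          proof -
            have "1 * 2 ^ k \<le> c * 2 ^ k" using c by (intro mult_right_mono) auto
            moreover have "t1 \<le> t" using t by simp
            ultimately show ?thesis using k(1) by linarith
          qed
          ultimately have "X (y + real j *\<^sub>R p) \<omega> \<le> \<delta> i / c * (c * 2 ^ k)" by (intro t1(2))
          then show ?thesis using c by simp
        qed
        have "(\<Sum>j<m. X (y + real j *\<^sub>R p) \<omega>) \<le> (\<Sum>j<nat \<lfloor>\<eta> i * 2 ^ k\<rfloor>. X (y + real j *\<^sub>R p) \<omega>)"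
          using mn X_nonneg[OF segment_in_T[OF yT p] elim(2)] by (intro sum_mono2) auto
        also have "\<dots> = (\<Sum>j<nat \<lfloor>\<eta> i * 2 ^ k\<rfloor>. min (X (y + real j *\<^sub>R p) \<omega>) (\<delta> i * 2 ^ k))"
          using X_le by (intro sum.cong) (auto simp: min_absorb1)
        also have "\<dots> \<le> 1 / Suc i * 2 ^ k" using sum yk by blast
        also have "\<dots> \<le> \<epsilon> / 2 * (2 * t)" using i k(2) \<epsilon> by (intro mult_mono) auto
        finally show ?thesis by simp
      qed
      moreover have "max t1 t2 \<ge> 1" using t1(1) by simp
      ultimately show "\<exists>\<eta>>0. \<exists>t0\<ge>1. \<forall>t\<ge>t0. \<forall>y\<in>Tball t. \<forall>m. real m \<le> \<eta> * t \<longrightarrow>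
          (\<Sum>j<m. X (y + real j *\<^sub>R p) \<omega>) \<le> \<epsilon> * t"
        using \<eta>[of i] by blast
    qed
  qed
qed

text \<open>The first \<open>m * r\<close> points in direction \<open>p\<close> split by residue
  modulo \<open>r\<close> into \<open>r\<close> segments of \<open>m\<close> steps in direction
  \<open>r p\<close>. Enlarging \<open>m\<close> to \<open>m * r\<close> avoids rounding and is
  harmless for nonnegative values.\<close>

lemma segment_small_multiple:
  assumes r: "r \<ge> 1" and p: "p \<in> T" and \<omega>: "\<omega> \<in> space M" and small: "segment_small (real r *\<^sub>R p) \<omega>"
  shows "segment_small p \<omega>"
  unfolding segment_small_def
proof (intro allI impI)
  fix \<epsilon> :: real assume \<epsilon>: "\<epsilon> > 0"
  then have pos: "\<epsilon> / (2 * real r) > 0" using r by simp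
  from small[unfolded segment_small_def, rule_format, OF pos] obtain \<eta> t0 where \<eta>: "\<eta> > 0" and t0: "t0 \<ge> 1" and
    small: "\<And>t y m. t \<ge> t0 \<Longrightarrow> y \<in> Tball t \<Longrightarrow> real m \<le> \<eta> * t \<Longrightarrow>
      (\<Sum>j<m. X (y + real j *\<^sub>R (real r *\<^sub>R p)) \<omega>) \<le> \<epsilon> / (2 * real r) * t"
    by blast
  \<comment> \<open>From \<open>t1\<close> on, the shifted starting points \<open>y + i p\<close>
    with \<open>i < r\<close> lie within radius \<open>2 * t\<close>; this is the source of the 2 in
    \<open>\<epsilon> / (2 * r)\<close>.\<close>
  define t1 where "t1 = max t0 (real r * norm p)"
  have "(\<Sum>j<m. X (y + real j *\<^sub>R p) \<omega>) \<le> \<epsilon> * t"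
    if t: "t \<ge> t1" and y: "y \<in> Tball t" and m: "real m \<le> \<eta> * t" for t y m
  proof -
    have yT: "y \<in> T" using y by (simp add: Tball_def)
    have t': "t \<ge> t0" "t \<ge> real r * norm p" "t \<ge> 0" using t t0 by (auto simp: t1_def)
    have "(\<Sum>j<m. X (y + real j *\<^sub>R p) \<omega>) \<le> (\<Sum>j<m * r. X (y + real j *\<^sub>R p) \<omega>)"
      using r X_nonneg[OF segment_in_T[OF yT p] \<omega>] by (intro sum_mono2) auto
    also have "\<dots> = (\<Sum>j<m. \<Sum>i=j * r..<j * r + r. X (y + real i *\<^sub>R p) \<omega>)" by (rule sum.nat_group[symmetric])
    also have "\<dots> = (\<Sum>j<m. \<Sum>i<r. X (y + real i *\<^sub>R p + real j *\<^sub>R (real r *\<^sub>R p)) \<omega>)"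
    proof (rule sum.cong[OF refl])
      fix j
      have "(\<Sum>i=j * r..<j * r + r. X (y + real i *\<^sub>R p) \<omega>) = (\<Sum>i=0..<r. X (y + real (i + j * r) *\<^sub>R p) \<omega>)"
        using sum.shift_bounds_nat_ivl[of "\<lambda>i. X (y + real i *\<^sub>R p) \<omega>" 0 "j * r" r] by (simp add: add.commute)
      then show "(\<Sum>i=j * r..<j * r + r. X (y + real i *\<^sub>R p) \<omega>)
          = (\<Sum>i<r. X (y + real i *\<^sub>R p + real j *\<^sub>R (real r *\<^sub>R p)) \<omega>)"
        by (simp add: scaleR_left_distrib atLeast0LessThan add.assoc)
    qed
    also have "\<dots> = (\<Sum>i<r. \<Sum>j<m. X (y + real i *\<^sub>R p + real j *\<^sub>R (real r *\<^sub>R p)) \<omega>)" by (rule sum.swap)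
    also have "\<dots> \<le> (\<Sum>i<r. \<epsilon> / (2 * real r) * (2 * t))"
    proof (intro sum_mono small)
      fix i assume i: "i \<in> {..<r}"
      have "real i * norm p \<le> real r * norm p" using i by (intro mult_right_mono) auto
      then have "norm (y + real i *\<^sub>R p) \<le> 2 * t"
        using y t' norm_triangle_ineq[of y "real i *\<^sub>R p"] by (simp add: Tball_def)
      then show "y + real i *\<^sub>R p \<in> Tball (2 * t)" using segment_in_T[OF yT p] by (simp add: Tball_def)
      have "\<eta> * t \<le> \<eta> * (2 * t)" using t' \<eta> by (intro mult_left_mono) auto
      then show "real m \<le> \<eta> * (2 * t)" using m by linarith
    qed (use t' in simp)
    also have "\<dots> = \<epsilon> * t" using r by simp
    finally show ?thesis .
  qed
  moreover have "t1 \<ge> 1" using t0 by (simp add: t1_def)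
  ultimately show "\<exists>\<eta>>0. \<exists>t0\<ge>1. \<forall>t\<ge>t0. \<forall>y\<in>Tball t. \<forall>m. real m \<le> \<eta> * t \<longrightarrow>
      (\<Sum>j<m. X (y + real j *\<^sub>R p) \<omega>) \<le> \<epsilon> * t"
    using \<eta> by blast
qed

text \<open>The exponential estimate works with steps longer than \<open>gap\<close>; a multiple
  \<open>r p\<close> is long enough, and segments of step \<open>p\<close> are reduced to
  it.\<close>

lemma AE_segment_small:
  assumes p: "p \<in> T" "p \<noteq> 0"
  shows "AE \<omega> in M. segment_small p \<omega>"
proof (cases "l = 1")
  case True then show ?thesis using p by (rule AE_segment_small_dim1)
next
  case False
  then have l2: "l \<ge> 2" using l by simp
  have "N p > 0" using norm_function_nonneg[OF N, of p] N p by (fastforce simp: norm_function_def order_le_less)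
  then obtain r :: nat where r: "real r * N p > gap" using reals_Archimedean3 by blast
  have r1: "r \<ge> 1"
  proof (rule ccontr)
    assume "\<not> r \<ge> 1" then show False using r gap by (simp add: not_le)
  qed
  have "N (real r *\<^sub>R p) > gap" using r N by (simp add: norm_function_def)
  then have "AE \<omega> in M. segment_small (real r *\<^sub>R p) \<omega>"
    using l2 r1 by (intro AE_segment_small_large_step vector_semigroup_scale T p)
  with AE_space show ?thesis
    by eventually_elim (rule segment_small_multiple[OF r1 p(1)])
qed

end

section \<open>Comparison along short segments\<close>

context semigroup_basis begin

text \<open>In this context \<omega> is fixed: \<open>H x\<close> stands for
  \<open>h x \<omega>\<close> and \<open>G b y\<close> for \<open>h_plus b (g y \<omega>)\<close>.
  Randomness enters only through the bounds assumed for \<open>G\<close> and the convergence of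
  \<open>H\<close> along multiples.\<close>

lemma subadditive_chain_single:
  assumes hom: "semigroup_hom S T \<pi>"
    and step: "\<And>x y. x \<in> S \<Longrightarrow> y \<in> S \<Longrightarrow> H (x + y) \<le> H x + G y (\<pi> x)"
    and z: "z \<in> S" and b: "b \<in> S"
  shows "H (z + real m *\<^sub>R b) \<le> (H z :: real) + (\<Sum>j<m. G b (\<pi> z + real j *\<^sub>R \<pi> b))"
proof (induction m)
  case (Suc m)
  have zm: "z + real m *\<^sub>R b \<in> S"
    using vector_semigroup_sum[OF S, of "{b}" z "\<lambda>_. m"] z b by simp
  have "H ((z + real m *\<^sub>R b) + b) \<le> H (z + real m *\<^sub>R b) + G b (\<pi> z + real m *\<^sub>R \<pi> b)"
    using step[OF zm b] semigroup_hom_add_scale[OF S hom b z, of m] by simp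
  then show ?case using Suc.IH by (simp add: algebra_simps)
qed simp

text \<open>The summands are added one direction after the other, so each block is a segment
  starting at some point of \<open>T\<close>. The radius \<open>r\<close> bounds the whole
  displacement, hence every such starting point, and \<open>E\<close> bounds every block.\<close>

lemma subadditive_chain:
  assumes hom: "semigroup_hom S T \<pi>"
    and step: "\<And>x y. x \<in> S \<Longrightarrow> y \<in> S \<Longrightarrow> H (x + y) \<le> H x + G y (\<pi> x)"
    and z: "z \<in> S" and "finite B" "B \<subseteq> S"
    and seg: "\<And>b y. b \<in> B \<Longrightarrow> y \<in> T \<Longrightarrow> norm y \<le> r \<Longrightarrow> (\<Sum>j<m b. G b (y + real j *\<^sub>R \<pi> b)) \<le> E"
    and r: "norm (\<pi> z) + (\<Sum>b\<in>B. real (m b) * norm (\<pi> b)) \<le> r"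
  shows "H (z + (\<Sum>b\<in>B. real (m b) *\<^sub>R b)) \<le> (H z :: real) + real (card B) * E"
  using assms(4-7)
proof (induction B rule: finite_induct)
  case (insert b B)
  let ?z = "z + (\<Sum>b\<in>B. real (m b) *\<^sub>R b)"
  have zS: "?z \<in> S" using insert by (intro vector_semigroup_sum S z) auto
  have r': "norm (\<pi> z) + (\<Sum>b\<in>B. real (m b) * norm (\<pi> b)) \<le> r"
  proof -
    have "(\<Sum>b\<in>insert b B. real (m b) * norm (\<pi> b)) = real (m b) * norm (\<pi> b) + (\<Sum>b\<in>B. real (m b) * norm (\<pi> b))"
      using insert.hyps by simp
    moreover have "0 \<le> real (m b) * norm (\<pi> b)" by simp
    ultimately show ?thesis using insert.prems(3) by linarith
  qed
  have IH: "H ?z \<le> H z + real (card B) * E"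
    using insert.prems r' by (intro insert.IH) auto
  have "\<pi> ?z = \<pi> z + (\<Sum>b\<in>B. real (m b) *\<^sub>R \<pi> b)"
    using insert by (intro semigroup_hom_sum[OF S hom z]) auto
  then have "norm (\<pi> ?z) \<le> norm (\<pi> z) + norm (\<Sum>b\<in>B. real (m b) *\<^sub>R \<pi> b)"
    by (simp only: norm_triangle_ineq)
  also have "\<dots> \<le> norm (\<pi> z) + (\<Sum>b\<in>B. norm (real (m b) *\<^sub>R \<pi> b))"
    by (intro add_left_mono norm_sum)
  also have "\<dots> \<le> r" using r' by simp
  finally have nz: "norm (\<pi> ?z) \<le> r" .
  have "H (?z + real (m b) *\<^sub>R b) \<le> H ?z + (\<Sum>j<m b. G b (\<pi> ?z + real j *\<^sub>R \<pi> b))"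
    using insert.prems by (intro subadditive_chain_single[OF hom step zS]) auto
  also have "\<dots> \<le> (H z + real (card B) * E) + E"
    using IH nz zS hom by (intro add_mono insert.prems(2)) (auto simp: semigroup_hom_def)
  also have "?z + real (m b) *\<^sub>R b = z + (\<Sum>b\<in>insert b B. real (m b) *\<^sub>R b)"
    using insert.hyps by (simp add: algebra_simps)
  finally show ?case using insert.hyps by (simp add: algebra_simps)
qed simp

text \<open>All starting points met between \<open>z\<close> and \<open>w\<close> have norm at most
  \<open>r * t\<close>, where \<open>r\<close> collects the growth of \<pi>, the step from
  \<open>F\<close> and the segments. The bounds for \<open>G\<close> are used at this
  radius.\<close>

lemma comparison:
  assumes hom: "semigroup_hom S T \<pi>"
    and K: "K > 0" "\<And>x. x \<in> S \<Longrightarrow> norm (\<pi> x) \<le> K * (norm x + 1)"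
    and step: "\<And>x y. x \<in> S \<Longrightarrow> y \<in> S \<Longrightarrow> H (x + y) \<le> H x + G y (\<pi> x)"
    and \<delta>: "\<delta> > 0" and \<tau>0: "\<tau>0 > 0" and F: "finite F" "F \<subseteq> S"
    and dec: "\<And>w z \<tau>. w \<in> S \<Longrightarrow> z \<in> S \<Longrightarrow> \<tau> \<ge> \<tau>0 \<Longrightarrow> norm (w - z - \<tau> *\<^sub>R e) \<le> \<delta> * \<tau> \<Longrightarrow>
      \<exists>s\<in>F. \<exists>m. (\<forall>a\<in>A. real (m a) \<le> 2 * \<tau>) \<and> w = z + s + (\<Sum>a\<in>A. real (m a) *\<^sub>R a)"
    and seg: "\<And>b \<epsilon>. b \<in> A \<Longrightarrow> \<epsilon> > 0 \<Longrightarrow> \<exists>\<eta>>0. \<exists>t0\<ge>1. \<forall>t\<ge>t0. \<forall>y\<in>T. norm y \<le> t \<longrightarrow> (\<forall>m.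
      real m \<le> \<eta> * t \<longrightarrow> (\<Sum>j<m. G b (y + real j *\<^sub>R \<pi> b)) \<le> \<epsilon> * t)"
    and sub: "\<And>s \<epsilon>. s \<in> F \<Longrightarrow> \<epsilon> > 0 \<Longrightarrow> \<exists>t0\<ge>1. \<forall>t\<ge>t0. \<forall>y\<in>T. norm y \<le> t \<longrightarrow> G s y \<le> \<epsilon> * t"
    and \<epsilon>: "\<epsilon> > 0" and R: "R > 0"
  obtains \<sigma>0 :: real where "\<sigma>0 > 0"
    "\<And>\<sigma>. 0 < \<sigma> \<Longrightarrow> \<sigma> \<le> \<sigma>0 \<Longrightarrow> \<exists>t0. \<forall>t\<ge>t0. \<forall>z\<in>S. \<forall>w\<in>S. norm z \<le> R * t \<longrightarrow>
       norm (w - z - (\<sigma> * t) *\<^sub>R e) \<le> \<delta> * (\<sigma> * t) \<longrightarrow> H w \<le> (H z :: real) + \<epsilon> * t"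
proof -
  define r where "r = 1 + K * (R + 1) + (\<Sum>s\<in>F. norm (\<pi> s)) + 2 * (\<Sum>b\<in>A. norm (\<pi> b))"
  have r: "r \<ge> 1" using K(1) R by (simp add: r_def sum_nonneg)
  \<comment> \<open>One share for each of the \<open>card A\<close> segments and one for the step
    from \<open>F\<close>, all at radius \<open>r * t\<close>.\<close>
  define \<epsilon>' where "\<epsilon>' = \<epsilon> / ((real (card A) + 1) * r)"
  have \<epsilon>': "\<epsilon>' > 0" using \<epsilon> r by (simp add: \<epsilon>'_def add_nonneg_pos)
  have \<epsilon>_eq: "(real (card A) + 1) * (\<epsilon>' * r) = \<epsilon>"
  proof -
    have "c * (\<epsilon> / (c * r) * r) = \<epsilon>" if "c \<noteq> 0" for c using that r by simp
    then show ?thesis unfolding \<epsilon>'_def by (metis of_nat_Suc of_nat_0_neq add.commute)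
  qed
  have "\<forall>b\<in>A. \<exists>\<eta>>0. \<exists>t0\<ge>1. \<forall>t\<ge>t0. \<forall>y\<in>T. norm y \<le> t \<longrightarrow> (\<forall>m.
      real m \<le> \<eta> * t \<longrightarrow> (\<Sum>j<m. G b (y + real j *\<^sub>R \<pi> b)) \<le> \<epsilon>' * t)"
    using seg \<epsilon>' by blast
  then obtain \<eta> where \<eta>: "\<And>b. b \<in> A \<Longrightarrow> \<eta> b > 0" and
    ex: "\<forall>b\<in>A. \<exists>t0\<ge>1. \<forall>t\<ge>t0. \<forall>y\<in>T. norm y \<le> t \<longrightarrow> (\<forall>m.
      real m \<le> \<eta> b * t \<longrightarrow> (\<Sum>j<m. G b (y + real j *\<^sub>R \<pi> b)) \<le> \<epsilon>' * t)"
    by (auto dest!: bchoice)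
  from bchoice[OF ex] obtain tA where tA: "\<And>b t y m. b \<in> A \<Longrightarrow> t \<ge> tA b \<Longrightarrow> y \<in> T \<Longrightarrow> norm y \<le> t \<Longrightarrow>
      real m \<le> \<eta> b * t \<Longrightarrow> (\<Sum>j<m. G b (y + real j *\<^sub>R \<pi> b)) \<le> \<epsilon>' * t"
    by blast
  have "\<forall>s\<in>F. \<exists>t0\<ge>1. \<forall>t\<ge>t0. \<forall>y\<in>T. norm y \<le> t \<longrightarrow> G s y \<le> \<epsilon>' * t" using sub \<epsilon>' by blast
  from bchoice[OF this] obtain tF where tF: "\<And>s t y. s \<in> F \<Longrightarrow> t \<ge> tF s \<Longrightarrow> y \<in> T \<Longrightarrow> norm y \<le> t \<Longrightarrow> G s y \<le> \<epsilon>' * t"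
    by blast
  define \<eta>0 where "\<eta>0 = Min (\<eta> ` A)"
  have \<eta>0: "\<eta>0 > 0" unfolding \<eta>0_def using \<eta> finA Ane by (subst Min_gr_iff) auto
  have \<eta>0_le: "\<eta>0 \<le> \<eta> b" if "b \<in> A" for b unfolding \<eta>0_def using that finA by (intro Min_le) auto
  define t1 where "t1 = Max (insert 1 (tA ` A \<union> tF ` F))"
  have t1: "t1 \<ge> 1" "\<And>b. b \<in> A \<Longrightarrow> tA b \<le> t1" "\<And>s. s \<in> F \<Longrightarrow> tF s \<le> t1"
    unfolding t1_def using finA F(1) by (auto intro!: Max_ge)
  \<comment> \<open>Segments have at most \<open>2 * \<sigma> * t\<close> steps, so the second entry
    makes them short enough; the first makes \<open>r\<close> independent of \<sigma>.\<close>
  define \<sigma>0 where "\<sigma>0 = min 1 (\<eta>0 / 2)"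
  have \<sigma>0: "\<sigma>0 > 0" using \<eta>0 by (simp add: \<sigma>0_def)
  show ?thesis
  proof (rule that[OF \<sigma>0])
    fix \<sigma> :: real assume \<sigma>: "0 < \<sigma>" "\<sigma> \<le> \<sigma>0"
    have \<sigma>1: "\<sigma> \<le> 1" "2 * \<sigma> \<le> \<eta>0" using \<sigma> by (auto simp: \<sigma>0_def)
    show "\<exists>t0. \<forall>t\<ge>t0. \<forall>z\<in>S. \<forall>w\<in>S. norm z \<le> R * t \<longrightarrow>
       norm (w - z - (\<sigma> * t) *\<^sub>R e) \<le> \<delta> * (\<sigma> * t) \<longrightarrow> H w \<le> H z + \<epsilon> * t"
    \<comment> \<open>The second entry gives \<open>\<tau>0 \<le> \<sigma> * t\<close>; hence
      \<open>t0\<close> is chosen after \<sigma>.\<close>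
    proof (intro exI[of _ "max t1 (\<tau>0 / \<sigma>)"] allI ballI impI)
      fix t z w
      assume t: "t \<ge> max t1 (\<tau>0 / \<sigma>)" and z: "z \<in> S" and w: "w \<in> S" and nz: "norm z \<le> R * t"
        and near: "norm (w - z - (\<sigma> * t) *\<^sub>R e) \<le> \<delta> * (\<sigma> * t)"
      have t': "t \<ge> t1" "t \<ge> 1" "\<tau>0 \<le> \<sigma> * t" using t t1(1) \<sigma>(1) by (auto simp: field_simps)
      obtain s m where s: "s \<in> F" and m: "\<forall>a\<in>A. real (m a) \<le> 2 * (\<sigma> * t)"
        and w_eq: "w = z + s + (\<Sum>a\<in>A. real (m a) *\<^sub>R a)"
        using dec[OF w z t'(3) near] by blast
      have sS: "s \<in> S" using s F(2) by blast
      have zs: "z + s \<in> S" using z sS S by (auto simp: vector_semigroup_def)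
      have rt: "r * t \<ge> t" using r t'(2) by (simp add: mult_le_cancel_right1)
      have \<pi>zT: "\<pi> z \<in> T" using hom z by (simp add: semigroup_hom_def)
      have \<pi>z: "norm (\<pi> z) \<le> K * (R + 1) * t"
      proof -
        have "norm (\<pi> z) \<le> K * (norm z + 1)" by (rule K(2)[OF z])
        also have "\<dots> \<le> K * (R * t + t)" using nz t'(2) K(1) by (intro mult_left_mono add_mono) auto
        finally show ?thesis by (simp add: algebra_simps)
      qed
      have \<pi>s: "norm (\<pi> s) \<le> (\<Sum>s\<in>F. norm (\<pi> s)) * t"
      proof -
        have "norm (\<pi> s) \<le> (\<Sum>s\<in>F. norm (\<pi> s))" using s F(1) by (intro member_le_sum) auto
        also have "\<dots> \<le> (\<Sum>s\<in>F. norm (\<pi> s)) * t"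
          using mult_left_mono[OF t'(2), of "\<Sum>s\<in>F. norm (\<pi> s)"] by (simp add: sum_nonneg)
        finally show ?thesis .
      qed
      have \<pi>m: "(\<Sum>b\<in>A. real (m b) * norm (\<pi> b)) \<le> 2 * (\<Sum>b\<in>A. norm (\<pi> b)) * t"
      proof -
        have "(\<Sum>b\<in>A. real (m b) * norm (\<pi> b)) \<le> (\<Sum>b\<in>A. 2 * t * norm (\<pi> b))"
        proof (intro sum_mono mult_right_mono)
          fix b assume "b \<in> A"
          then have "real (m b) \<le> 2 * (\<sigma> * t)" using m by blast
          also have "\<dots> \<le> 2 * (1 * t)" using \<sigma>1 t'(2) by (intro mult_left_mono mult_right_mono) auto
          finally show "real (m b) \<le> 2 * t" by simp
        qed simp
        also have "\<dots> = 2 * (\<Sum>b\<in>A. norm (\<pi> b)) * t" by (simp add: sum_distrib_left sum_distrib_right mult_ac)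
        finally show ?thesis .
      qed
      have r_eq: "r * t = t + K * (R + 1) * t + (\<Sum>s\<in>F. norm (\<pi> s)) * t + 2 * (\<Sum>b\<in>A. norm (\<pi> b)) * t"
        by (simp add: r_def algebra_simps)
      have nonneg: "0 \<le> (\<Sum>s\<in>F. norm (\<pi> s)) * t" "0 \<le> 2 * (\<Sum>b\<in>A. norm (\<pi> b)) * t"
        using t'(2) by (auto intro!: mult_nonneg_nonneg sum_nonneg)
      have "H (z + s) \<le> H z + G s (\<pi> z)" by (rule step[OF z sS])
      also have "G s (\<pi> z) \<le> \<epsilon>' * (r * t)"
      proof (rule tF[OF s _ \<pi>zT])
        show "tF s \<le> r * t" using t1(3)[OF s] t'(1) rt by linarith
        show "norm (\<pi> z) \<le> r * t" using \<pi>z nonneg t'(2) unfolding r_eq by linarith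
      qed
      finally have zs_le: "H (z + s) \<le> H z + \<epsilon>' * (r * t)" by simp
      have "H w \<le> H (z + s) + real (card A) * (\<epsilon>' * (r * t))"
        unfolding w_eq
      proof (rule subadditive_chain[OF hom step zs finA AS])
        have "\<pi> (z + s) = \<pi> z + \<pi> s" using hom z sS by (simp add: semigroup_hom_def)
        then have "norm (\<pi> (z + s)) \<le> norm (\<pi> z) + norm (\<pi> s)" by (simp add: norm_triangle_ineq)
        then show "norm (\<pi> (z + s)) + (\<Sum>b\<in>A. real (m b) * norm (\<pi> b)) \<le> r * t"
          using \<pi>z \<pi>s \<pi>m t'(2) unfolding r_eq by linarith
        fix b y assume b: "b \<in> A" and y: "y \<in> T" "norm y \<le> r * t"
        show "(\<Sum>j<m b. G b (y + real j *\<^sub>R \<pi> b)) \<le> \<epsilon>' * (r * t)"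
        proof (rule tA[OF b _ y])
          show "tA b \<le> r * t" using t1(2)[OF b] t'(1) rt by linarith
          have "real (m b) \<le> 2 * (\<sigma> * t)" using m b by blast
          also have "\<dots> = (2 * \<sigma>) * t" by simp
          also have "\<dots> \<le> \<eta> b * (r * t)"
            using \<sigma>1(2) \<eta>0_le[OF b] \<eta>[OF b] rt t'(2) by (intro mult_mono) auto
          finally show "real (m b) \<le> \<eta> b * (r * t)" .
        qed
      qed
      also have "\<dots> \<le> H z + (real (card A) + 1) * (\<epsilon>' * r) * t" using zs_le by (simp add: algebra_simps)
      finally show "H w \<le> H z + \<epsilon> * t" by (simp only: \<epsilon>_eq)
    qed
  qed
qed

section \<open>Limits along directions for a fixed realization\<close>

text \<open>The target \<open>x + (c * \<sigma>) *\<^sub>R e\<close> is fixed before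
  \<open>v\<close>, as the admissible error of \<open>v / N\<close> is proportional to \<sigma>. It
  lies behind \<open>x\<close> for \<open>c = - 1\<close> and ahead of it for \<open>c = 1\<close>,
  which leaves room for positive steps between the multiples of \<open>v\<close> and the
  sequence.\<close>

lemma approximating_direction:
  assumes x: "x \<in> asymptotic_cone S" and c: "\<bar>c\<bar> \<le> 1" and pos: "\<rho> > 0" "\<sigma>0 > 0" "\<delta> > (0::real)"
  obtains \<sigma> v and N :: nat where "0 < \<sigma>" "\<sigma> \<le> \<sigma>0" "v \<in> S" "N \<ge> 1" "v \<in> asymptotic_cone S"
    "v /\<^sub>R real N \<in> asymptotic_cone S" "norm (v /\<^sub>R real N - x) < \<rho>"
    "norm (v /\<^sub>R real N - (x + (c * \<sigma>) *\<^sub>R e)) \<le> \<delta> * \<sigma> / 4"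
proof -
  obtain \<rho>1 where \<rho>1: "\<rho>1 > 0" "\<And>z. z \<in> span S \<Longrightarrow> norm (z - x) < \<rho>1 \<Longrightarrow> z \<in> asymptotic_cone S"
    using asymptotic_cone_open[OF x] by blast
  define \<rho>2 where "\<rho>2 = min \<rho> \<rho>1"
  have \<rho>2: "\<rho>2 > 0" using pos \<rho>1 by (simp add: \<rho>2_def)
  \<comment> \<open>The second entry keeps the target within \<open>\<rho>2 / 2\<close> of
    \<open>x\<close>; the other half is left for the approximation by \<open>v / N\<close>.\<close>
  define \<sigma> where "\<sigma> = min \<sigma>0 (\<rho>2 / (2 * (norm e + 1)))"
  have ne: "norm e + 1 > 0" by (simp add: add_nonneg_pos)
  have \<sigma>: "\<sigma> > 0" using pos \<rho>2 ne by (simp add: \<sigma>_def)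
  define y where "y = x + (c * \<sigma>) *\<^sub>R e"
  have eS: "e \<in> span S" unfolding e_def using AS by (intro span_sum span_base) auto
  have xS: "x \<in> span S" using x by (simp add: asymptotic_cone_iff)
  have ySp: "y \<in> span S" unfolding y_def using xS eS by (intro span_add span_scale)
  have yx: "norm (y - x) \<le> \<rho>2 / 2"
  proof -
    have "norm (y - x) = \<bar>c\<bar> * (\<sigma> * norm e)" using \<sigma> by (simp add: y_def abs_mult)
    also have "\<dots> \<le> 1 * (\<sigma> * (norm e + 1))" using c \<sigma> by (intro mult_mono mult_left_mono) auto
    also have "\<dots> \<le> \<rho>2 / (2 * (norm e + 1)) * (norm e + 1)"
      unfolding mult_1 \<sigma>_def by (intro mult_right_mono) (auto simp: less_imp_le[OF ne])
    also have "\<dots> = \<rho>2 / 2"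
    proof -
      have "\<rho>2 / (2 * d) * d = \<rho>2 / 2" if "d \<noteq> 0" for d using that by simp
      then show ?thesis using ne by (metis less_irrefl)
    qed
    finally show ?thesis .
  qed
  have yO: "y \<in> asymptotic_cone S" using yx \<rho>2 by (intro \<rho>1(2) ySp) (simp add: \<rho>2_def)
  then have ycone: "y \<in> generated_cone S" unfolding asymptotic_cone_iff by fastforce
  have "min (\<delta> * \<sigma> / 4) (\<rho>2 / 2) > 0" using pos \<sigma> \<rho>2 by simp
  from generated_cone_approx[OF S ycone this] obtain v and N :: nat
    where v: "v \<in> S" "N \<ge> 1" "norm (v /\<^sub>R real N - y) < min (\<delta> * \<sigma> / 4) (\<rho>2 / 2)" .
  have "norm (v /\<^sub>R real N - x) \<le> norm (v /\<^sub>R real N - y) + norm (y - x)"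
    by (metis norm_triangle_ineq diff_add_cancel add_diff_eq)
  then have near: "norm (v /\<^sub>R real N - x) < \<rho>2" using v(3) yx by simp
  have vN: "v /\<^sub>R real N \<in> asymptotic_cone S"
    using near v(1) by (intro \<rho>1(2) span_scale span_base) (auto simp: \<rho>2_def)
  moreover have "real N *\<^sub>R (v /\<^sub>R real N) = v" using v(2) by simp
  ultimately have "v \<in> asymptotic_cone S"
    using asymptotic_cone_scale[of "v /\<^sub>R real N" S "real N"] v(2) by simp
  then show ?thesis using that[of \<sigma> v N] \<sigma> v vN near by (simp add: \<sigma>_def \<rho>2_def y_def)
qed

text \<open>If the gauge is minus infinity at one point, it is so on the whole cone; otherwise
  continuity applies.\<close>

lemma gauge_less_near:
  assumes q: "gauge_on (asymptotic_cone S) q" and x: "x \<in> asymptotic_cone S" and r: "q x < ereal r"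
  obtains \<rho> where "\<rho> > 0" "\<And>y. y \<in> asymptotic_cone S \<Longrightarrow> norm (y - x) < \<rho> \<Longrightarrow> q y < ereal r"
proof (cases "q x = -\<infinity>")
  case True
  show ?thesis
  proof (rule that[of 1])
    fix y assume "y \<in> asymptotic_cone S"
    then show "q y < ereal r" using gauge_minus_infinity[OF q x True] by simp
  qed simp
next
  case False
  then obtain u where u: "q x = ereal u" using r by (cases "q x") auto
  then have "r - u > 0" using r by simp
  then obtain \<rho> where \<rho>: "\<rho> > 0"
    "\<And>y. y \<in> asymptotic_cone S \<Longrightarrow> norm (y - x) < \<rho> \<Longrightarrow>
      \<exists>s. q y = ereal s \<and> \<bar>s - real_of_ereal (q x)\<bar> < r - u"
    by (rule gauge_continuous[OF q x False]) blast
  show ?thesis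
  proof (rule that[OF \<rho>(1)])
    fix y assume "y \<in> asymptotic_cone S" "norm (y - x) < \<rho>"
    from \<rho>(2)[OF this] show "q y < ereal r" using u by auto
  qed
qed

lemma gauge_greater_near:
  assumes q: "gauge_on (asymptotic_cone S) q" and x: "x \<in> asymptotic_cone S" and r: "ereal r < q x"
  obtains \<rho> where "\<rho> > 0" "\<And>y. y \<in> asymptotic_cone S \<Longrightarrow> norm (y - x) < \<rho> \<Longrightarrow> ereal r < q y"
proof -
  have "q x < \<infinity>" using q x by (simp add: gauge_on_def)
  then obtain u where u: "q x = ereal u" using r by (cases "q x") auto
  then have "u - r > 0" "q x \<noteq> -\<infinity>" using r by auto
  then obtain \<rho> where \<rho>: "\<rho> > 0"
    "\<And>y. y \<in> asymptotic_cone S \<Longrightarrow> norm (y - x) < \<rho> \<Longrightarrow>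
      \<exists>s. q y = ereal s \<and> \<bar>s - real_of_ereal (q x)\<bar> < u - r"
    using gauge_continuous[OF q x] by metis
  show ?thesis
  proof (rule that[OF \<rho>(1)])
    fix y assume "y \<in> asymptotic_cone S" "norm (y - x) < \<rho>"
    from \<rho>(2)[OF this] show "ereal r < q y" using u by auto
  qed
qed

lemma eventually_near_direction:
  fixes t :: "nat \<Rightarrow> real"
  assumes t: "filterlim t at_top sequentially" and lim: "(\<lambda>k. xs k /\<^sub>R t k) \<longlonglongrightarrow> x" and \<theta>: "\<theta> > 0"
  shows "\<forall>\<^sub>F k in sequentially. norm (xs k - t k *\<^sub>R x) \<le> \<theta> * t k"
proof -
  have "\<forall>\<^sub>F k in sequentially. dist (xs k /\<^sub>R t k) x < \<theta>" using lim \<theta> by (rule tendstoD)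
  moreover have "\<forall>\<^sub>F k in sequentially. 1 \<le> t k" using t by (simp add: filterlim_at_top)
  ultimately show ?thesis
  proof eventually_elim
    case (elim k)
    then have "xs k - t k *\<^sub>R x = t k *\<^sub>R (xs k /\<^sub>R t k - x)" by (simp add: scaleR_right_diff_distrib)
    then have "norm (xs k - t k *\<^sub>R x) = t k * norm (xs k /\<^sub>R t k - x)" using elim by simp
    also have "\<dots> \<le> t k * \<theta>" using elim by (intro mult_left_mono) (auto simp: dist_norm)
    finally show ?case by (simp add: mult.commute)
  qed
qed

text \<open>Meant for \<open>n\<close> the integer part of \<open>t / N\<close>: replacing
  \<open>t\<close> by \<open>n * N\<close> in front of \<open>v / N\<close> costs at most
  \<open>norm v\<close>.\<close>

lemma norm_floor_multiple_diff_le: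
  assumes N: "N \<ge> (1::nat)" and n: "real n * real N \<le> t" "t \<le> real n * real N + real N" and t: "t \<ge> 0"
    and w: "norm (v /\<^sub>R real N - w) \<le> \<theta>"
  shows "norm (real n *\<^sub>R v - t *\<^sub>R w) \<le> \<theta> * t + norm v"
proof -
  have "real n *\<^sub>R v - t *\<^sub>R w = t *\<^sub>R (v /\<^sub>R real N - w) - (t - real n * real N) *\<^sub>R (v /\<^sub>R real N)"
  proof -
    have "real n = t * inverse (real N) - (t - real n * real N) * inverse (real N)"
      using N by (simp add: field_simps)
    then have "real n *\<^sub>R v = (t * inverse (real N)) *\<^sub>R v - ((t - real n * real N) * inverse (real N)) *\<^sub>R v"
      by (metis scaleR_left_diff_distrib)
    then show ?thesis by (simp add: scaleR_right_diff_distrib)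
  qed
  also have "norm \<dots> \<le> norm (t *\<^sub>R (v /\<^sub>R real N - w)) + norm ((t - real n * real N) *\<^sub>R (v /\<^sub>R real N))"
    by (rule norm_triangle_ineq4)
  also have "\<dots> = t * norm (v /\<^sub>R real N - w) + (t - real n * real N) * (norm v / real N)"
    using n(1) t by (simp add: divide_inverse mult.commute)
  also have "\<dots> \<le> t * \<theta> + real N * (norm v / real N)"
    using n t w by (intro add_mono mult_left_mono mult_right_mono) auto
  finally show ?thesis using N by (simp add: mult.commute)
qed

text \<open>\<open>t\<close> is left general, so that an arbitrary norm enters only through
  \<open>t k = Nm (xs k)\<close> while the estimates are Euclidean. Multiples of \<open>v\<close>
  trailing the sequence bound \<open>H (xs k)\<close> from above, multiples running ahead bound it
  from below. Both are prepared in \<open>key\<close>, with \<open>c = - 1\<close> and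
  \<open>c = 1\<close>.\<close>

lemma directional_limit:
  fixes H :: "real ^ 'm \<Rightarrow> real" and t :: "nat \<Rightarrow> real"
  assumes \<delta>: "\<delta> > 0"
    and comp: "\<And>\<epsilon> R. \<epsilon> > 0 \<Longrightarrow> R > 0 \<Longrightarrow> \<exists>\<sigma>0>0. \<forall>\<sigma>. 0 < \<sigma> \<longrightarrow> \<sigma> \<le> \<sigma>0 \<longrightarrow> (\<exists>t0. \<forall>t\<ge>t0. \<forall>z\<in>S. \<forall>w\<in>S.
       norm z \<le> R * t \<longrightarrow> norm (w - z - (\<sigma> * t) *\<^sub>R e) \<le> \<delta> * (\<sigma> * t) \<longrightarrow> H w \<le> H z + \<epsilon> * t)"
    and q: "gauge_on (asymptotic_cone S) q"
    and conv: "\<And>v. v \<in> asymptotic_cone S \<Longrightarrow> v \<in> S \<Longrightarrow> (\<lambda>k::nat. ereal (H (real k *\<^sub>R v) / real k)) \<longlonglongrightarrow> q v"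
    and x: "x \<in> asymptotic_cone S" and xs: "\<And>k. xs k \<in> S"
    and t: "filterlim t at_top sequentially" and lim: "(\<lambda>k. xs k /\<^sub>R t k) \<longlonglongrightarrow> x"
  shows "(\<lambda>k. ereal (H (xs k) / t k)) \<longlonglongrightarrow> q x"
proof -
  have t_large: "\<forall>\<^sub>F k in sequentially. c \<le> t k" for c using t by (simp add: filterlim_at_top)
  have key: "\<exists>\<sigma> v N n. 0 < \<sigma> \<and> v \<in> S \<and> v /\<^sub>R real N \<in> asymptotic_cone S \<and> norm (v /\<^sub>R real N - x) < \<rho> \<and> N \<ge> 1 \<and>
      (\<forall>\<^sub>F k in sequentially. (\<forall>z\<in>S. \<forall>w\<in>S. norm z \<le> (norm x + 1) * t k \<longrightarrow>
        norm (w - z - (\<sigma> * t k) *\<^sub>R e) \<le> \<delta> * (\<sigma> * t k) \<longrightarrow> H w \<le> H z + \<epsilon> * t k)) \<and>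
      (\<forall>\<^sub>F k in sequentially. real (n k) * real N \<le> t k \<and> t k \<le> real (n k) * real N + real N \<and> (1::nat) \<le> n k \<and>
         norm (real (n k) *\<^sub>R v - xs k - (c * (\<sigma> * t k)) *\<^sub>R e) \<le> \<delta> * (\<sigma> * t k) \<and>
         norm (real (n k) *\<^sub>R v) \<le> (norm x + 1) * t k) \<and>
      (\<lambda>k. ereal (H (real (n k) *\<^sub>R v) / real (n k))) \<longlonglongrightarrow> ereal (real N) * q (v /\<^sub>R real N)"
    if \<epsilon>: "\<epsilon> > 0" and \<rho>: "\<rho> > 0" "\<rho> \<le> 1" and c: "\<bar>c\<bar> \<le> 1" for \<epsilon> \<rho> c
  proof -
    have "norm x + 1 > 0" by (simp add: add_nonneg_pos)
    from comp[OF \<epsilon> this] obtain \<sigma>0 where \<sigma>0: "\<sigma>0 > 0" and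
      cmp: "\<And>\<sigma>. 0 < \<sigma> \<Longrightarrow> \<sigma> \<le> \<sigma>0 \<Longrightarrow> \<exists>t0. \<forall>t\<ge>t0. \<forall>z\<in>S. \<forall>w\<in>S. norm z \<le> (norm x + 1) * t \<longrightarrow>
         norm (w - z - (\<sigma> * t) *\<^sub>R e) \<le> \<delta> * (\<sigma> * t) \<longrightarrow> H w \<le> H z + \<epsilon> * t"
      by blast
    obtain \<sigma> v and N :: nat where \<sigma>: "0 < \<sigma>" "\<sigma> \<le> \<sigma>0" and v: "v \<in> S" "N \<ge> 1" "v \<in> asymptotic_cone S"
      "v /\<^sub>R real N \<in> asymptotic_cone S" "norm (v /\<^sub>R real N - x) < \<rho>"
      "norm (v /\<^sub>R real N - (x + (c * \<sigma>) *\<^sub>R e)) \<le> \<delta> * \<sigma> / 4"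
      using approximating_direction[OF x c \<rho>(1) \<sigma>0 \<delta>] by blast
    obtain t0 where t0: "\<And>t z w. t \<ge> t0 \<Longrightarrow> z \<in> S \<Longrightarrow> w \<in> S \<Longrightarrow> norm z \<le> (norm x + 1) * t \<Longrightarrow>
         norm (w - z - (\<sigma> * t) *\<^sub>R e) \<le> \<delta> * (\<sigma> * t) \<Longrightarrow> H w \<le> H z + \<epsilon> * t"
      using cmp[OF \<sigma>] by blast
    have ev1: "\<forall>\<^sub>F k in sequentially. (\<forall>z\<in>S. \<forall>w\<in>S. norm z \<le> (norm x + 1) * t k \<longrightarrow>
        norm (w - z - (\<sigma> * t k) *\<^sub>R e) \<le> \<delta> * (\<sigma> * t k) \<longrightarrow> H w \<le> H z + \<epsilon> * t k)"
      using t_large[of t0] by eventually_elim (use t0 in blast)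
    \<comment> \<open>As \<open>v / N\<close> is close to \<open>x\<close>, this many copies of
      \<open>v\<close> match the size \<open>t k\<close>.\<close>
    define n where "n k = nat \<lfloor>t k / real N\<rfloor>" for k
    have n_large: "\<forall>\<^sub>F k in sequentially. m \<le> n k" for m
      using t_large[of "real m * real N"]
    proof eventually_elim
      case (elim k)
      then have "real m \<le> t k / real N" using v(2) by (simp add: field_simps)
      then show ?case by (simp add: n_def le_nat_iff le_floor_iff)
    qed
    then have n_lim: "filterlim n at_top sequentially" by (simp add: filterlim_at_top)
    have "\<forall>\<^sub>F k in sequentially. norm (xs k - t k *\<^sub>R x) \<le> \<delta> * \<sigma> / 4 * t k"
      using \<delta> \<sigma> by (intro eventually_near_direction t lim) simp
    with n_large[of 1] t_large[of 0] t_large[of "norm v * 2 / (\<delta> * \<sigma>)"]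
    have ev2: "\<forall>\<^sub>F k in sequentially. real (n k) * real N \<le> t k \<and> t k \<le> real (n k) * real N + real N \<and> (1::nat) \<le> n k \<and>
         norm (real (n k) *\<^sub>R v - xs k - (c * (\<sigma> * t k)) *\<^sub>R e) \<le> \<delta> * (\<sigma> * t k) \<and>
         norm (real (n k) *\<^sub>R v) \<le> (norm x + 1) * t k"
    proof eventually_elim
      case (elim k)
      have tN: "0 \<le> t k / real N" using elim(2) by simp
      have "real (n k) \<le> t k / real N" unfolding n_def using tN by (rule of_nat_floor)
      moreover have "t k / real N \<le> real (n k) + 1" unfolding n_def by linarith
      ultimately have nN: "real (n k) * real N \<le> t k" "t k \<le> real (n k) * real N + real N"
        using v(2) by (auto simp: field_simps)
      have a: "norm (real (n k) *\<^sub>R v - t k *\<^sub>R (x + (c * \<sigma>) *\<^sub>R e)) \<le> \<delta> * \<sigma> / 4 * t k + norm v"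
        by (rule norm_floor_multiple_diff_le[OF v(2) nN elim(2) v(6)])
      have b: "norm v \<le> \<delta> * \<sigma> / 2 * t k" using elim(3) \<delta> \<sigma>(1) by (simp add: field_simps)
      have "real (n k) *\<^sub>R v - xs k - (c * (\<sigma> * t k)) *\<^sub>R e
          = (real (n k) *\<^sub>R v - t k *\<^sub>R (x + (c * \<sigma>) *\<^sub>R e)) - (xs k - t k *\<^sub>R x)"
        by (simp add: algebra_simps)
      also have "norm \<dots> \<le> norm (real (n k) *\<^sub>R v - t k *\<^sub>R (x + (c * \<sigma>) *\<^sub>R e)) + norm (xs k - t k *\<^sub>R x)"
        by (rule norm_triangle_ineq4)
      \<comment> \<open>Error budget: a quarter for the direction of \<open>v\<close>, a half for
        rounding \<open>t k\<close> to a multiple of \<open>N\<close>, a quarter for the sequence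
        itself.\<close>
      also have "\<dots> \<le> (\<delta> * \<sigma> / 4 * t k + \<delta> * \<sigma> / 2 * t k) + \<delta> * \<sigma> / 4 * t k"
        using a b elim(4) by (intro add_mono) auto
      also have "\<dots> = \<delta> * (\<sigma> * t k)" by simp
      finally have near: "norm (real (n k) *\<^sub>R v - xs k - (c * (\<sigma> * t k)) *\<^sub>R e) \<le> \<delta> * (\<sigma> * t k)" .
      have "norm (v /\<^sub>R real N) \<le> norm x + 1"
        using v(5) \<rho>(2) norm_triangle_ineq[of x "v /\<^sub>R real N - x"] by simp
      then have bound: "(real (n k) * real N) * norm (v /\<^sub>R real N) \<le> t k * (norm x + 1)"
        using nN(1) elim(2) by (intro mult_mono) auto
      have "norm (real (n k) *\<^sub>R v) = (real (n k) * real N) * norm (v /\<^sub>R real N)"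
        using v(2) by (simp add: field_simps)
      also note bound
      also have "t k * (norm x + 1) = (norm x + 1) * t k" by (rule mult.commute)
      finally have "norm (real (n k) *\<^sub>R v) \<le> (norm x + 1) * t k" .
      then show ?case using nN elim(1) near by blast
    qed
    have "q (s *\<^sub>R (v /\<^sub>R real N)) = ereal s * q (v /\<^sub>R real N)" if "s > 0" for s
      using q v(4) that unfolding gauge_on_def by blast
    from this[of "real N"] have qv: "q v = ereal (real N) * q (v /\<^sub>R real N)" using v(2) by simp
    have "(\<lambda>k. ereal (H (real (n k) *\<^sub>R v) / real (n k))) \<longlonglongrightarrow> q v"
      by (rule filterlim_compose[OF conv[OF v(3,1)] n_lim])
    then show ?thesis using \<sigma>(1) v(1,2,4,5) ev1 ev2 qv by (intro exI[of _ \<sigma>] exI[of _ v] exI[of _ N] exI[of _ n]) auto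
  qed
  show ?thesis
  proof (rule order_tendstoI)
    fix a assume a: "q x < a"
    obtain r where r: "q x < ereal r" "ereal r < a" using ereal_dense2[OF a] by blast
    obtain r1 where r1: "q x < ereal r1" "r1 < r" using ereal_dense2[OF r(1)] by auto
    obtain \<rho>0 where \<rho>0: "\<rho>0 > 0" "\<And>y. y \<in> asymptotic_cone S \<Longrightarrow> norm (y - x) < \<rho>0 \<Longrightarrow> q y < ereal r1"
      using gauge_less_near[OF q x r1(1)] by metis
    \<comment> \<open>Of \<open>r - r1\<close> one half pays for the comparison, the other for the
      rounding error \<open>\<bar>r1\<bar> * N\<close>.\<close>
    define \<epsilon> where "\<epsilon> = (r - r1) / 2"
    have \<epsilon>: "\<epsilon> > 0" using r1 by (simp add: \<epsilon>_def)
    have "min \<rho>0 1 > 0" "min \<rho>0 1 \<le> 1" "\<bar>- 1 :: real\<bar> \<le> 1" using \<rho>0 by auto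
    from key[OF \<epsilon> this] obtain \<sigma> v N n where \<sigma>: "0 < \<sigma>" and v: "v \<in> S" "v /\<^sub>R real N \<in> asymptotic_cone S"
      "norm (v /\<^sub>R real N - x) < min \<rho>0 1" "N \<ge> 1"
      and ev1: "\<forall>\<^sub>F k in sequentially. (\<forall>z\<in>S. \<forall>w\<in>S. norm z \<le> (norm x + 1) * t k \<longrightarrow>
        norm (w - z - (\<sigma> * t k) *\<^sub>R e) \<le> \<delta> * (\<sigma> * t k) \<longrightarrow> H w \<le> H z + \<epsilon> * t k)"
      and ev2: "\<forall>\<^sub>F k in sequentially. real (n k) * real N \<le> t k \<and> t k \<le> real (n k) * real N + real N \<and> (1::nat) \<le> n k \<and>
         norm (real (n k) *\<^sub>R v - xs k - (- 1 * (\<sigma> * t k)) *\<^sub>R e) \<le> \<delta> * (\<sigma> * t k) \<and>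
         norm (real (n k) *\<^sub>R v) \<le> (norm x + 1) * t k"
      and lim_n: "(\<lambda>k. ereal (H (real (n k) *\<^sub>R v) / real (n k))) \<longlonglongrightarrow> ereal (real N) * q (v /\<^sub>R real N)"
      by (elim exE conjE)
    have "q (v /\<^sub>R real N) < ereal r1" using v(2,3) by (intro \<rho>0(2)) auto
    then have "ereal (real N) * q (v /\<^sub>R real N) < ereal (real N * r1)"
      using v(4) by (cases "q (v /\<^sub>R real N)") auto
    from order_tendstoD(2)[OF lim_n this]
    have "\<forall>\<^sub>F k in sequentially. H (real (n k) *\<^sub>R v) / real (n k) < real N * r1" by simp
    with ev1 ev2 t_large[of "(\<bar>r1\<bar> * real N + 1) / \<epsilon>"] t_large[of 1]
    have "\<forall>\<^sub>F k in sequentially. H (xs k) / t k < r"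
    proof eventually_elim
      case (elim k)
      have nS: "real (n k) *\<^sub>R v \<in> S" using elim(2) by (intro vector_semigroup_scale S v) auto
      have "norm (xs k - real (n k) *\<^sub>R v - (\<sigma> * t k) *\<^sub>R e) = norm (real (n k) *\<^sub>R v - xs k - (- 1 * (\<sigma> * t k)) *\<^sub>R e)"
        by (subst norm_minus_cancel[symmetric]) (simp add: algebra_simps)
      then have "H (xs k) \<le> H (real (n k) *\<^sub>R v) + \<epsilon> * t k" using elim(1,2) nS xs by auto
      also have "H (real (n k) *\<^sub>R v) \<le> r1 * (real (n k) * real N)"
        using elim(2,5) by (simp add: field_simps)
      \<comment> \<open>\<open>r1\<close> may be negative, so \<open>n k * N \<le> t k\<close> alone
        does not suffice.\<close>
      also have "r1 * (real (n k) * real N) \<le> r1 * t k + \<bar>r1\<bar> * real N"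
      proof -
        have "\<bar>r1 * (real (n k) * real N - t k)\<bar> \<le> \<bar>r1\<bar> * real N"
          unfolding abs_mult using elim(2) by (intro mult_left_mono) auto
        then show ?thesis by (simp add: right_diff_distrib abs_le_iff)
      qed
      also have "r1 * t k + \<bar>r1\<bar> * real N + \<epsilon> * t k < r * t k"
      proof -
        have "\<bar>r1\<bar> * real N + 1 \<le> \<epsilon> * t k" using elim(3) \<epsilon> by (simp add: field_simps)
        moreover have "r * t k = r1 * t k + 2 * (\<epsilon> * t k)"
        proof -
          have "2 * (\<epsilon> * t k) = (r - r1) * t k" by (simp add: \<epsilon>_def)
          then show ?thesis by (simp add: left_diff_distrib)
        qed
        ultimately show ?thesis by simp
      qed
      finally have "H (xs k) < r * t k" by simp
      then show ?case using elim(4) by (simp add: pos_divide_less_eq)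
    qed
    then show "\<forall>\<^sub>F k in sequentially. ereal (H (xs k) / t k) < a"
    proof eventually_elim
      case (elim k)
      then have "ereal (H (xs k) / t k) < ereal r" by simp
      then show ?case using r(2) by (rule less_trans)
    qed
  next
    fix a assume a: "a < q x"
    obtain r where r: "a < ereal r" "ereal r < q x" using ereal_dense2[OF a] by blast
    obtain r1 where r1: "r < r1" "ereal r1 < q x" using ereal_dense2[OF r(2)] by auto
    obtain \<rho>0 where \<rho>0: "\<rho>0 > 0" "\<And>y. y \<in> asymptotic_cone S \<Longrightarrow> norm (y - x) < \<rho>0 \<Longrightarrow> ereal r1 < q y"
      using gauge_greater_near[OF q x r1(2)] by metis
    define \<epsilon> where "\<epsilon> = (r1 - r) / 2"
    have \<epsilon>: "\<epsilon> > 0" using r1 by (simp add: \<epsilon>_def)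
    have "min \<rho>0 1 > 0" "min \<rho>0 1 \<le> 1" "\<bar>1 :: real\<bar> \<le> 1" using \<rho>0 by auto
    from key[OF \<epsilon> this] obtain \<sigma> v N n where \<sigma>: "0 < \<sigma>" and v: "v \<in> S" "v /\<^sub>R real N \<in> asymptotic_cone S"
      "norm (v /\<^sub>R real N - x) < min \<rho>0 1" "N \<ge> 1"
      and ev1: "\<forall>\<^sub>F k in sequentially. (\<forall>z\<in>S. \<forall>w\<in>S. norm z \<le> (norm x + 1) * t k \<longrightarrow>
        norm (w - z - (\<sigma> * t k) *\<^sub>R e) \<le> \<delta> * (\<sigma> * t k) \<longrightarrow> H w \<le> H z + \<epsilon> * t k)"
      and ev2: "\<forall>\<^sub>F k in sequentially. real (n k) * real N \<le> t k \<and> t k \<le> real (n k) * real N + real N \<and> (1::nat) \<le> n k \<and>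
         norm (real (n k) *\<^sub>R v - xs k - (1 * (\<sigma> * t k)) *\<^sub>R e) \<le> \<delta> * (\<sigma> * t k) \<and>
         norm (real (n k) *\<^sub>R v) \<le> (norm x + 1) * t k"
      and lim_n: "(\<lambda>k. ereal (H (real (n k) *\<^sub>R v) / real (n k))) \<longlonglongrightarrow> ereal (real N) * q (v /\<^sub>R real N)"
      by (elim exE conjE)
    have "ereal r1 < q (v /\<^sub>R real N)" using v(2,3) by (intro \<rho>0(2)) auto
    then have "ereal (real N * r1) < ereal (real N) * q (v /\<^sub>R real N)"
      using v(4) by (cases "q (v /\<^sub>R real N)") auto
    from order_tendstoD(1)[OF lim_n this]
    have "\<forall>\<^sub>F k in sequentially. real N * r1 < H (real (n k) *\<^sub>R v) / real (n k)" by simp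
    \<comment> \<open>Now the comparison starts at \<open>xs k\<close>, whose norm therefore has to
      be at most \<open>(norm x + 1) * t k\<close>.\<close>
    moreover have "\<forall>\<^sub>F k in sequentially. norm (xs k - t k *\<^sub>R x) \<le> 1 * t k"
      by (intro eventually_near_direction t lim) simp
    ultimately have "\<forall>\<^sub>F k in sequentially. r < H (xs k) / t k"
      using ev1 ev2 t_large[of "(\<bar>r1\<bar> * real N + 1) / \<epsilon>"] t_large[of 1]
    proof eventually_elim
      case (elim k)
      have nS: "real (n k) *\<^sub>R v \<in> S" using elim(4) by (intro vector_semigroup_scale S v) auto
      have "norm (xs k) \<le> norm (xs k - t k *\<^sub>R x) + norm (t k *\<^sub>R x)"
        using norm_triangle_ineq[of "xs k - t k *\<^sub>R x" "t k *\<^sub>R x"] by simp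
      also have "\<dots> \<le> (norm x + 1) * t k" using elim(2,6) by (simp add: algebra_simps)
      finally have "norm (xs k) \<le> (norm x + 1) * t k" .
      then have cmp: "H (real (n k) *\<^sub>R v) \<le> H (xs k) + \<epsilon> * t k" using elim(3,4) nS xs by auto
      have lower: "r1 * (real (n k) * real N) \<le> H (real (n k) *\<^sub>R v)"
        using elim(4,1) by (simp add: field_simps)
      have "\<bar>r1 * (real (n k) * real N - t k)\<bar> \<le> \<bar>r1\<bar> * real N"
        unfolding abs_mult using elim(4) by (intro mult_left_mono) auto
      then have "r1 * t k - \<bar>r1\<bar> * real N \<le> r1 * (real (n k) * real N)"
        by (simp add: right_diff_distrib abs_le_iff)
      moreover have "\<bar>r1\<bar> * real N + 1 \<le> \<epsilon> * t k" using elim(5) \<epsilon> by (simp add: field_simps)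
      moreover have "r1 * t k = r * t k + 2 * (\<epsilon> * t k)"
      proof -
        have "2 * (\<epsilon> * t k) = (r1 - r) * t k" by (simp add: \<epsilon>_def)
        then show ?thesis by (simp add: left_diff_distrib)
      qed
      ultimately have "r * t k < H (xs k)" using cmp lower by linarith
      then show ?case using elim(6) by (simp add: pos_less_divide_eq)
    qed
    then show "\<forall>\<^sub>F k in sequentially. a < ereal (H (xs k) / t k)"
    proof eventually_elim
      case (elim k)
      then have "ereal r < ereal (H (xs k) / t k)" by simp
      with r(1) show ?case by (rule less_trans)
    qed
  qed
qed

end

section \<open>The fields generated by a measure-preserving action and the common null set\<close>

lemma noise_field_action:
  fixes M :: "'a measure" and T :: "(real ^ 'n) set"
  assumes "prob_space M" and T: "vector_semigroup T" and N: "norm_function N" and l: "l \<ge> 1"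
    and act: "semigroup_action M T g" and Y: "Y \<in> borel_measurable M" "\<And>\<omega>. \<omega> \<in> space M \<Longrightarrow> 0 \<le> Y \<omega>"
    and moment: "integrable M (\<lambda>\<omega>. \<bar>Y \<omega>\<bar> ^ l)"
    and indep: "almost_independent M N T (\<lambda>y \<omega>. Y (g y \<omega>))"
    and K0: "K0 > 0" "\<And>R. R \<ge> 1 \<Longrightarrow> real (card {y \<in> T. norm y \<le> R}) \<le> K0 * R ^ l"
  obtains c where "noise_field M T N (\<lambda>y \<omega>. Y (g y \<omega>)) Y l K0 c"
proof -
  interpret prob_space M by fact
  obtain c where c: "\<forall>A B. A \<subseteq> T \<longrightarrow> A \<noteq> {} \<longrightarrow> B \<subseteq> T \<longrightarrow> B \<noteq> {} \<longrightarrow> set_distance N A B > c \<longrightarrow>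
      indep_var (PiM A (\<lambda>_. borel)) (\<lambda>\<omega>. \<lambda>y\<in>A. Y (g y \<omega>)) (PiM B (\<lambda>_. borel)) (\<lambda>\<omega>. \<lambda>y\<in>B. Y (g y \<omega>))"
    using indep unfolding almost_independent_def by blast
  have g: "g y \<in> measurable M M" and pres: "\<And>A. A \<in> sets M \<Longrightarrow> emeasure M (g y -` A \<inter> space M) = emeasure M A"
    if "y \<in> T" for y
    using act that unfolding semigroup_action_def measure_preserving_map_def by auto
  have distr_g: "distr M M (g y) = M" if "y \<in> T" for y
    using pres[OF that] g[OF that] by (intro measure_eqI) (auto simp: emeasure_distr)
  \<comment> \<open>The constant of almost independence may be negative; enlarging it to a
    nonnegative \<open>gap\<close> is harmless.\<close>
  have "noise_field M T N (\<lambda>y \<omega>. Y (g y \<omega>)) Y l K0 (max c 0)"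
  proof
    show "(\<lambda>\<omega>. Y (g y \<omega>)) \<in> borel_measurable M" if "y \<in> T" for y
      by (rule measurable_compose[OF g[OF that] Y(1)])
    show "0 \<le> Y (g y \<omega>)" if "y \<in> T" "\<omega> \<in> space M" for y \<omega>
      using Y(2) measurable_space[OF g[OF that(1)] that(2)] by blast
    show "distr M borel (\<lambda>\<omega>. Y (g y \<omega>)) = distr M borel Y" if "y \<in> T" for y
      using distr_distr[OF Y(1) g[OF that]] distr_g[OF that] by (simp add: comp_def)
    have "integrable M (\<lambda>\<omega>. \<bar>Y \<omega>\<bar> ^ l) \<longleftrightarrow> integrable M (\<lambda>\<omega>. Y \<omega> ^ l)"
      by (rule Bochner_Integration.integrable_cong) (auto simp: Y(2))
    then show "integrable M (\<lambda>\<omega>. Y \<omega> ^ l)" using moment by simp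
    show "indep_var (PiM A (\<lambda>_. borel)) (\<lambda>\<omega>. \<lambda>y\<in>A. Y (g y \<omega>)) (PiM B (\<lambda>_. borel)) (\<lambda>\<omega>. \<lambda>y\<in>B. Y (g y \<omega>))"
      if "A \<subseteq> T" "A \<noteq> {}" "B \<subseteq> T" "B \<noteq> {}" "set_distance N A B > max c 0" for A B
      using c that by auto
  qed (use T N l Y K0 in auto)
  then show ?thesis by (rule that)
qed

theorem theorem1p1:
  fixes M :: "'a measure"
    and T :: "(real ^ 'n) set" and S :: "(real ^ 'm) set"
    and Nm :: "real ^ 'm \<Rightarrow> real" and Nn :: "real ^ 'n \<Rightarrow> real"
    and g :: "real ^ 'n \<Rightarrow> 'a \<Rightarrow> 'a" and f :: "real ^ 'm \<Rightarrow> 'a \<Rightarrow> 'a"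
    and \<pi> :: "real ^ 'm \<Rightarrow> real ^ 'n"
    and h h_plus :: "real ^ 'm \<Rightarrow> 'a \<Rightarrow> real"
    and q :: "real ^ 'm \<Rightarrow> ereal"
    and l :: nat
  assumes "norm_function Nm" and "norm_function Nn"
    and "prob_space M"
    and "l \<ge> 1"
    and "vector_semigroup T" and "semigroup_dim T = l"
    and "ergodic_action M T g"
    and "vector_semigroup S"
    and "semigroup_hom S T \<pi>" and "nontrivial_on S \<pi>"
    and "\<And>x. x \<in> S \<Longrightarrow> f x = g (\<pi> x)"
    and "subadditive_random_function M S f h"
    and "random_function M S h_plus"
    and "\<And>x \<omega>. x \<in> S \<Longrightarrow> \<omega> \<in> space M \<Longrightarrow> 0 \<le> h_plus x \<omega>"
    and "\<And>x \<omega>. x \<in> S \<Longrightarrow> \<omega> \<in> space M \<Longrightarrow> h x \<omega> \<le> h_plus x \<omega>"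
    and "\<And>a. a \<in> S \<Longrightarrow> integrable M (\<lambda>\<omega>. \<bar>h_plus a \<omega>\<bar> ^ l)"
    and "\<And>a. a \<in> S \<Longrightarrow> almost_independent M Nn T (\<lambda>y \<omega>. h_plus a (g y \<omega>))"
    and "associated_gauge M S h q"
  shows "\<exists>W\<in>sets M. measure M W = 1 \<and>
    (\<forall>\<omega>\<in>W. \<forall>x\<in>asymptotic_cone S. \<forall>xs.
       (\<forall>k. xs k \<in> S) \<longrightarrow> asymptotic_direction Nm xs x \<longrightarrow>
       (\<lambda>k. ereal (h (xs k) \<omega> / Nm (xs k))) \<longlonglongrightarrow> q x)"
proof -
  note Nn = assms(2) and prob = assms(3) and l = assms(4) and T = assms(5)
    and dimT = assms(6) and erg = assms(7) and S = assms(8) and hom = assms(9) and nontriv = assms(10)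
    and f = assms(11) and subadd = assms(12) and meas = assms(13) and nonneg = assms(14)
    and dom = assms(15) and moment = assms(16) and indep = assms(17) and gauge = assms(18)
  interpret prob_space M by (rule prob)
  have act: "semigroup_action M T g" using erg by (simp add: ergodic_action_def)
  obtain a0 where a0: "a0 \<in> S" "\<pi> a0 \<noteq> 0" using nontriv by (auto simp: nontrivial_on_def)
  \<comment> \<open>The basis lemma is applied to \<open>T\<close> with the identity, in order to
    count the points of balls in \<open>T\<close>; nontriviality comes from that of \<pi>.\<close>
  have "semigroup_hom T T (\<lambda>y. y)" by (simp add: semigroup_hom_def)
  moreover have "nontrivial_on T (\<lambda>y. y)"
    using a0 hom by (auto simp: nontrivial_on_def semigroup_hom_def)
  ultimately obtain A' \<phi>' C' where B': "semigroup_basis T A' (\<Sum>A') \<phi>' C'" "card A' = semigroup_dim T"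
    by (rule exists_semigroup_basis[OF T])
  obtain K0 where K0: "K0 > 0" "\<And>R. R \<ge> 1 \<Longrightarrow> real (card {y \<in> T. norm y \<le> R}) \<le> K0 * R ^ l"
    using semigroup_basis.card_ball[OF B'(1)] B'(2) dimT by auto
  obtain A \<phi> C where basis: "semigroup_basis S A (\<Sum>A) \<phi> C" and \<pi>A: "\<And>a. a \<in> A \<Longrightarrow> \<pi> a \<noteq> 0"
    using exists_semigroup_basis[OF S hom nontriv] by metis
  interpret B: semigroup_basis S A "\<Sum>A" \<phi> C by (rule basis)
  obtain K where K: "K > 0" "\<And>x. x \<in> S \<Longrightarrow> norm (\<pi> x) \<le> K * (norm x + 1)"
    using B.hom_growth[OF hom] by blast
  obtain \<delta> \<tau>0 F where \<delta>: "\<delta> > 0" and \<tau>0: "\<tau>0 > 0" and F: "finite F" "F \<subseteq> S"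
    and dec: "\<And>w z \<tau>. w \<in> S \<Longrightarrow> z \<in> S \<Longrightarrow> \<tau> \<ge> \<tau>0 \<Longrightarrow> norm (w - z - \<tau> *\<^sub>R \<Sum>A) \<le> \<delta> * \<tau> \<Longrightarrow>
      \<exists>s\<in>F. \<exists>m. (\<forall>a\<in>A. real (m a) \<le> 2 * \<tau>) \<and> w = z + s + (\<Sum>a\<in>A. real (m a) *\<^sub>R a)"
    by (rule B.decomposition) blast
  have field: "\<exists>c. noise_field M T Nn (\<lambda>y \<omega>. h_plus b (g y \<omega>)) (h_plus b) l K0 c" if b: "b \<in> S" for b
    using noise_field_action[OF prob T Nn l act _ nonneg[OF b] moment[OF b] indep[OF b] K0] meas b
    unfolding random_function_def by metis
  define small_segments where "small_segments b \<omega> \<longleftrightarrow> (\<forall>\<epsilon>>0. \<exists>\<eta>>0. \<exists>t0\<ge>1. \<forall>t\<ge>t0. \<forall>y\<in>T. norm y \<le> t \<longrightarrow>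
      (\<forall>m. real m \<le> \<eta> * t \<longrightarrow> (\<Sum>j<m. h_plus b (g (y + real j *\<^sub>R \<pi> b) \<omega>)) \<le> \<epsilon> * t))" for b \<omega>
  define sublinear where "sublinear s \<omega> \<longleftrightarrow> (\<forall>\<epsilon>>0. \<exists>t0\<ge>1. \<forall>t\<ge>t0. \<forall>y\<in>T. norm y \<le> t \<longrightarrow>
      h_plus s (g y \<omega>) \<le> \<epsilon> * t)" for s \<omega>
  have AE1: "AE \<omega> in M. small_segments b \<omega>" if b: "b \<in> A" for b
  proof -
    have bS: "b \<in> S" using b B.AS by blast
    obtain c where c: "noise_field M T Nn (\<lambda>y \<omega>. h_plus b (g y \<omega>)) (h_plus b) l K0 c" using field[OF bS] by blast
    have "AE \<omega> in M. noise_field.segment_small T (\<lambda>y \<omega>. h_plus b (g y \<omega>)) (\<pi> b) \<omega>"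
      using hom bS \<pi>A[OF b] by (intro noise_field.AE_segment_small[OF c]) (auto simp: semigroup_hom_def)
    then show ?thesis
      unfolding small_segments_def noise_field.segment_small_def[OF c] noise_field.Tball_def[OF c] by (simp add: Ball_def imp_conjL)
  qed
  have AE2: "AE \<omega> in M. sublinear s \<omega>" if s: "s \<in> F" for s
  proof -
    have sS: "s \<in> S" using s F by blast
    obtain c where c: "noise_field M T Nn (\<lambda>y \<omega>. h_plus s (g y \<omega>)) (h_plus s) l K0 c" using field[OF sS] by blast
    show ?thesis using noise_field.AE_sublinear[OF c]
      unfolding sublinear_def noise_field.sublinear_at_def[OF c] noise_field.Tball_def[OF c] by (simp add: Ball_def imp_conjL)
  qed
  let ?V = "asymptotic_cone S \<inter> S"
  define conv where "conv v \<omega> \<longleftrightarrow> (\<lambda>k::nat. ereal (h (real k *\<^sub>R v) \<omega> / real k)) \<longlonglongrightarrow> q v" for v \<omega>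
  have AE3: "AE \<omega> in M. conv v \<omega>" if "v \<in> ?V" for v
    using gauge that unfolding associated_gauge_def conv_def by blast
  \<comment> \<open>Convergence is given almost surely for each \<open>v\<close> separately;
    countability yields one null set for all.\<close>
  have "countable ?V" using countable_int_lattice B.S_lattice by (meson countable_subset inf.coboundedI2)
  then have "AE \<omega> in M. \<forall>v\<in>?V. conv v \<omega>" using AE3 by (simp add: AE_ball_countable)
  moreover have "AE \<omega> in M. \<forall>b\<in>A. small_segments b \<omega>" using AE1 B.finA by (simp add: AE_finite_all)
  moreover have "AE \<omega> in M. \<forall>s\<in>F. sublinear s \<omega>" using AE2 F(1) by (simp add: AE_finite_all)
  ultimately have "AE \<omega> in M. (\<forall>v\<in>?V. conv v \<omega>) \<and> (\<forall>b\<in>A. small_segments b \<omega>) \<and> (\<forall>s\<in>F. sublinear s \<omega>)"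
    by eventually_elim auto
  \<comment> \<open>The good event itself is not shown to be measurable; the complement of a
    measurable null set covering the exceptions serves as \<open>W\<close>.\<close>
  then obtain Z where Z: "Z \<in> sets M" "emeasure M Z = 0"
    "{\<omega> \<in> space M. \<not> ((\<forall>v\<in>?V. conv v \<omega>) \<and> (\<forall>b\<in>A. small_segments b \<omega>) \<and> (\<forall>s\<in>F. sublinear s \<omega>))} \<subseteq> Z"
    by (rule AE_E)
  show ?thesis
  proof (intro bexI[of _ "space M - Z"] conjI ballI allI impI)
    show "space M - Z \<in> sets M" using Z(1) by auto
    have "prob Z = 0" using Z(2) by (simp add: measure_def)
    then show "measure M (space M - Z) = 1" using prob_compl[OF Z(1)] by simp
    fix \<omega> x xs
    assume \<omega>: "\<omega> \<in> space M - Z" and x: "x \<in> asymptotic_cone S" and xs: "\<forall>k. xs k \<in> S"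
      and dir: "asymptotic_direction Nm xs x"
    have good: "\<forall>v\<in>?V. conv v \<omega>" "\<forall>b\<in>A. small_segments b \<omega>" "\<forall>s\<in>F. sublinear s \<omega>"
      using \<omega> Z(3) by blast+
    \<comment> \<open>Subadditivity evaluates \<open>h y\<close> at the shifted point and domination
      is applied there, so the increment depends on \<open>x\<close> only through
      \<open>\<pi> x\<close>.\<close>
    have step: "h (x + y) \<omega> \<le> h x \<omega> + h_plus y (g (\<pi> x) \<omega>)" if "x \<in> S" "y \<in> S" for x y
    proof -
      have "\<pi> x \<in> T" using hom that by (simp add: semigroup_hom_def)
      then have "g (\<pi> x) \<in> measurable M M"
        using act by (simp add: semigroup_action_def measure_preserving_map_def)
      then have "g (\<pi> x) \<omega> \<in> space M" using \<omega> by (auto dest: measurable_space)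
      then have "h y (g (\<pi> x) \<omega>) \<le> h_plus y (g (\<pi> x) \<omega>)" by (rule dom[OF that(2)])
      moreover have "h (x + y) \<omega> \<le> h x \<omega> + h y (f x \<omega>)"
        using subadd that \<omega> by (simp add: subadditive_random_function_def)
      ultimately show ?thesis using f[OF that(1)] by simp
    qed
    have comp: "\<exists>\<sigma>0>0. \<forall>\<sigma>. 0 < \<sigma> \<longrightarrow> \<sigma> \<le> \<sigma>0 \<longrightarrow> (\<exists>t0. \<forall>t\<ge>t0. \<forall>z\<in>S. \<forall>w\<in>S.
       norm z \<le> R * t \<longrightarrow> norm (w - z - (\<sigma> * t) *\<^sub>R \<Sum>A) \<le> \<delta> * (\<sigma> * t) \<longrightarrow> h w \<omega> \<le> h z \<omega> + \<epsilon> * t)"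
      if \<epsilon>: "\<epsilon> > 0" and R: "R > 0" for \<epsilon> R
    proof (rule B.comparison[where H = "\<lambda>x. h x \<omega>" and G = "\<lambda>b y. h_plus b (g y \<omega>)", OF hom K _ \<delta> \<tau>0 F dec _ _ \<epsilon> R])
      show "\<exists>\<eta>>0. \<exists>t0\<ge>1. \<forall>t\<ge>t0. \<forall>y\<in>T. norm y \<le> t \<longrightarrow> (\<forall>m. real m \<le> \<eta> * t \<longrightarrow>
          (\<Sum>j<m. h_plus b (g (y + real j *\<^sub>R \<pi> b) \<omega>)) \<le> \<epsilon> * t)" if "b \<in> A" "\<epsilon> > 0" for b \<epsilon>
        using good(2) that unfolding small_segments_def by blast
      show "\<exists>t0\<ge>1. \<forall>t\<ge>t0. \<forall>y\<in>T. norm y \<le> t \<longrightarrow> h_plus s (g y \<omega>) \<le> \<epsilon> * t" if "s \<in> F" "\<epsilon> > 0" for s \<epsilon>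
        using good(3) that unfolding sublinear_def by blast
    qed (use step in blast)+
    show "(\<lambda>k. ereal (h (xs k) \<omega> / Nm (xs k))) \<longlonglongrightarrow> q x"
    proof (rule B.directional_limit[where H = "\<lambda>x. h x \<omega>", OF \<delta> comp])
      show "gauge_on (asymptotic_cone S) q" using gauge by (simp add: associated_gauge_def)
      show "(\<lambda>k::nat. ereal (h (real k *\<^sub>R v) \<omega> / real k)) \<longlonglongrightarrow> q v" if "v \<in> asymptotic_cone S" "v \<in> S" for v
        using good(1) that by (auto simp: conv_def)
    qed (use x xs dir in \<open>auto simp: asymptotic_direction_def\<close>)
  qed
qed

end
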